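(* Let $q=p^r$ be a power of a prime $p$ with $r\ge 1$, let $n\ge 1$, let $V=\mathbb F_q^n$ be the natural $GL_n(q)$-module, let $I=(n_1,\dots,n_\ell)$ be a composition of $n$ with associated standard parabolic subgroup $P_I\subseteq GL_n(q)$, and put $m_i=n_1+\cdots+n_i$ for $1\le i\le\ell$. Then the Hilbert series $H\big((S^\bullet(V)\otimes\wedge^\bullet(V))^{P_I};t,s\big)=\sum_{i,j}t^is^j\dim_{\mathbb F_q}\big(S^i(V)\otimes\wedge^j(V)\big)^{P_I}$ is equal to $$\frac{1-t^{q^{m_1}-1}+\sum_{i=1}^{\ell-1}\big(t^{q^{m_i}-1}-t^{q^{m_{i+1}}-1}\big)\prod_{j=1}^{m_i}(1+st^{-q^{j-1}})+t^{q^n-1}\prod_{j=1}^n(1+st^{-q^{j-1}})}{\prod_{i=1}^{\ell}\prod_{j=1}^{n_i}\big(1-t^{q^{m_i}-q^{m_i-j}}\big)}.$$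
   Context: $GL_n(q)$ acts naturally on the symmetric algebra $S^\bullet(V)$ and the exterior algebra $\wedge^\bullet(V)$ of $V$ (over $\mathbb F_q$), and diagonally on their tensor product. A composition $I=(n_1,\dots,n_\ell)$ of $n$ is a sequence of positive integers with sum $n$. $P_I$ is the subgroup of $GL_n(q)$ of block upper triangular matrices with invertible diagonal blocks of sizes $n_1,\dots,n_\ell$ (in this order); matrices act on $V$ with basis $x_1,\dots,x_n$ by $g\cdot x_j=\sum_k g_{kj}x_k$. *)

theory Defs
  imports
    "HOL-Library.Poly_Mapping"
    "HOL-Computational_Algebra.Primes"
    "HOL-Computational_Algebra.Formal_Laurent_Series"
    "Jordan_Normal_Form.Matrix"
begin

section \<open>Symmetric algebra, exterior algebra and their tensor product\<close>

text \<open>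
  Let \<open>V\<close> have basis \<open>x\<^sub>0, \<dots>, x\<^sub>n\<^sub>-\<^sub>1\<close> (indices start at 0). Then \<open>S(V)\<close> is the polynomial
  ring in the \<open>x\<^sub>k\<close>, with the monomials as basis; the exterior algebra has as basis the products
  \<open>x\<^sub>J = x\<^bsub>j\<^sub>1\<^esub> \<and> \<dots> \<and> x\<^bsub>j\<^sub>r\<^esub>\<close> for the sets \<open>J = {j\<^sub>1 < \<dots> < j\<^sub>r}\<close>; and the tensor product has
  as basis the pairs. The types do not bound the variable indices: \<open>n\<close> enters through
  \<open>bigraded\<close> below.
\<close>

type_synonym 'k sym_alg = "(nat \<Rightarrow>\<^sub>0 nat) \<Rightarrow>\<^sub>0 'k"
type_synonym 'k ext_alg = "nat set \<Rightarrow>\<^sub>0 'k"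
type_synonym 'k sym_ext = "((nat \<Rightarrow>\<^sub>0 nat) \<times> nat set) \<Rightarrow>\<^sub>0 'k"

definition scale :: "'k::field \<Rightarrow> ('b \<Rightarrow>\<^sub>0 'k) \<Rightarrow> ('b \<Rightarrow>\<^sub>0 'k)" where
  "scale c u = Poly_Mapping.map ((*) c) u"

lemma lookup_scale: "Poly_Mapping.lookup (scale c u) b = c * Poly_Mapping.lookup u b"
  by (simp add: scale_def Poly_Mapping.map.rep_eq when_def)

interpretation scale: vector_space "scale :: 'k::field \<Rightarrow> ('b \<Rightarrow>\<^sub>0 'k) \<Rightarrow> ('b \<Rightarrow>\<^sub>0 'k)"
  by unfold_locales
    (auto intro!: poly_mapping_eqI simp: lookup_scale lookup_add algebra_simps)

definition monom_deg :: "(nat \<Rightarrow>\<^sub>0 nat) \<Rightarrow> nat" where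
  "monom_deg a = (\<Sum>k\<in>Poly_Mapping.keys a. Poly_Mapping.lookup a k)"

definition sym_var :: "nat \<Rightarrow> 'k::field sym_alg" where
  "sym_var k = Poly_Mapping.single (Poly_Mapping.single k 1) 1"

definition ext_var :: "nat \<Rightarrow> 'k::field ext_alg" where
  "ext_var k = Poly_Mapping.single {k} 1"

definition ext_one :: "'k::field ext_alg" where
  "ext_one = Poly_Mapping.single {} 1"

text \<open>
  On basis elements, \<open>x\<^sub>J \<and> x\<^sub>K\<close> is 0 if \<open>J\<close> and \<open>K\<close> meet, and otherwise \<open>x\<^bsub>J \<union> K\<^esub>\<close> with the sign
  of the permutation that sorts the concatenation of \<open>J\<close> and \<open>K\<close>, i.e. -1 to the number of its
  inversions.
\<close>

definition wedge_sign :: "nat set \<Rightarrow> nat set \<Rightarrow> 'k::field" where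
  "wedge_sign J K = (if J \<inter> K = {} then (- 1) ^ card {(j, k). j \<in> J \<and> k \<in> K \<and> k < j} else 0)"

definition wedge :: "'k::field ext_alg \<Rightarrow> 'k ext_alg \<Rightarrow> 'k ext_alg" where
  "wedge u v = (\<Sum>J\<in>Poly_Mapping.keys u. \<Sum>K\<in>Poly_Mapping.keys v.
     Poly_Mapping.single (J \<union> K)
       (wedge_sign J K * Poly_Mapping.lookup u J * Poly_Mapping.lookup v K))"

definition wedge_list :: "'k::field ext_alg list \<Rightarrow> 'k ext_alg" where
  "wedge_list us = foldr wedge us ext_one"

definition tensor :: "'k::field sym_alg \<Rightarrow> 'k ext_alg \<Rightarrow> 'k sym_ext" where
  "tensor f w = (\<Sum>a\<in>Poly_Mapping.keys f. \<Sum>J\<in>Poly_Mapping.keys w.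
     Poly_Mapping.single (a, J) (Poly_Mapping.lookup f a * Poly_Mapping.lookup w J))"

lemma wedge_single:
  "wedge (Poly_Mapping.single J a) (Poly_Mapping.single K b)
     = Poly_Mapping.single (J \<union> K) (wedge_sign J K * a * b)"
  by (simp add: wedge_def)

lemma ext_var_alternating: "wedge (ext_var j) (ext_var j) = 0"
  by (simp add: ext_var_def wedge_single wedge_sign_def)

lemma ext_var_anticommute:
  "wedge (ext_var j) (ext_var k) = - wedge (ext_var k) (ext_var j)"
proof -
  have *: "{(a, b). a = x \<and> b = y \<and> b < a} = (if y < x then {(x, y)} else {})" for x y :: nat
    by auto
  show ?thesis
    by (cases j k rule: linorder_cases)
      (simp_all add: ext_var_def wedge_single wedge_sign_def * single_uminus insert_commute
         cong: conj_cong)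
qed

lemma wedge_list_ext_vars:
  assumes "sorted_wrt (<) js"
  shows "wedge_list (map ext_var js) = Poly_Mapping.single (set js) 1"
  using assms
proof (induction js)
  case Nil
  then show ?case by (simp add: wedge_list_def ext_one_def)
next
  case (Cons j js)
  have *: "{(a, b). a = j \<and> b \<in> set js \<and> b < a} = {}"
    using Cons.prems by auto
  have "j \<notin> set js"
    using Cons.prems by auto
  then have "wedge_sign {j} (set js) = (1 :: 'a)"
    by (simp add: wedge_sign_def *)
  then show ?case
    using Cons by (simp add: wedge_list_def ext_var_def wedge_single)
qed


section \<open>The diagonal action\<close>

text \<open>
  The image of \<open>x\<^sub>j\<close> under an \<open>n \<times> n\<close> matrix \<open>g\<close> is \<open>\<Sum>\<^sub>k g\<^sub>k\<^sub>j x\<^sub>k\<close>; this extends to algebra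
  endomorphisms of both factors.
\<close>

definition sym_act :: "nat \<Rightarrow> 'k::field mat \<Rightarrow> 'k sym_alg \<Rightarrow> 'k sym_alg" where
  "sym_act n g f = (\<Sum>a\<in>Poly_Mapping.keys f. scale (Poly_Mapping.lookup f a)
     (\<Prod>j<n. (\<Sum>k<n. scale (g $$ (k, j)) (sym_var k)) ^ Poly_Mapping.lookup a j))"

definition ext_act :: "nat \<Rightarrow> 'k::field mat \<Rightarrow> 'k ext_alg \<Rightarrow> 'k ext_alg" where
  "ext_act n g w = (\<Sum>J\<in>Poly_Mapping.keys w. scale (Poly_Mapping.lookup w J)
     (wedge_list (map (\<lambda>j. \<Sum>k<n. scale (g $$ (k, j)) (ext_var k)) (sorted_list_of_set J))))"

definition diag_act :: "nat \<Rightarrow> 'k::field mat \<Rightarrow> 'k sym_ext \<Rightarrow> 'k sym_ext" where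
  "diag_act n g u = (\<Sum>(a, J)\<in>Poly_Mapping.keys u. scale (Poly_Mapping.lookup u (a, J))
     (tensor (sym_act n g (Poly_Mapping.single a 1)) (ext_act n g (Poly_Mapping.single J 1))))"

text \<open>The component \<open>S\<^sup>i(V) \<otimes> \<And>\<^sup>j(V)\<close>, for \<open>V\<close> of dimension \<open>n\<close>.\<close>

definition bigraded :: "nat \<Rightarrow> nat \<Rightarrow> nat \<Rightarrow> 'k::field sym_ext set" where
  "bigraded n i j = {u. \<forall>(a, J)\<in>Poly_Mapping.keys u.
     Poly_Mapping.keys a \<subseteq> {..<n} \<and> monom_deg a = i \<and> J \<subseteq> {..<n} \<and> card J = j}"


section \<open>Parabolic subgroups\<close>

definition composition :: "nat list \<Rightarrow> nat \<Rightarrow> bool" where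
  "composition I n \<longleftrightarrow> (\<forall>k\<in>set I. 0 < k) \<and> sum_list I = n"

definition partial_sum :: "nat list \<Rightarrow> nat \<Rightarrow> nat" where
  "partial_sum I i = sum_list (take i I)"

definition general_linear :: "nat \<Rightarrow> 'k::field mat set" where
  "general_linear n = {g \<in> carrier_mat n n. invertible_mat g}"

text \<open>
  With 0-based indices, block \<open>i\<close> consists of the rows and columns from \<open>partial_sum I i\<close> up to,
  but not including, \<open>partial_sum I (Suc i)\<close>. An entry lies below the diagonal blocks iff some
  \<open>partial_sum I i\<close> separates its column from its row.
\<close>

definition parabolic :: "nat list \<Rightarrow> 'k::field mat set" where
  "parabolic I = {g \<in> general_linear (sum_list I).
     (\<forall>i \<le> length I. \<forall>a < sum_list I. \<forall>b < partial_sum I i. partial_sum I i \<le> a \<longrightarrow> g $$ (a, b) = 0) \<and>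
     (\<forall>i < length I. invertible_mat
        (mat (I ! i) (I ! i) (\<lambda>(a, b). g $$ (partial_sum I i + a, partial_sum I i + b))))}"

definition parabolic_invariants :: "nat list \<Rightarrow> nat \<Rightarrow> nat \<Rightarrow> 'k::field sym_ext set" where
  "parabolic_invariants I i j = {u \<in> bigraded (sum_list I) i j.
     \<forall>g\<in>parabolic I. diag_act (sum_list I) g u = u}"


section \<open>Hilbert series\<close>

text \<open>
  The identity between Hilbert series and rational function is stated in the field of formal
  Laurent series in \<open>t\<close> over the field of formal Laurent series in \<open>s\<close> over the rationals. This
  field contains both the power series in \<open>s, t\<close> and the rational functions in \<open>s, t\<close>, and
  division in it expands \<open>1 / (1 - t\<^sup>d)\<close> as a geometric series.
\<close>

type_synonym bi_series = "rat fls fls"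

definition var_t :: bi_series where
  "var_t = fls_X"

definition var_s :: bi_series where
  "var_s = fls_const fls_X"

text \<open>The series \<open>\<Sum>\<^sub>i\<^sub>,\<^sub>j d i j t\<^sup>i s\<^sup>j\<close>.\<close>

definition double_series :: "(nat \<Rightarrow> nat \<Rightarrow> nat) \<Rightarrow> bi_series" where
  "double_series d = fps_to_fls (Abs_fps (\<lambda>i. fps_to_fls (Abs_fps (\<lambda>j. of_nat (d i j)))))"

text \<open>The type argument is the ground field.\<close>

definition hilbert_series :: "'k::field itself \<Rightarrow> nat list \<Rightarrow> bi_series" where
  "hilbert_series k I = double_series (\<lambda>i j.
     vector_space.dim scale (parabolic_invariants I i j :: 'k sym_ext set))"

end

theory Submission
  imports Defs
begin

text \<open>
  A form with coefficients in \<open>S(V)\<close> is determined by its iterated contractions \<open>\<iota>\<^sub>S\<close> with equivariant vectors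
  \<open>u\<^sub>t\<close> (\<open>t < n\<close>), where the \<open>x\<^sub>j\<close>-entry of \<open>u\<^sub>t\<close> is a power of the product of all \<open>x\<^sub>j + v\<close>, with \<open>v\<close> in the flag
  subspace before the block of \<open>t\<close>. The contractions of an invariant form are invariant polynomials.
  The torus and the transvections with root \<open>x\<^sub>c\<close> force \<open>\<iota>\<^sub>S\<close> of an invariant form to be divisible by \<open>x\<^sub>c\<^bsup>q-1\<^esup>\<close>,
  hence, by invariance, by the product of all nonzero vectors of \<open>V\<^sub>m\<close>, where \<open>m\<close> is the end of the block
  of \<open>Max S\<close>. Contracting the volume form of \<open>V\<^sub>m\<close> shows that this is the only restriction. So the
  invariant forms are a free module over the invariant polynomials with one generator for each \<open>S\<close>, of degree
  \<open>q\<^sup>m - 1 - \<Sum>\<^sub>s q\<^sup>s\<close> (the sum is over \<open>s \<in> S\<close>; degree 0 for \<open>S = {}\<close>).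

  For the invariant polynomials, setting \<open>x\<^sub>0 = 0\<close> is a surjection onto the \<open>q\<close>-th powers of the invariants of
  the induced flag in \<open>x\<^sub>1, x\<^sub>2, \<dots>\<close> (Dickson invariants lift), and the kernel is generated by the product of the
  nonzero vectors of the first flag subspace. This determines their Hilbert series recursively.
\<close>

section \<open>Substitutions and gradings\<close>

text \<open>Invariance is used in two strengths. Divisibility and exponent bounds use substitutions
  in a single variable. The polynomials fixed by these turn out to lie in an algebra of Dickson
  coefficients, which is fixed by everything that permutes the flag subspaces; this is how
  invariance passes to the whole parabolic subgroup. The contraction vectors must be equivariant,
  while injectivity of the iterated contractions asks for triangularity. The product of all
  \<open>x_j + v\<close> with \<open>v\<close> in the span of \<open>x_0, ..., x_(t-1)\<close> is
  triangular in \<open>j\<close>, but inside a block that span is not stable. So the span is frozen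
  at the start of the block and the missing degree is made up by the Frobenius map, which is linear
  over the ground field and so keeps equivariance. The number \<open>q - 1\<close> enters as the
  order of the group of units: the torus sees exponents only modulo \<open>q - 1\<close>. The degree
  of a generator is the degree \<open>q^m - 1\<close> of the forced divisor minus the degrees
  \<open>q^s\<close> that the contractions add. Since restriction to \<open>x_0 = 0\<close> lands in
  q-th powers, the comparison of invariant spaces is not linear; it is done by counting
  elements.\<close>

abbreviation lookup where "lookup \<equiv> Poly_Mapping.lookup"
abbreviation keys where "keys \<equiv> Poly_Mapping.keys"
abbreviation single where "single \<equiv> Poly_Mapping.single"
abbreviation cst :: "'k::field \<Rightarrow> 'k sym_alg" where "cst c \<equiv> single 0 c"
abbreviation var :: "nat \<Rightarrow> 'k::field sym_alg" where "var k \<equiv> sym_var k"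

lemma scale_conv_mult: "scale c f = cst c * (f :: 'k::field sym_alg)"
  by (simp add: scale_def mult_map_scale_conv_mult)

lemma poly_mapping_sum_single:
  assumes "finite A" "keys f \<subseteq> A"
  shows "f = (\<Sum>a\<in>A. single a (lookup f a))"
proof (rule poly_mapping_eqI)
  fix b
  have "lookup (\<Sum>a\<in>A. single a (lookup f a)) b = (\<Sum>a\<in>A. if b = a then lookup f a else 0)"
    by (auto simp: lookup_sum lookup_single when_def intro!: sum.cong)
  also have "\<dots> = lookup f b"
    using assms by (auto simp: in_keys_iff)
  finally show "lookup f b = lookup (\<Sum>a\<in>A. single a (lookup f a)) b" ..
qed

lemma poly_mapping_additive_induct [case_names single add]:
  assumes "\<And>a c. P (single a c)" "\<And>f g. P f \<Longrightarrow> P g \<Longrightarrow> P (f + g)"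
  shows "P (f :: 'a \<Rightarrow>\<^sub>0 'b::comm_monoid_add)"
proof -
  have "P (\<Sum>a\<in>A. single a (lookup f a))" if "finite A" for A
    using that
  proof (induction A)
    case empty
    then show ?case using assms(1)[of undefined 0] by simp
  qed (use assms in auto)
  from this[of "keys f"] show ?thesis
    by (simp flip: poly_mapping_sum_single[OF finite_keys subset_refl])
qed

lemma sym_alg_mult_left_cancel:
  assumes "f \<noteq> 0" "f * g = f * h" shows "g = (h :: 'k::field sym_alg)"
  using assms by (metis mult_left_cancel)

lemma sym_alg_mult_eq_0:
  assumes "f * g = 0" shows "f = 0 \<or> g = (0 :: 'k::field sym_alg)"
  using assms by (metis no_zero_divisors)

definition msubst :: "(nat \<Rightarrow> 'k::field sym_alg) \<Rightarrow> (nat \<Rightarrow>\<^sub>0 nat) \<Rightarrow> 'k sym_alg" where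
  "msubst \<sigma> a = (\<Prod>k\<in>keys a. \<sigma> k ^ lookup a k)"

definition psubst :: "(nat \<Rightarrow> 'k::field sym_alg) \<Rightarrow> 'k sym_alg \<Rightarrow> 'k sym_alg" where
  "psubst \<sigma> f = (\<Sum>a\<in>keys f. cst (lookup f a) * msubst \<sigma> a)"

lemma msubst_superset:
  assumes "finite A" "keys a \<subseteq> A"
  shows "msubst \<sigma> a = (\<Prod>k\<in>A. \<sigma> k ^ lookup a k)"
  unfolding msubst_def using assms by (intro prod.mono_neutral_left) (auto simp: in_keys_iff)

lemma msubst_add: "msubst \<sigma> (a + b) = msubst \<sigma> a * msubst \<sigma> b"
proof -
  let ?A = "keys a \<union> keys b"
  show ?thesis
    using keys_add[of a b]
    by (simp add: msubst_superset[of ?A] lookup_add power_add prod.distrib)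
qed

lemma msubst_0 [simp]: "msubst \<sigma> 0 = 1"
  by (simp add: msubst_def)

lemma psubst_superset:
  assumes "finite A" "keys f \<subseteq> A"
  shows "psubst \<sigma> f = (\<Sum>a\<in>A. cst (lookup f a) * msubst \<sigma> a)"
  unfolding psubst_def using assms by (intro sum.mono_neutral_left) (auto simp: in_keys_iff)

lemma psubst_add [simp]: "psubst \<sigma> (f + g) = psubst \<sigma> f + psubst \<sigma> g"
proof -
  let ?A = "keys f \<union> keys g"
  show ?thesis
    using keys_add[of f g]
    by (simp add: psubst_superset[of ?A] lookup_add single_add distrib_right sum.distrib)
qed

lemma psubst_0 [simp]: "psubst \<sigma> 0 = 0"
  by (simp add: psubst_def)

lemma psubst_single: "psubst \<sigma> (single a c) = cst c * msubst \<sigma> a"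
  by (simp add: psubst_def)

lemma psubst_cst [simp]: "psubst \<sigma> (cst c) = cst c"
  by (simp add: psubst_single)

lemma psubst_1 [simp]: "psubst \<sigma> 1 = 1"
  using psubst_cst[of \<sigma> 1] by simp

lemma psubst_var [simp]: "psubst \<sigma> (var k) = \<sigma> k"
  by (simp add: psubst_single sym_var_def msubst_def)

lemma psubst_mult [simp]: "psubst \<sigma> (f * g) = psubst \<sigma> f * psubst \<sigma> g"
proof (induction f rule: poly_mapping_additive_induct)
  case (single a c)
  show ?case
  proof (induction g rule: poly_mapping_additive_induct)
    case (single b d)
    have "cst (c * d) = cst c * cst d" by (simp add: mult_single)
    then show ?case by (simp add: mult_single psubst_single msubst_add mult_ac)
  qed (simp add: distrib_left)
qed (simp add: distrib_right)

lemma psubst_uminus [simp]: "psubst \<sigma> (- f) = - psubst \<sigma> f"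
  using psubst_add[of \<sigma> f "- f"] by (simp add: add_eq_0_iff)

lemma psubst_diff [simp]: "psubst \<sigma> (f - g) = psubst \<sigma> f - psubst \<sigma> g"
  using psubst_add[of \<sigma> f "- g"] by simp

lemma psubst_power [simp]: "psubst \<sigma> (f ^ k) = psubst \<sigma> f ^ k"
  by (induction k) auto

lemma psubst_sum [simp]: "psubst \<sigma> (sum f A) = (\<Sum>a\<in>A. psubst \<sigma> (f a))"
  by (induction A rule: infinite_finite_induct) auto

lemma psubst_prod [simp]: "psubst \<sigma> (prod f A) = (\<Prod>a\<in>A. psubst \<sigma> (f a))"
  by (induction A rule: infinite_finite_induct) auto

lemma psubst_cong: "(\<And>a k. a \<in> keys f \<Longrightarrow> k \<in> keys a \<Longrightarrow> \<sigma> k = \<tau> k) \<Longrightarrow> psubst \<sigma> f = psubst \<tau> f"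
  unfolding psubst_def msubst_def by (intro sum.cong prod.cong arg_cong2[where f = "(*)"]) auto

lemma single_conv_msubst_var: "msubst var a = single a 1"
proof -
  have var_power: "var k ^ m = single (single k m) 1" for k m
    by (induction m) (auto simp: sym_var_def mult_single simp flip: single_add)
  have "(\<Prod>k\<in>A. var k ^ lookup a k) = single (\<Sum>k\<in>A. single k (lookup a k)) 1" if "finite A" for A
    using that by (induction A) (auto simp: var_power mult_single)
  from this[of "keys a"] show ?thesis
    by (simp add: msubst_def flip: poly_mapping_sum_single[OF finite_keys subset_refl])
qed

lemma single_conv_mult: "single a c = cst c * msubst var a"
  by (simp add: single_conv_msubst_var mult_single)

lemma psubst_id [simp]: "psubst var f = f"
  by (induction f rule: poly_mapping_additive_induct)
    (simp_all only: psubst_single psubst_add single_conv_mult[symmetric])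

lemma psubst_psubst: "psubst \<tau> (psubst \<sigma> f) = psubst (\<lambda>k. psubst \<tau> (\<sigma> k)) f"
  by (induction f rule: poly_mapping_additive_induct) (simp_all add: psubst_single msubst_def)

text \<open>Constants and variables generate the ring. This serves for properties that are closed
  under products but awkward to check on monomials.\<close>

lemma poly_ring_induct [case_names cst var add mult]:
  assumes "\<And>c. P (cst c)" "\<And>k. P (var k)" "\<And>f g. P f \<Longrightarrow> P g \<Longrightarrow> P (f + g)"
    "\<And>f g. P f \<Longrightarrow> P g \<Longrightarrow> P (f * g)"
  shows "P (f :: 'k::field sym_alg)"
proof (induction f rule: poly_mapping_additive_induct)
  case (single a c)
  have one: "P 1" using assms(1)[of 1] by simp
  have pow: "P (g ^ m)" if "P g" for g m
    using that by (induction m) (auto simp: one assms)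
  have "P (\<Prod>k\<in>A. var k ^ lookup a k)" if "finite A" for A
    using that by (induction A) (auto simp: one assms pow)
  then have "P (msubst var a)" unfolding msubst_def by simp
  then show ?case using assms(1,4) by (subst single_conv_mult) blast
qed (rule assms(3))

definition var_subst :: "nat \<Rightarrow> 'k::field sym_alg \<Rightarrow> nat \<Rightarrow> 'k sym_alg" where
  "var_subst b v k = (if k = b then v else var k)"

lemma var_subst_same [simp]: "var_subst b v b = v"
  by (simp add: var_subst_def)

lemma var_subst_other [simp]: "k \<noteq> b \<Longrightarrow> var_subst b v k = var k"
  by (simp add: var_subst_def)

section \<open>Polynomials in a given set of variables\<close>

definition vars_in :: "nat set \<Rightarrow> 'k::field sym_alg \<Rightarrow> bool" where
  "vars_in A f \<longleftrightarrow> (\<forall>a\<in>keys f. keys a \<subseteq> A)"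

lemma psubst_vars_in_cong: "vars_in A f \<Longrightarrow> (\<And>k. k \<in> A \<Longrightarrow> \<sigma> k = \<tau> k) \<Longrightarrow> psubst \<sigma> f = psubst \<tau> f"
  unfolding vars_in_def by (intro psubst_cong) blast

lemma vars_in_add: "vars_in A f \<Longrightarrow> vars_in A g \<Longrightarrow> vars_in A (f + g)"
  using keys_add[of f g] unfolding vars_in_def by blast

lemma vars_in_mult: 
  assumes "vars_in A f" "vars_in A g" shows "vars_in A (f * g)"
  unfolding vars_in_def
proof
  fix a assume "a \<in> keys (f * g)"
  then obtain b c where "a = b + c" "b \<in> keys f" "c \<in> keys g"
    using keys_mult[of f g] by blast
  then show "keys a \<subseteq> A" using assms keys_add[of b c] unfolding vars_in_def by blast
qed

lemma vars_in_cst [simp]: "vars_in A (cst c)"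
  by (auto simp: vars_in_def split: if_splits)

lemma vars_in_0 [simp]: "vars_in A 0"
  by (auto simp: vars_in_def)

lemma vars_in_1 [simp]: "vars_in A 1"
  by (auto simp: vars_in_def)

lemma vars_in_var [simp]: "vars_in A (var k) \<longleftrightarrow> k \<in> A"
  by (auto simp: vars_in_def sym_var_def)

lemma vars_in_uminus [simp]: "vars_in A (- f) \<longleftrightarrow> vars_in A f"
  by (auto simp: vars_in_def in_keys_iff)

lemma vars_in_diff: "vars_in A f \<Longrightarrow> vars_in A g \<Longrightarrow> vars_in A (f - g)"
  using vars_in_add[of A f "- g"] by simp

lemma vars_in_scale: "vars_in A f \<Longrightarrow> vars_in A (scale c f)"
  by (simp add: scale_conv_mult vars_in_mult)

lemma vars_in_power: "vars_in A f \<Longrightarrow> vars_in A (f ^ k)"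
  by (induction k) (auto intro: vars_in_mult)

lemma vars_in_sum: "(\<And>i. i \<in> I \<Longrightarrow> vars_in A (f i)) \<Longrightarrow> vars_in A (sum f I)"
  by (induction I rule: infinite_finite_induct) (auto intro: vars_in_add)

lemma vars_in_prod: "(\<And>i. i \<in> I \<Longrightarrow> vars_in A (f i)) \<Longrightarrow> vars_in A (prod f I)"
  by (induction I rule: infinite_finite_induct) (auto intro: vars_in_mult)

lemma vars_in_mono: "vars_in A f \<Longrightarrow> A \<subseteq> B \<Longrightarrow> vars_in B f"
  unfolding vars_in_def by blast

lemma vars_in_psubst:
  assumes "vars_in A f" "\<And>k. k \<in> A \<Longrightarrow> vars_in B (\<sigma> k)"
  shows "vars_in B (psubst \<sigma> f)"
  unfolding psubst_def msubst_def using assms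
  by (intro vars_in_sum vars_in_mult vars_in_prod vars_in_power) (auto simp: vars_in_def[of A])

definition restrict_vars :: "nat set \<Rightarrow> nat \<Rightarrow> 'k::field sym_alg" where
  "restrict_vars A k = (if k \<in> A then var k else 0)"

text \<open>A condition on exponents becomes an equation between images under a ring homomorphism.
  In this form it survives cancellation of a factor and, later, extraction of q-th roots.\<close>

lemma vars_in_iff: "vars_in A f \<longleftrightarrow> psubst (restrict_vars A) f = f"
proof
  assume "vars_in A f"
  then have "psubst (restrict_vars A) f = psubst var f"
    by (rule psubst_vars_in_cong) (auto simp: restrict_vars_def)
  then show "psubst (restrict_vars A) f = f" by simp
next
  assume *: "psubst (restrict_vars A) f = f"
  have "vars_in UNIV f" by (simp add: vars_in_def)
  then have "vars_in A (psubst (restrict_vars A) f)"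
    by (rule vars_in_psubst) (auto simp: restrict_vars_def)
  then show "vars_in A f" unfolding * .
qed

lemma vars_in_cancel:
  assumes "vars_in A (f * g)" "vars_in A f" "f \<noteq> 0"
  shows "vars_in A g"
proof -
  have "f * psubst (restrict_vars A) g = f * g"
    using assms(1,2) unfolding vars_in_iff psubst_mult by metis
  with assms(3) show ?thesis unfolding vars_in_iff by (rule sym_alg_mult_left_cancel)
qed

section \<open>The grading by total degree\<close>

lemma monom_deg_superset:
  assumes "finite A" "keys a \<subseteq> A"
  shows "monom_deg a = (\<Sum>k\<in>A. lookup a k)"
  unfolding monom_deg_def using assms by (intro sum.mono_neutral_left) (auto simp: in_keys_iff)

lemma monom_deg_add: "monom_deg (a + b) = monom_deg a + monom_deg b"
proof -
  let ?A = "keys a \<union> keys b"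
  show ?thesis
    using keys_add[of a b]
    by (simp add: monom_deg_superset[of ?A] lookup_add sum.distrib)
qed

lemma monom_deg_0 [simp]: "monom_deg 0 = 0"
  by (simp add: monom_deg_def)

definition homogeneous :: "nat \<Rightarrow> 'k::field sym_alg \<Rightarrow> bool" where
  "homogeneous d f \<longleftrightarrow> (\<forall>a\<in>keys f. monom_deg a = d)"

lemma homogeneous_0 [simp]: "homogeneous d 0"
  by (simp add: homogeneous_def)

lemma homogeneous_cst [simp]: "homogeneous 0 (cst c)"
  by (auto simp: homogeneous_def split: if_splits)

lemma homogeneous_1 [simp]: "homogeneous 0 1"
  by (auto simp: homogeneous_def)

lemma homogeneous_var [simp]: "homogeneous (Suc 0) (var k)"
  by (auto simp: homogeneous_def sym_var_def monom_deg_def)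

lemma homogeneous_add: "homogeneous d f \<Longrightarrow> homogeneous d g \<Longrightarrow> homogeneous d (f + g)"
  using keys_add[of f g] unfolding homogeneous_def by blast

lemma homogeneous_uminus [simp]: "homogeneous d (- f) \<longleftrightarrow> homogeneous d f"
  by (auto simp: homogeneous_def in_keys_iff)

lemma homogeneous_diff: "homogeneous d f \<Longrightarrow> homogeneous d g \<Longrightarrow> homogeneous d (f - g)"
  using homogeneous_add[of d f "- g"] by simp

lemma homogeneous_mult:
  assumes "homogeneous d f" "homogeneous e g"
  shows "homogeneous (d + e) (f * g)"
  unfolding homogeneous_def
proof
  fix a assume "a \<in> keys (f * g)"
  then obtain b c where "a = b + c" "b \<in> keys f" "c \<in> keys g"
    using keys_mult[of f g] by blast
  then show "monom_deg a = d + e" using assms by (auto simp: homogeneous_def monom_deg_add)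
qed

lemma homogeneous_scale: "homogeneous d f \<Longrightarrow> homogeneous d (scale c f)"
  using homogeneous_mult[of 0 "cst c" d f] by (simp add: scale_conv_mult)

lemma homogeneous_power: "homogeneous d f \<Longrightarrow> homogeneous (d * k) (f ^ k)"
  by (induction k) (auto dest: homogeneous_mult)

lemma homogeneous_sum: "(\<And>i. i \<in> I \<Longrightarrow> homogeneous d (f i)) \<Longrightarrow> homogeneous d (sum f I)"
  by (induction I rule: infinite_finite_induct) (auto intro: homogeneous_add)

lemma homogeneous_prod:
  "(\<And>i. i \<in> I \<Longrightarrow> homogeneous (d i) (f i)) \<Longrightarrow> homogeneous (sum d I) (prod f I)"
  by (induction I rule: infinite_finite_induct) (auto intro: homogeneous_mult)

lemma homogeneous_psubst:
  assumes "homogeneous d f" "\<And>k. homogeneous (Suc 0) (\<sigma> k)"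
  shows "homogeneous d (psubst \<sigma> f)"
  unfolding psubst_def
proof (rule homogeneous_sum)
  fix a assume "a \<in> keys f"
  then have d: "d = (\<Sum>k\<in>keys a. lookup a k)" using assms(1)
    by (auto simp: homogeneous_def monom_deg_def)
  have "homogeneous d (msubst \<sigma> a)"
    unfolding msubst_def d using homogeneous_power[OF assms(2), of "lookup a _"]
    by (intro homogeneous_prod) simp
  then show "homogeneous d (cst (lookup f a) * msubst \<sigma> a)"
    using homogeneous_mult[OF homogeneous_cst] by fastforce
qed

definition hcomp :: "nat \<Rightarrow> 'k::field sym_alg \<Rightarrow> 'k sym_alg" where
  "hcomp d f = (\<Sum>a\<in>{a\<in>keys f. monom_deg a = d}. single a (lookup f a))"

lemma lookup_hcomp: "lookup (hcomp d f) a = (if monom_deg a = d then lookup f a else 0)"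
proof -
  have "lookup (hcomp d f) a =
      (\<Sum>b\<in>{b\<in>keys f. monom_deg b = d}. if a = b then lookup f b else 0)"
    by (auto simp: hcomp_def lookup_sum lookup_single when_def intro!: sum.cong)
  also have "\<dots> = (if monom_deg a = d then lookup f a else 0)"
    by (auto simp: in_keys_iff)
  finally show ?thesis .
qed

lemma hcomp_add: "hcomp d (f + g) = hcomp d f + hcomp d g"
  by (rule poly_mapping_eqI) (simp add: lookup_hcomp lookup_add)

lemma hcomp_homogeneous: "homogeneous d f \<Longrightarrow> hcomp e f = (if e = d then f else 0)"
  by (rule poly_mapping_eqI) (auto simp: lookup_hcomp homogeneous_def in_keys_iff)

lemma hcomp_single: "hcomp d (single a c) = (if monom_deg a = d then single a c else 0)"
  by (rule poly_mapping_eqI) (auto simp: lookup_hcomp lookup_single when_def)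

lemma hcomp_mult:
  assumes "homogeneous e f"
  shows "hcomp d (f * g) = (if e \<le> d then f * hcomp (d - e) g else 0)"
proof (induction g rule: poly_mapping_additive_induct)
  case (single a c)
  have "homogeneous (e + monom_deg a) (f * single a c)"
    by (rule homogeneous_mult[OF assms]) (auto simp: homogeneous_def split: if_splits)
  from hcomp_homogeneous[OF this, of d] show ?case by (auto simp: hcomp_single)
qed (simp add: distrib_left hcomp_add)

lemma hcomp_eq_0_imp: "(\<And>d. hcomp d f = 0) \<Longrightarrow> f = 0"
  by (rule poly_mapping_eqI) (metis lookup_hcomp lookup_zero)

text \<open>As \<open>f\<close> is homogeneous, the component of \<open>f * g\<close> in degree
  \<open>i + e\<close> is \<open>f\<close> times the component of \<open>g\<close> in degree
  \<open>i\<close>, and the ring is a domain. The second conclusion covers the case in which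
  \<open>d - e\<close> is truncated.\<close>

lemma homogeneous_cancel:
  assumes "homogeneous d (f * g)" "homogeneous e f" "f \<noteq> 0"
  shows "homogeneous (d - e) g" "d < e \<Longrightarrow> g = 0"
proof -
  have *: "hcomp i g = 0" if "i + e \<noteq> d" for i
  proof -
    have "f * hcomp i g = hcomp (i + e) (f * g)"
      by (simp add: hcomp_mult[OF assms(2)])
    also have "\<dots> = 0" using hcomp_homogeneous[OF assms(1)] that by auto
    finally show ?thesis using assms(3) sym_alg_mult_eq_0 by blast
  qed
  show "homogeneous (d - e) g"
    unfolding homogeneous_def
  proof
    fix a assume "a \<in> keys g"
    then have "hcomp (monom_deg a) g \<noteq> 0" by (metis in_keys_iff lookup_hcomp lookup_zero)
    then have "monom_deg a + e = d" using * by blast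
    then show "monom_deg a = d - e" by linarith
  qed
  show "g = 0" if "d < e"
  proof (rule hcomp_eq_0_imp)
    fix i show "hcomp i g = 0" using *[of i] that by linarith
  qed
qed

lemma homogeneous_0_imp_cst:
  assumes "homogeneous 0 f" shows "f = cst (lookup f 0)"
proof (rule poly_mapping_eqI)
  fix a
  have *: "lookup f a = 0" if "a \<noteq> 0"
  proof (rule ccontr)
    assume **: "lookup f a \<noteq> 0"
    have "monom_deg a = 0" using assms ** by (auto simp: homogeneous_def in_keys_iff)
    then have "lookup a k = 0" if "k \<in> keys a" for k
      using that by (auto simp: monom_deg_def)
    then have "lookup a k = lookup 0 k" for k by (auto simp: in_keys_iff)
    then have "a = 0" by (rule poly_mapping_eqI)
    with that show False by blast
  qed
  show "lookup f a = lookup (cst (lookup f 0)) a"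
    unfolding lookup_single when_def using * by metis
qed

lemma cst_power: "cst c ^ i = cst (c ^ i :: 'k::field)"
  by (induction i) (auto simp: mult_single)

lemma prime_CHAR_finite_field: "prime CHAR('k::{field,finite})"
  by (intro prime_CHAR_semidom finite_imp_CHAR_pos finite)

lemma CHAR_poly_mapping: "CHAR('a::comm_monoid_add \<Rightarrow>\<^sub>0 'k::comm_semiring_1) = CHAR('k)"
proof -
  have single_eq_0: "single 0 c = (0 :: 'a \<Rightarrow>\<^sub>0 'k) \<longleftrightarrow> c = 0" for c
    by (metis lookup_single_eq lookup_zero single_zero)
  have "of_nat m = (0 :: 'a \<Rightarrow>\<^sub>0 'k) \<longleftrightarrow> of_nat m = (0 :: 'k)" for m
    unfolding single_of_nat[symmetric] by (rule single_eq_0)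
  then show ?thesis by (intro CHAR_eqI) (simp_all add: of_nat_eq_0_iff_char_dvd)
qed

section \<open>Linear forms over a finite field\<close>

text \<open>\<open>ground\<close> ties the field type to the locale. Writing \<open>q\<close> as a
  power of the characteristic is what makes the q-th power additive on polynomials.\<close>

locale coeff_field =
  fixes q :: nat and ground :: "'k::{field, finite} itself"
  assumes q_card: "q = card (UNIV :: 'k set)" and q_char: "\<exists>r. q = CHAR('k) ^ r"
begin

lemma q_ge_2: "q \<ge> 2"
proof -
  have "card {0, 1 :: 'k} \<le> q" unfolding q_card by (rule card_mono) auto
  then show ?thesis by simp
qed

lemma q_pos: "q > 0" and q_gt_1: "q > 1"
  using q_ge_2 by auto

text \<open>Multiplication by \<open>c\<close> permutes the units, so it leaves their product
  unchanged.\<close>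

lemma unit_power: "c ^ (q - 1) = 1" if "c \<noteq> 0" for c :: 'k
proof -
  have "(\<Prod>d\<in>UNIV-{0}. c * d) = (\<Prod>d\<in>UNIV-{0}. d)"
    by (rule prod.reindex_bij_witness[of _ "\<lambda>y. y / c" "\<lambda>y. c * y"]) (use that in auto)
  then have "c ^ (q - 1) * (\<Prod>d\<in>UNIV-{0}. d) = (\<Prod>d\<in>UNIV-{0}. d)"
    by (simp add: prod.distrib q_card)
  moreover have "(\<Prod>d\<in>UNIV-{0}. d) \<noteq> (0 :: 'k)" by simp
  ultimately show ?thesis by simp
qed

lemma field_power_q: "(c :: 'k) ^ q = c"
proof (cases "c = 0")
  case False
  then show ?thesis using unit_power[OF False] q_pos
    by (metis mult.right_neutral power_minus_mult mult_1)
qed (use q_pos in auto)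

lemma field_power_q_power: "(c :: 'k) ^ (q ^ i) = c"
  by (induction i) (auto simp: power_mult field_power_q)

text \<open>Otherwise the nonzero remainder \<open>i\<close> of \<open>e\<close> modulo
  \<open>q - 1\<close> would give the polynomial \<open>x^i - 1\<close> all \<open>q - 1\<close>
  units as roots, more than its degree.\<close>

lemma dvd_of_power_eq_1:
  assumes "\<And>c :: 'k. c \<noteq> 0 \<Longrightarrow> c ^ e = 1" shows "(q - 1) dvd e"
proof (rule ccontr)
  assume nd: "\<not> (q - 1) dvd e"
  define i where "i = e mod (q - 1)"
  have i: "0 < i" "i < q - 1"
    using nd q_gt_1 by (auto simp: i_def mod_greater_zero_iff_not_dvd)
  have root: "c ^ i = 1" if "c \<noteq> 0" for c :: 'k
  proof -
    have "c ^ e = (c ^ (q - 1)) ^ (e div (q - 1)) * c ^ i"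
      by (simp add: i_def flip: power_mult power_add)
    then show ?thesis using assms[OF that] unit_power[OF that] by simp
  qed
  define p where "p = Polynomial.monom (1 :: 'k) i - 1"
  have "Polynomial.coeff p i = 1" using i by (simp add: p_def)
  then have "p \<noteq> 0" by auto
  have "degree p \<le> i" unfolding p_def by (intro degree_diff_le) (auto simp: degree_monom_le)
  have "UNIV - {0} \<subseteq> {c. poly p c = 0}"
    using root by (auto simp: p_def poly_monom)
  then have "card (UNIV - {0 :: 'k}) \<le> card {c. poly p c = 0}"
    by (intro card_mono) auto
  also have "\<dots> \<le> degree p" by (rule card_poly_roots_bound[OF \<open>p \<noteq> 0\<close>])
  finally show False using \<open>degree p \<le> i\<close> i by (simp add: q_card)
qed

section \<open>Additivity of the q-th power\<close>

lemma prime_CHAR_sym_alg: "prime CHAR('k sym_alg)"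
  by (simp add: CHAR_poly_mapping prime_CHAR_finite_field)

lemma frob_add: "(f + g) ^ (q ^ i) = f ^ (q ^ i) + (g :: 'k sym_alg) ^ (q ^ i)"
proof -
  obtain r where r: "q = CHAR('k) ^ r" using q_char by blast
  show ?thesis
    by (rule freshmans_dream'[OF prime_CHAR_sym_alg, where n = "r * i"])
      (simp add: r CHAR_poly_mapping power_mult)
qed

lemma frob_add_poly: "(f + g) ^ q = f ^ q + (g :: 'k sym_alg poly) ^ q"
proof -
  obtain r where r: "q = CHAR('k) ^ r" using q_char by blast
  show ?thesis
    by (rule freshmans_dream'[where n = r])
      (use prime_CHAR_sym_alg in \<open>simp_all add: r CHAR_poly_mapping\<close>)
qed

lemma frob_sum_poly: "(sum f A) ^ q = (\<Sum>a\<in>A. (f a :: 'k sym_alg poly) ^ q)"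
  by (induction A rule: infinite_finite_induct) (use q_pos in \<open>auto simp: frob_add_poly\<close>)

lemma frob_scale: "(cst c * f) ^ (q ^ i) = cst c * (f :: 'k sym_alg) ^ (q ^ i)"
  by (simp add: power_mult_distrib cst_power field_power_q_power)

lemma frob_uminus: "(- f) ^ (q ^ i) = - ((f :: 'k sym_alg) ^ (q ^ i))"
proof -
  have "f ^ (q ^ i) + (- f) ^ (q ^ i) = 0"
    using q_pos by (simp add: zero_power flip: frob_add)
  then show ?thesis by (metis add.inverse_unique)
qed

lemma frob_diff: "(f - g) ^ (q ^ i) = f ^ (q ^ i) - (g :: 'k sym_alg) ^ (q ^ i)"
  using frob_add[of f "- g" i] frob_uminus by simp

lemma sym_alg_power_eq_0: "f ^ i = 0 \<Longrightarrow> f = (0 :: 'k sym_alg)"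
proof (induction i)
  case (Suc i)
  then show ?case using sym_alg_mult_eq_0[of f "f ^ i"] by auto
qed simp

lemma frob_inject: "f ^ q = g ^ q \<Longrightarrow> f = (g :: 'k sym_alg)"
  using frob_diff[of f g 1] sym_alg_power_eq_0[of "f - g" q] by simp

lemma cst_eq_0_iff: "cst c = (0 :: 'k sym_alg) \<longleftrightarrow> c = 0"
  by (metis lookup_single_eq lookup_zero single_zero)

text \<open>As polynomials in \<open>f\<close> both sides are monic of degree \<open>q\<close> and
  vanish at the points \<open>- (cst c * g)\<close>. These points are distinct only for
  \<open>g\<close> nonzero, hence the separate case.\<close>

lemma prod_translates:
  fixes f g :: "'k sym_alg"
  shows "(\<Prod>c\<in>UNIV. f + cst c * g) = f ^ q - g ^ (q - 1) * f"
proof (cases "g = 0")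
  case True
  then show ?thesis using q_ge_2 by (simp add: q_card zero_power)
next
  case False
  define A where "A = (\<Prod>c\<in>UNIV. [:cst c * g, 1:])"
  define B where "B = Polynomial.monom 1 q + Polynomial.monom (- (g ^ (q - 1))) 1"
  have degA: "degree A = q" and lcA: "lead_coeff A = 1"
    unfolding A_def by (subst degree_prod_eq_sum_degree; simp add: q_card) (simp add: lead_coeff_prod)
  have degB: "degree B = q" 
    unfolding B_def using q_ge_2
    by (subst degree_add_eq_left) (auto simp: degree_monom_eq intro: le_less_trans[OF degree_monom_le])
  have lcB: "lead_coeff B = 1"
    using degB q_ge_2 by (simp add: B_def)
  have inj: "inj (\<lambda>c. - (cst c * g))"
  proof (rule injI)
    fix c d assume "- (cst c * g) = - (cst d * g)"
    then have "cst (c - d) * g = 0" by (simp add: single_diff left_diff_distrib)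
    then show "c = d" using False sym_alg_mult_eq_0 cst_eq_0_iff by force
  qed
  have "A = B"
  proof (rule poly_eqI_degree_lead_coeff[where n = q and A = "range (\<lambda>c. - (cst c * g))"])
    show "card (range (\<lambda>c. - (cst c * g))) \<ge> q"
      using card_image[OF inj] by (simp add: q_card)
    fix z assume "z \<in> range (\<lambda>c. - (cst c * g))"
    then obtain c where z: "z = - (cst c * g)" by auto
    have "poly A z = 0" by (auto simp: A_def poly_prod z)
    moreover have "poly B z = 0"
      using frob_scale[of "- c" g 1] power_minus_mult[OF q_pos, of g]
      by (simp add: B_def poly_monom z single_uminus mult_ac)
    ultimately show "poly A z = poly B z" by simp
  qed (use degA degB lcA lcB in auto)
  then have "poly A f = poly B f" by simp
  then show ?thesis by (simp add: A_def B_def poly_prod poly_monom add_ac)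
qed

section \<open>Subspaces of linear forms spanned by consecutive variables\<close>

definition V :: "nat \<Rightarrow> nat \<Rightarrow> 'k sym_alg set" where
  "V a m = {v. \<exists>c. v = (\<Sum>k = a..<m. cst (c k) * var k)}"

lemma V_empty: "m \<le> a \<Longrightarrow> V a m = {0}"
  by (auto simp: V_def)

lemma V_Suc: "a \<le> m \<Longrightarrow> V a (Suc m) = (\<lambda>(v, c). v + cst c * var m) ` (V a m \<times> UNIV)"
proof (intro equalityI subsetI)
  fix w assume a: "a \<le> m" and "w \<in> V a (Suc m)"
  then obtain c where w: "w = (\<Sum>k = a..<m. cst (c k) * var k) + cst (c m) * var m"
    by (auto simp: V_def)
  then show "w \<in> (\<lambda>(v, c). v + cst c * var m) ` (V a m \<times> UNIV)"
    by (auto simp: V_def)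
next
  fix w assume a: "a \<le> m" and "w \<in> (\<lambda>(v, c). v + cst c * var m) ` (V a m \<times> UNIV)"
  then obtain c d where w: "w = (\<Sum>k = a..<m. cst (c k) * var k) + cst d * var m"
    by (auto simp: V_def)
  also have "\<dots> = (\<Sum>k = a..<Suc m. cst ((c(m := d)) k) * var k)"
    using a by (auto intro!: sum.cong)
  finally show "w \<in> V a (Suc m)" by (auto simp: V_def simp del: fun_upd_apply)
qed

lemma V_0 [simp]: "0 \<in> V a m"
  unfolding V_def by (auto intro!: exI[of _ "\<lambda>_. 0"])

lemma V_add: "v \<in> V a m \<Longrightarrow> w \<in> V a m \<Longrightarrow> v + w \<in> V a m"
proof -
  assume "v \<in> V a m" "w \<in> V a m"
  then obtain c d where "v = (\<Sum>k = a..<m. cst (c k) * var k)" "w = (\<Sum>k = a..<m. cst (d k) * var k)"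
    by (auto simp: V_def)
  then have "v + w = (\<Sum>k = a..<m. cst (c k + d k) * var k)"
    by (simp add: single_add distrib_right sum.distrib)
  then show ?thesis by (auto simp: V_def)
qed

lemma V_scale: "v \<in> V a m \<Longrightarrow> cst c * v \<in> V a m"
proof -
  assume "v \<in> V a m"
  then obtain d where "v = (\<Sum>k = a..<m. cst (d k) * var k)" by (auto simp: V_def)
  then have "cst c * v = (\<Sum>k = a..<m. cst (c * d k) * var k)"
    by (simp add: sum_distrib_left mult_single flip: mult.assoc)
  then show ?thesis by (auto simp: V_def)
qed

lemma V_uminus: "v \<in> V a m \<Longrightarrow> - v \<in> V a m"
  using V_scale[of v a m "- 1"] by (simp add: single_uminus)

lemma V_sum: "(\<And>i. i \<in> I \<Longrightarrow> f i \<in> V a m) \<Longrightarrow> sum f I \<in> V a m"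
  by (induction I rule: infinite_finite_induct) (auto intro: V_add)

lemma V_var: "a \<le> k \<Longrightarrow> k < m \<Longrightarrow> var k \<in> V a m"
proof -
  assume "a \<le> k" "k < m"
  then have "var k = (\<Sum>i = a..<m. if i = k then var i else 0)"
    by simp
  also have "\<dots> = (\<Sum>i = a..<m. cst (if i = k then 1 else 0) * var i)"
    by (rule sum.cong) auto
  finally have "var k = (\<Sum>i = a..<m. cst (if i = k then 1 else 0) * var i)" .
  then show ?thesis by (auto simp: V_def)
qed

lemma V_mono: "a' \<le> a \<Longrightarrow> m \<le> m' \<Longrightarrow> V a m \<subseteq> V a' m'"
proof
  fix v assume *: "a' \<le> a" "m \<le> m'" and "v \<in> V a m"
  then obtain c where "v = (\<Sum>k = a..<m. cst (c k) * var k)" by (auto simp: V_def)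
  then show "v \<in> V a' m'" using * by (auto intro!: V_sum V_scale V_var)
qed

lemma V_vars_in: "v \<in> V a m \<Longrightarrow> vars_in {a..<m} v"
  unfolding V_def by (auto intro!: vars_in_sum vars_in_mult)

lemma V_homogeneous: "v \<in> V a m \<Longrightarrow> homogeneous (Suc 0) v"
  unfolding V_def using homogeneous_mult[OF homogeneous_cst homogeneous_var]
  by (auto intro!: homogeneous_sum)

lemma psubst_V: "v \<in> V a m \<Longrightarrow> (\<And>k. a \<le> k \<Longrightarrow> k < m \<Longrightarrow> \<sigma> k = \<tau> k) \<Longrightarrow> psubst \<sigma> v = psubst \<tau> v"
  by (rule psubst_vars_in_cong[OF V_vars_in]) auto

lemma psubst_V_id: "v \<in> V a m \<Longrightarrow> (\<And>k. a \<le> k \<Longrightarrow> k < m \<Longrightarrow> \<sigma> k = var k) \<Longrightarrow> psubst \<sigma> v = v"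
  using psubst_V[of v a m \<sigma> var] by simp

lemma psubst_in_V:
  assumes "v \<in> V a m" "\<And>k. a \<le> k \<Longrightarrow> k < m \<Longrightarrow> \<sigma> k \<in> V a' m'"
  shows "psubst \<sigma> v \<in> V a' m'"
proof -
  obtain c where "v = (\<Sum>k = a..<m. cst (c k) * var k)" using assms by (auto simp: V_def)
  then show ?thesis using assms(2) by (auto intro!: V_sum V_scale)
qed

text \<open>Setting \<open>x_m = 0\<close> isolates the parts in lower variables; setting all
  variables to 1 in what remains isolates the scalars.\<close>

lemma coeff_separates:
  assumes "v \<in> V a m" "w \<in> V a m" "v + cst c * var m = w + cst d * var m"
  shows "v = w \<and> c = d"
proof -
  let ?\<sigma> = "var_subst m 0"
  have "psubst ?\<sigma> u = u" if "u \<in> V a m" for u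
    by (rule psubst_V_id[OF that]) auto
  then have "psubst ?\<sigma> v = v" "psubst ?\<sigma> w = w" using assms by blast+
  then have vw: "v = w" using arg_cong[OF assms(3), of "psubst ?\<sigma>"] by simp
  then have "cst c * var m = cst d * var m" using assms(3) by (metis add_left_cancel)
  then have "psubst (\<lambda>_. 1) (cst c * var m) = psubst (\<lambda>_. 1) (cst d * var m)" by (rule arg_cong)
  then have "cst c = cst d" unfolding psubst_mult psubst_cst psubst_var mult_1_right .
  then have "c = d" by (metis lookup_single_eq)
  with vw show ?thesis by simp
qed

lemma inj_V_Suc: "inj_on (\<lambda>(v, c). v + cst c * var m) (V a m \<times> UNIV)"
  using coeff_separates by (auto simp: inj_on_def)

lemma finite_V: "finite (V a m)"
proof (cases "a \<le> m")
  case True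
  then show ?thesis
    by (induction rule: dec_induct) (auto simp: V_empty V_Suc)
qed (simp add: V_empty)

lemma card_V: "card (V a m) = q ^ (m - a)"
proof (cases "a \<le> m")
  case True
  then show ?thesis
    by (induction rule: dec_induct)
      (auto simp: V_empty V_Suc card_image[OF inj_V_Suc] card_cartesian_product q_card Suc_diff_le)
qed (simp add: V_empty)

section \<open>Divisibility by linear forms\<close>

lemma dvd_psubst_diff: "(var b - v) dvd (f - psubst (var_subst b v) f)"
proof (induction f rule: poly_ring_induct)
  case (add f g)
  then show ?case using dvd_add[OF add] by (simp add: algebra_simps)
next
  case (mult f g)
  let ?s = "psubst (var_subst b v)"
  have *: "f * g - ?s (f * g) = f * (g - ?s g) + (f - ?s f) * ?s g" by (simp add: algebra_simps)
  show ?case unfolding * by (intro dvd_add dvd_mult dvd_mult2 mult)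
qed (auto simp: var_subst_def)

text \<open>The factor theorem: modulo \<open>var b - v\<close> a polynomial agrees with its value
  at \<open>x_b = v\<close>. The assumption expresses that \<open>v\<close> is unaffected by that
  substitution.\<close>

lemma dvd_iff_psubst_eq_0:
  assumes "psubst (var_subst b v) v = v"
  shows "(var b - v) dvd f \<longleftrightarrow> psubst (var_subst b v) f = 0"
proof
  assume "(var b - v) dvd f"
  then obtain g where "f = (var b - v) * g" by blast
  then show "psubst (var_subst b v) f = 0" using assms by simp
qed (use dvd_psubst_diff[of b v f] in simp)

text \<open>Each line of linear forms contains exactly one such vector, the one with coefficient 1
  at its highest variable. Distinct ones are pairwise non-associated primes.\<close>

definition normalized :: "'k sym_alg \<Rightarrow> bool" where
  "normalized \<alpha> \<longleftrightarrow> (\<exists>b v. v \<in> V 0 b \<and> \<alpha> = var b + v)"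

lemma normalized_dvd_iff:
  assumes "v \<in> V 0 b" shows "(var b + v) dvd f \<longleftrightarrow> psubst (var_subst b (- v)) f = 0"
  using dvd_iff_psubst_eq_0[of b "- v" f] psubst_V_id[OF V_uminus[OF assms], of "var_subst b (- v)"]
  by simp

lemma var_dvd_iff: "var b dvd (f :: 'k sym_alg) \<longleftrightarrow> psubst (var_subst b 0) f = 0"
  using normalized_dvd_iff[OF V_0, of b f] by simp

lemma normalized_prime:
  assumes "normalized \<alpha>" "\<alpha> dvd f * g" shows "\<alpha> dvd f \<or> \<alpha> dvd g"
proof -
  obtain b v where *: "v \<in> V 0 b" "\<alpha> = var b + v" using assms by (auto simp: normalized_def)
  show ?thesis
    using assms(2) sym_alg_mult_eq_0 unfolding * normalized_dvd_iff[OF *(1)] by auto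
qed

text \<open>Test divisibility by substituting \<open>x_b = - v\<close> into \<open>\<beta>\<close>.
  If both have the same highest variable, \<open>w - v\<close> remains; if that of
  \<open>\<beta>\<close> is lower, \<open>\<beta>\<close> is unchanged; if it is higher, it survives
  with coefficient 1.\<close>

lemma normalized_not_dvd:
  assumes "normalized \<alpha>" "normalized \<beta>" "\<alpha> \<noteq> \<beta>" shows "\<not> \<alpha> dvd \<beta>"
proof
  assume d: "\<alpha> dvd \<beta>"
  obtain b v where *: "v \<in> V 0 b" "\<alpha> = var b + v" using assms by (auto simp: normalized_def)
  obtain c w where **: "w \<in> V 0 c" "\<beta> = var c + w" using assms by (auto simp: normalized_def)
  let ?\<sigma> = "var_subst b (- v)"
  have zero: "?\<sigma> c + psubst ?\<sigma> w = 0"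
    using d unfolding * normalized_dvd_iff[OF *(1)] by (simp add: **)
  have sw: "psubst ?\<sigma> w = w" if "c \<le> b"
    by (rule psubst_V_id[OF **(1)]) (use that in auto)
  consider "c = b" | "c < b" | "b < c" by linarith
  then show False
  proof cases
    case 1
    then have "w = v" using zero sw by simp
    then show False using assms(3) * ** 1 by simp
  next
    case 2
    then have "w + cst 1 * var c = 0 + cst 0 * var c" using zero sw by (simp add: add.commute)
    then show False using coeff_separates[OF **(1) V_0] by fastforce
  next
    case 3
    have "psubst ?\<sigma> w \<in> V 0 c"
      by (rule psubst_in_V[OF **(1)])
        (use 3 * V_mono[of 0 0 b c] in \<open>auto simp: var_subst_def intro: V_var V_uminus\<close>)
    moreover have "psubst ?\<sigma> w + cst 1 * var c = 0 + cst 0 * var c"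
      using zero 3 by (simp add: add.commute)
    ultimately show False using coeff_separates[OF _ V_0] by fastforce
  qed
qed

lemma normalized_not_unit: "normalized \<alpha> \<Longrightarrow> \<not> \<alpha> dvd 1"
  by (auto simp: normalized_def normalized_dvd_iff)

lemma normalized_nonzero: "normalized \<alpha> \<Longrightarrow> \<alpha> \<noteq> 0"
proof
  assume "normalized \<alpha>" "\<alpha> = 0"
  then obtain b v where *: "v \<in> V 0 b" "v + cst 1 * var b = 0 + cst 0 * var b"
    by (auto simp: normalized_def add.commute)
  then show False using coeff_separates[OF _ V_0] by fastforce
qed

lemma var_nonzero [simp]: "var k \<noteq> (0 :: 'k sym_alg)"
proof
  assume "var k = (0 :: 'k sym_alg)"
  then have "psubst (\<lambda>_. 1) (var k) = psubst (\<lambda>_. 1) (0 :: 'k sym_alg)" by (rule arg_cong)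
  then show False by simp
qed

text \<open>Primality moves one factor \<open>\<alpha>\<close> at a time into \<open>g\<close>;
  cancelling it leaves the same situation with a smaller exponent.\<close>

lemma normalized_power_dvd_mult:
  assumes "normalized \<alpha>" "\<not> \<alpha> dvd f" "\<alpha> ^ r dvd f * g" shows "\<alpha> ^ r dvd g"
  using assms(3)
proof (induction r arbitrary: g)
  case (Suc r)
  have "\<alpha> dvd f * g" using Suc.prems by (metis dvd_mult_left power_Suc)
  then have "\<alpha> dvd g" using normalized_prime assms by blast
  then obtain h where h: "g = \<alpha> * h" by blast
  obtain k where "f * g = \<alpha> ^ Suc r * k" using Suc.prems by blast
  then have "\<alpha> * (f * h) = \<alpha> * (\<alpha> ^ r * k)" by (simp add: h mult_ac)
  then have "f * h = \<alpha> ^ r * k" using sym_alg_mult_left_cancel normalized_nonzero assms(1) by blast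
  then have "\<alpha> ^ r dvd h" using Suc.IH by simp
  then show ?case by (simp add: h mult_dvd_mono)
qed simp

lemma normalized_not_dvd_prod:
  assumes "normalized \<alpha>" "finite A" "\<And>\<beta>. \<beta> \<in> A \<Longrightarrow> normalized \<beta>" "\<alpha> \<notin> A"
  shows "\<not> \<alpha> dvd (\<Prod>A) ^ r"
proof -
  have 1: "\<not> \<alpha> dvd \<Prod>A" using assms(2-4)
  proof (induction A)
    case empty
    then show ?case using normalized_not_unit[OF assms(1)] by simp
  next
    case (insert \<beta> A)
    then have "\<not> \<alpha> dvd \<beta>" using normalized_not_dvd[OF assms(1)] by auto
    then show ?case using insert normalized_prime[OF assms(1), of \<beta> "\<Prod>A"] by auto
  qed
  show ?thesis
  proof (induction r)
    case 0
    then show ?case using normalized_not_unit[OF assms(1)] by simp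
  next
    case (Suc r)
    then show ?case unfolding power_Suc using 1 normalized_prime[OF assms(1)] by blast
  qed
qed

lemma prod_power_dvd:
  assumes "finite A" "\<And>\<alpha>. \<alpha> \<in> A \<Longrightarrow> normalized \<alpha>" "\<And>\<alpha>. \<alpha> \<in> A \<Longrightarrow> \<alpha> ^ r dvd f"
  shows "(\<Prod>A) ^ r dvd f"
  using assms
proof (induction A)
  case (insert \<alpha> A)
  then have "(\<Prod>A) ^ r dvd f" by blast
  then obtain g where g: "f = (\<Prod>A) ^ r * g" ..
  have "\<alpha> ^ r dvd g"
  proof (rule normalized_power_dvd_mult)
    show "\<not> \<alpha> dvd (\<Prod>A) ^ r" by (rule normalized_not_dvd_prod) (use insert in auto)
    have "\<alpha> ^ r dvd f" by (rule insert.prems(2)) simp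
    then show "\<alpha> ^ r dvd (\<Prod>A) ^ r * g" unfolding g .
  qed (use insert in auto)
  then have "\<alpha> ^ r * (\<Prod>A) ^ r dvd f"
    unfolding g by (subst mult.commute) (rule mult_dvd_mono[OF dvd_refl])
  then show ?case using insert by (simp add: power_mult_distrib)
qed simp

text \<open>As a function of \<open>f\<close> this is the linearized (Ore) polynomial whose set of
  roots is \<open>V a m\<close>.\<close>

definition norm_poly :: "nat \<Rightarrow> nat \<Rightarrow> 'k sym_alg \<Rightarrow> 'k sym_alg" where
  "norm_poly a m f = (\<Prod>v\<in>V a m. f + v)"

lemma norm_poly_trivial: "m \<le> a \<Longrightarrow> norm_poly a m f = f"
  by (simp add: norm_poly_def V_empty)

text \<open>The three claims need each other. Linearity at \<open>m\<close> turns the new factors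
  into \<open>N f + c * N (var m)\<close> with \<open>N = norm_poly a m\<close>, and
  \<open>prod_translates\<close> gives the recursion. The recursion in turn gives linearity at
  \<open>Suc m\<close>, because the q-th power is additive and fixes scalars.\<close>

lemma norm_poly_linear_Suc:
  assumes "a \<le> m"
  shows "norm_poly a m (f + g) = norm_poly a m f + norm_poly a m g"
    "norm_poly a m (cst c * f) = cst c * norm_poly a m f"
    "norm_poly a (Suc m) f = norm_poly a m f ^ q - norm_poly a m (var m) ^ (q - 1) * norm_poly a m f"
  using assms
proof (induction arbitrary: f g c rule: dec_induct)
  have Suc: "norm_poly a (Suc m) f =
      norm_poly a m f ^ q - norm_poly a m (var m) ^ (q - 1) * norm_poly a m f"
    if "\<And>f g. norm_poly a m (f + g) = norm_poly a m f + norm_poly a m g" 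
      "\<And>c f. norm_poly a m (cst c * f) = cst c * norm_poly a m f" "a \<le> m" for m f
  proof -
    have "norm_poly a (Suc m) f = (\<Prod>c\<in>UNIV. norm_poly a m (f + cst c * var m))"
      unfolding norm_poly_def V_Suc[OF that(3)] prod.reindex[OF inj_V_Suc]
      by (subst prod.swap) (simp add: prod.cartesian_product split_def add_ac)
    then show ?thesis by (simp add: that prod_translates)
  qed
  note * = this
  {
    case base
    case 1 then show ?case by (simp add: norm_poly_trivial)
    case 2 then show ?case by (simp add: norm_poly_trivial)
    case 3 then show ?case by (rule *) (simp_all add: norm_poly_trivial)
  next
    case (step m)
    have S1: "norm_poly a (Suc m) (f + g) = norm_poly a (Suc m) f + norm_poly a (Suc m) g" for f g
      unfolding step.IH(1,3) frob_add[of _ _ 1, unfolded power_one_right]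
        by (simp add: algebra_simps)
    have S2: "norm_poly a (Suc m) (cst c * f) = cst c * norm_poly a (Suc m) f" for c f
      unfolding step.IH(2,3) frob_scale[of _ _ 1, unfolded power_one_right]
        by (simp add: algebra_simps)
    case 1 show ?case by (rule S1)
    case 2 show ?case by (rule S2)
    case 3 show ?case by (rule *[OF S1 S2]) (use step in auto)
  }
qed

end

section \<open>Monomials, and coefficients of products of linear factors\<close>

lemma single_power: "(single m c :: 'k::field sym_alg) ^ i =
    single (Poly_Mapping.map ((*) i) m) (c ^ i)"
proof (induction i)
  case 0
  have "Poly_Mapping.map ((*) 0) m = 0"
    by (rule poly_mapping_eqI) (simp add: Poly_Mapping.map.rep_eq)
  then show ?case by (simp only: power_0 single_one)
next
  case (Suc i)
  have "m + Poly_Mapping.map ((*) i) m = Poly_Mapping.map ((*) (Suc i)) m"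
    by (rule poly_mapping_eqI) (simp add: Poly_Mapping.map.rep_eq lookup_add when_def)
  then show ?case by (simp only: power_Suc Suc.IH mult_single)
qed

lemma var_power_conv: "(var k :: 'k::field sym_alg) ^ i = single (single k i) 1"
  unfolding sym_var_def single_power by simp

lemma var_power_dvd_iff: "(var c :: 'k::field sym_alg) ^ r dvd f \<longleftrightarrow> (\<forall>m\<in>keys f. r \<le> lookup m c)"
proof
  assume "var c ^ r dvd f"
  then obtain g where g: "f = var c ^ r * g" by blast
  show "\<forall>m\<in>keys f. r \<le> lookup m c"
  proof
    fix m assume "m \<in> keys f"
    then obtain m' where "m = single c r + m'"
      using keys_mult[of "var c ^ r" g] by (auto simp: g var_power_conv)
    then show "r \<le> lookup m c" by (simp add: lookup_add)
  qed
next
  assume *: "\<forall>m\<in>keys f. r \<le> lookup m c"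
  have "var c ^ r dvd single m (lookup f m)" if "m \<in> keys f" for m
  proof -
    have "m = single c r + (m - single c r)"
      by (rule poly_mapping_eqI) (use * that in \<open>auto simp: lookup_add lookup_minus lookup_single when_def\<close>)
    then have "single m (lookup f m) = var c ^ r * single (m - single c r) (lookup f m)"
      by (simp add: var_power_conv mult_single)
    then show ?thesis by (rule dvdI)
  qed
  then have "var c ^ r dvd (\<Sum>m\<in>keys f. single m (lookup f m))" by (intro dvd_sum) auto
  then show "var c ^ r dvd f" by (simp flip: poly_mapping_sum_single[OF finite_keys subset_refl])
qed

lemma lookup_psubst_torus:
  "lookup (psubst (var_subst c (cst l * var c)) f) m = l ^ lookup m c * (lookup f m :: 'k::field)"
proof (induction f rule: poly_mapping_additive_induct)
  case (single m' x)
  have "msubst (var_subst c (cst l * var c)) m' =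
      (\<Prod>k\<in>insert c (keys m'). (if k = c then cst l ^ lookup m' k else 1) * var k ^ lookup m' k)"
    by (subst msubst_superset[of "insert c (keys m')"]) (auto intro!: prod.cong simp: power_mult_distrib)
  also have "\<dots> = cst l ^ lookup m' c * msubst var m'"
    by (subst msubst_superset[of "insert c (keys m')" m' var]) (auto simp: prod.distrib)
  also have "cst l ^ lookup m' c = cst (l ^ lookup m' c)"
    by (rule cst_power)
  finally show ?case
    by (simp add: psubst_single single_conv_msubst_var mult_single lookup_single when_def)
qed (simp add: lookup_add distrib_left)

lemma coeff_prod_linear:
  fixes g :: "'b \<Rightarrow> 'a::comm_ring_1"
  assumes "finite A" "x \<notin> A"
  shows "Polynomial.coeff (\<Prod>v\<in>insert x A. [:g v, 1:]) 0 =
      g x * Polynomial.coeff (\<Prod>v\<in>A. [:g v, 1:]) 0"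
    "Polynomial.coeff (\<Prod>v\<in>insert x A. [:g v, 1:]) (Suc k) =
      g x * Polynomial.coeff (\<Prod>v\<in>A. [:g v, 1:]) (Suc k) + Polynomial.coeff (\<Prod>v\<in>A. [:g v, 1:]) k"
  using assms by simp_all

lemma psubst_coeff_prod:
  assumes "finite A"
  shows "psubst \<sigma> (Polynomial.coeff (\<Prod>v\<in>A. [:g v, 1:]) k) =
      Polynomial.coeff (\<Prod>v\<in>A. [:psubst \<sigma> (g v), 1:]) k"
  using assms
proof (induction A arbitrary: k)
  case empty
  show ?case by (cases k) auto
next
  case (insert x A)
  show ?case
    by (cases k) (simp_all only: coeff_prod_linear[OF insert(1,2)] psubst_add psubst_mult insert.IH)
qed

lemma vars_in_coeff_prod:
  assumes "finite A" "\<And>v. v \<in> A \<Longrightarrow> vars_in S (g v)"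
  shows "vars_in S (Polynomial.coeff (\<Prod>v\<in>A. [:g v, 1:]) k)"
  using assms
proof (induction A arbitrary: k)
  case empty
  show ?case by (cases k) auto
next
  case (insert x A)
  then show ?case
    by (cases k) (simp_all only: coeff_prod_linear[OF insert(1,2)] vars_in_add vars_in_mult insertI1 insertI2)
qed

text \<open>The coefficients are elementary symmetric in the linear forms \<open>g v\<close>. The
  second conjunct guards the truncated difference \<open>card A - k\<close>.\<close>

lemma homogeneous_coeff_prod:
  assumes "finite A" "\<And>v. v \<in> A \<Longrightarrow> homogeneous (Suc 0) (g v)"
  shows "homogeneous (card A - k) (Polynomial.coeff (\<Prod>v\<in>A. [:g v, 1:]) k)
    \<and> (card A < k \<longrightarrow> Polynomial.coeff (\<Prod>v\<in>A. [:g v, 1:]) k = 0)"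
  using assms
proof (induction A arbitrary: k)
  case empty
  show ?case by (cases k) auto
next
  case (insert x A)
  have IH: "homogeneous (card A - k) (Polynomial.coeff (\<Prod>v\<in>A. [:g v, 1:]) k)"
      "card A < k \<Longrightarrow> Polynomial.coeff (\<Prod>v\<in>A. [:g v, 1:]) k = 0" for k
    using insert.IH insert.prems by auto
  have gx: "homogeneous (Suc 0) (g x)" using insert.prems by simp
  have c: "card (insert x A) = Suc (card A)" using insert by simp
  show ?case
  proof (cases k)
    case 0
    show ?thesis
      unfolding 0 coeff_prod_linear[OF insert(1,2)] c
      using homogeneous_mult[OF gx IH(1)[of 0]] by simp
  next
    case (Suc j)
    have "homogeneous (card A - j) (g x * Polynomial.coeff (\<Prod>v\<in>A. [:g v, 1:]) (Suc j))"
    proof (cases "card A < Suc j")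
      case False
      then have "Suc 0 + (card A - Suc j) = card A - j" by linarith
      then show ?thesis using homogeneous_mult[OF gx IH(1)[of "Suc j"]] by simp
    qed (simp add: IH(2))
    then show ?thesis
      unfolding Suc coeff_prod_linear[OF insert(1,2)] c
      using IH(1)[of j] IH(2)[of j] IH(2)[of "Suc j"] by (auto intro: homogeneous_add)
  qed
qed

context coeff_field
begin

text \<open>The torus element \<open>l\<close> multiplies the coefficient of a monomial by a power
  of \<open>l\<close> with its \<open>x_c\<close>-exponent. The extra factor \<open>l ^ j\<close> is
  the weight of the exterior part: 1 if \<open>x_c\<close> occurs in it, otherwise 0.\<close>

lemma torus_keys:
  fixes f :: "'k sym_alg"
  assumes "\<And>l. l \<noteq> 0 \<Longrightarrow> cst (l ^ j) * psubst (var_subst c (cst l * var c)) f = f" "m \<in> keys f"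
  shows "(q - 1) dvd lookup m c + j"
proof (rule dvd_of_power_eq_1)
  fix l :: 'k assume "l \<noteq> 0"
  from assms(1)[OF this] have "lookup f m =
      lookup (cst (l ^ j) * psubst (var_subst c (cst l * var c)) f) m"
    by simp
  also have "\<dots> = l ^ j * (l ^ lookup m c * lookup f m)"
    unfolding lookup_psubst_torus[symmetric] by (simp only: scale_conv_mult[symmetric] lookup_scale)
  finally have "l ^ (lookup m c + j) * lookup f m = 1 * lookup f m" by (simp add: power_add mult_ac)
  then show "l ^ (lookup m c + j) = 1" using assms(2) by (simp add: in_keys_iff)
qed

definition norm_set :: "nat \<Rightarrow> nat \<Rightarrow> 'k sym_alg set" where
  "norm_set a m = {var b + v | b v. a \<le> b \<and> b < m \<and> v \<in> V a b}"

definition nz_prod :: "nat \<Rightarrow> nat \<Rightarrow> 'k sym_alg" where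
  "nz_prod a m = \<Prod>(V a m - {0})"

lemma norm_set_empty: "m \<le> a \<Longrightarrow> norm_set a m = {}"
  by (auto simp: norm_set_def)

lemma norm_set_Suc: "a \<le> m \<Longrightarrow> norm_set a (Suc m) = norm_set a m \<union> (\<lambda>v. var m + v) ` V a m"
  by (auto simp: norm_set_def less_Suc_eq)

lemma norm_set_normalized: "\<alpha> \<in> norm_set a m \<Longrightarrow> normalized \<alpha>"
  using V_mono[of 0 a] by (fastforce simp: norm_set_def normalized_def)

lemma finite_norm_set: "finite (norm_set a m)"
proof (cases "a \<le> m")
  case True
  then show ?thesis
    by (induction rule: dec_induct) (auto simp: norm_set_empty norm_set_Suc finite_V)
qed (simp add: norm_set_empty)

lemma norm_set_subset: "norm_set a m \<subseteq> V a m"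
proof
  fix \<alpha> assume "\<alpha> \<in> norm_set a m"
  then obtain b v where *: "a \<le> b" "b < m" "v \<in> V a b" "\<alpha> = var b + v" by (auto simp: norm_set_def)
  then have "v \<in> V a m" using V_mono[of a a b m] by auto
  with * show "\<alpha> \<in> V a m" by (auto intro: V_add V_var)
qed

lemma norm_set_disjoint: "norm_set a m \<inter> (\<lambda>v. var m + v) ` V a m = {}"
proof -
  have False if "w \<in> V a m" "v \<in> V a m" "w = var m + v" for v w
  proof -
    have "w + cst 0 * var m = v + cst 1 * var m" using that by simp
    then show False using coeff_separates[OF that(1,2)] by fastforce
  qed
  then show ?thesis using norm_set_subset by blast
qed

text \<open>Every nonzero vector is a unit times a unique element of \<open>norm_set\<close>, so
  each of these occurs \<open>q - 1\<close> times. The constant \<open>k\<close> collects powers of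
  the product \<open>u\<close> of all units.\<close>

lemma nz_prod_conv:
  assumes "a \<le> m"
  shows "\<exists>k. k \<noteq> 0 \<and> nz_prod a m = cst k * (\<Prod>(norm_set a m)) ^ (q - 1)"
  using assms
proof (induction rule: dec_induct)
  case base
  show ?case by (rule exI[of _ 1]) (simp add: nz_prod_def V_empty norm_set_empty)
next
  case (step m)
  then obtain k where k: "k \<noteq> 0" "nz_prod a m = cst k * (\<Prod>(norm_set a m)) ^ (q - 1)" by blast
  define u where "u = (\<Prod>c\<in>UNIV - {0 :: 'k}. c)"
  let ?f = "\<lambda>(v, c). v + cst c * var m"
  have img: "V a (Suc m) - {0} = (V a m - {0}) \<union> ?f ` (V a m \<times> (UNIV - {0}))"
  proof -
    have "V a (Suc m) = V a m \<union> ?f ` (V a m \<times> (UNIV - {0}))"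
    proof -
      have "V a m \<times> UNIV = V a m \<times> {0} \<union> V a m \<times> (UNIV - {0 :: 'k})" by auto
      moreover have "?f ` (V a m \<times> {0}) = V a m" by force
      ultimately show ?thesis unfolding V_Suc[OF step(1)] by (simp only: image_Un)
    qed
    moreover have "0 \<notin> ?f ` (V a m \<times> (UNIV - {0}))"
    proof
      assume "0 \<in> ?f ` (V a m \<times> (UNIV - {0}))"
      then obtain p where p: "p \<in> V a m \<times> (UNIV - {0})" "0 = ?f p" by (rule imageE)
      obtain v c where "p = (v, c)" by (cases p)
      with p have *: "v \<in> V a m" "c \<noteq> 0" "0 = v + cst c * var m" by simp_all
      then have "v + cst c * var m = 0 + cst 0 * var m" by simp
      then show False using coeff_separates[OF *(1) V_0] *(2) by blast
    qed
    ultimately show ?thesis by auto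
  qed
  have disj: "(V a m - {0}) \<inter> ?f ` (V a m \<times> (UNIV - {0})) = {}"
  proof (rule ccontr)
    assume "\<not> ?thesis"
    then obtain v w c where *: "v \<in> V a m" "w \<in> V a m" "c \<noteq> 0" "v + cst 0 * var m =
        w + cst c * var m"
      by auto
    then show False using coeff_separates[OF *(1,2,4)] by simp
  qed
  have inj: "inj_on ?f (V a m \<times> (UNIV - {0}))"
    by (rule inj_on_subset[OF inj_V_Suc]) auto
  have prod_cst: "(\<Prod>c\<in>UNIV - {0 :: 'k}. cst c) = cst u"
  proof -
    have "(\<Prod>c\<in>A. cst c) = cst (\<Prod>c\<in>A. c :: 'k)" if "finite A" for A
      using that by (induction A) (auto simp: mult_single)
    then show ?thesis by (simp add: u_def)
  qed
  have card_units: "card (UNIV - {0 :: 'k}) = q - 1" by (simp add: q_card)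
  have row: "(\<Prod>v\<in>V a m. v + cst c * var m) = cst c ^ card (V a m) * (\<Prod>v\<in>V a m. var m + v)"
    if "c \<noteq> 0" for c
  proof -
    have "(\<Prod>v\<in>V a m. v + cst c * var m) = (\<Prod>v\<in>V a m. cst c * (var m + v))"
    proof (rule prod.reindex_bij_witness[of _ "\<lambda>v. cst c * v" "\<lambda>v. cst (1 / c) * v"])
      show "cst c * (cst (1 / c) * v) = v" "cst (1 / c) * (cst c * v) = v" for v
        using that by (simp_all add: mult_single flip: mult.assoc)
      then show "cst c * (var m + cst (1 / c) * v) = v + cst c * var m" for v
        by (simp add: distrib_left)
    qed (auto intro: V_scale)
    then show ?thesis by (simp add: prod.distrib)
  qed
  have "(\<Prod>x\<in>?f ` (V a m \<times> (UNIV - {0})). x) = (\<Prod>c\<in>UNIV - {0}. \<Prod>v\<in>V a m. v + cst c * var m)"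
    unfolding prod.reindex[OF inj] by (subst prod.swap) (simp add: prod.cartesian_product split_def)
  also have "\<dots> = (\<Prod>c\<in>UNIV - {0}. cst c ^ card (V a m) * (\<Prod>v\<in>V a m. var m + v))"
    by (rule prod.cong) (auto simp: row)
  also have "\<dots> = cst u ^ card (V a m) * (\<Prod>v\<in>V a m. var m + v) ^ (q - 1)"
    by (simp only: prod.distrib prod_constant prod_power_distrib[symmetric] prod_cst card_units)
  also have "cst u ^ card (V a m) = cst (u ^ card (V a m))" by (rule cst_power)
  finally have new: "(\<Prod>x\<in>?f ` (V a m \<times> (UNIV - {0})). x) =
      cst (u ^ card (V a m)) * (\<Prod>v\<in>V a m. var m + v) ^ (q - 1)" .
  have "nz_prod a (Suc m) = nz_prod a m * (\<Prod>x\<in>?f ` (V a m \<times> (UNIV - {0})). x)"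
    unfolding nz_prod_def img by (rule prod.union_disjoint) (use disj finite_V in auto)
  also have "\<dots> = cst (k * u ^ card (V a m)) * (\<Prod>(norm_set a m) * (\<Prod>v\<in>V a m. var m + v)) ^ (q - 1)"
    unfolding new k(2) by (simp add: power_mult_distrib mult_ac flip: mult_single[of 0 _ 0, simplified])
  also have "\<Prod>(norm_set a m) * (\<Prod>v\<in>V a m. var m + v) = \<Prod>(norm_set a (Suc m))"
    unfolding norm_set_Suc[OF step(1)]
    by (subst prod.union_disjoint)
      (use norm_set_disjoint finite_norm_set finite_V in \<open>auto simp: prod.reindex inj_on_def\<close>)
  finally show ?case using k(1) by (intro exI[of _ "k * u ^ card (V a m)"]) (auto simp: u_def)
qed

lemma nz_prod_nonzero: "nz_prod a m \<noteq> 0"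
proof -
  have "\<Prod>A \<noteq> 0" if "finite A" "0 \<notin> A" for A :: "'k sym_alg set"
    using that by (induction A) (auto dest: sym_alg_mult_eq_0)
  then show ?thesis unfolding nz_prod_def using finite_V by auto
qed

lemma nz_prod_dvd:
  assumes "a \<le> m" "\<And>\<alpha>. \<alpha> \<in> norm_set a m \<Longrightarrow> \<alpha> ^ (q - 1) dvd f"
  shows "nz_prod a m dvd f"
proof -
  obtain k where k: "k \<noteq> 0" "nz_prod a m = cst k * (\<Prod>(norm_set a m)) ^ (q - 1)"
    using nz_prod_conv[OF assms(1)] by blast
  have "(\<Prod>(norm_set a m)) ^ (q - 1) dvd f"
    by (rule prod_power_dvd) (use finite_norm_set norm_set_normalized assms in auto)
  then obtain g where "f = (\<Prod>(norm_set a m)) ^ (q - 1) * g" by blast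
  also have "\<dots> = nz_prod a m * (cst (1 / k) * g)"
    using k(1) by (simp add: k(2) mult_single mult_ac flip: mult.assoc[of "cst _" "cst _"])
  finally show ?thesis by (rule dvdI)
qed

lemma nz_prod_homogeneous: "homogeneous (q ^ (m - a) - 1) (nz_prod a m)"
proof -
  have "homogeneous (\<Sum>v\<in>V a m - {0}. Suc 0) (nz_prod a m)"
    unfolding nz_prod_def by (rule homogeneous_prod) (use V_homogeneous in auto)
  also have "(\<Sum>v\<in>V a m - {0}. Suc 0) = q ^ (m - a) - 1"
    using card_V by (simp add: finite_V)
  finally show ?thesis .
qed

lemma nz_prod_vars_in: "vars_in {a..<m} (nz_prod a m)"
  unfolding nz_prod_def by (rule vars_in_prod) (use V_vars_in in auto)

section \<open>Restriction to the hyperplane where the lowest variable is 0\<close>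

lemma coeff_poly_power_q:
  "Polynomial.coeff (P ^ q) (q * i) = Polynomial.coeff (P :: 'k sym_alg poly) i ^ q"
proof -
  have "P ^ q = (\<Sum>j\<le>degree P. Polynomial.monom (Polynomial.coeff P j) j) ^ q"
    by (simp add: poly_as_sum_of_monoms)
  also have "\<dots> = (\<Sum>j\<le>degree P. Polynomial.monom (Polynomial.coeff P j ^ q) (q * j))"
    by (simp add: frob_sum_poly monom_power mult.commute)
  finally have "Polynomial.coeff (P ^ q) (q * i) =
      (\<Sum>j\<le>degree P. if j = i then Polynomial.coeff P j ^ q else 0)"
    using q_pos by (auto simp: coeff_sum intro!: sum.cong)
  also have "\<dots> = Polynomial.coeff P i ^ q"
    using q_pos by (auto simp: coeff_eq_0)
  finally show ?thesis .
qed

lemma V_lower: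
  assumes "a < m"
  shows "V a m = (\<lambda>(v, c). v + cst c * var a) ` (V (Suc a) m \<times> UNIV)"
    "inj_on (\<lambda>(v, c). v + cst c * var a) (V (Suc a) m \<times> UNIV)"
proof -
  let ?f = "\<lambda>(v, c). v + cst c * var a"
  have eps: "psubst (var_subst a 0) v = v" if "v \<in> V (Suc a) m" for v
    by (rule psubst_V_id[OF that]) auto
  show "inj_on ?f (V (Suc a) m \<times> UNIV)"
  proof (rule inj_onI, clarify)
    fix v c w d assume *: "v \<in> V (Suc a) m" "w \<in> V (Suc a) m" "v + cst c * var a =
        w + cst d * var a"
    have "v = w" using arg_cong[OF *(3), of "psubst (var_subst a 0)"] by (simp add: eps *(1,2))
    with *(3) have "0 + cst c * var a = 0 + cst d * var a" by simp
    then show "v = w \<and> c = d" using \<open>v = w\<close> coeff_separates[OF V_0 V_0] by blast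
  qed
  show "V a m = ?f ` (V (Suc a) m \<times> UNIV)"
  proof (intro equalityI subsetI)
    fix v assume "v \<in> V a m"
    then obtain c where "v = (\<Sum>k = a..<m. cst (c k) * var k)" by (auto simp: V_def)
    also have "\<dots> = (\<Sum>k = Suc a..<m. cst (c k) * var k) + cst (c a) * var a"
      using assms by (simp add: sum.atLeast_Suc_lessThan add.commute)
    finally show "v \<in> ?f ` (V (Suc a) m \<times> UNIV)" by (auto simp: V_def)
  next
    fix v assume "v \<in> ?f ` (V (Suc a) m \<times> UNIV)"
    then show "v \<in> V a m" using V_mono[of a "Suc a" m m] assms by (auto intro!: V_add V_scale V_var)
  qed
qed

text \<open>
  The difference of \<open>f\<close> and \<open>f\<close> at \<open>x\<^sub>b = 0\<close> is divisible by \<open>x\<^sub>b\<close>, hence by all translates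
  \<open>x\<^sub>b + c x\<^sub>a\<close>, hence by their product, which becomes \<open>x\<^sub>b\<^sup>q\<close> at \<open>x\<^sub>a = 0\<close>; the quotient is again invariant.
\<close>

lemma exponents_divisible:
  fixes f :: "'k sym_alg"
  assumes "a < b" "homogeneous d f" "\<And>c. psubst (var_subst b (var b + cst c * var a)) f = f"
  shows "\<forall>m\<in>keys (psubst (var_subst a 0) f). q dvd lookup m b"
  using assms(2,3)
proof (induction d arbitrary: f rule: less_induct)
  case (less d)
  let ?eps = "psubst (var_subst a 0)" and ?rho = "psubst (var_subst b 0)"
  let ?T = "\<lambda>c. psubst (var_subst b (var b + cst c * var a))"
  define N where "N = (\<Prod>c\<in>UNIV. var b + cst c * var a :: 'k sym_alg)"
  have N: "N = var b ^ q - var a ^ (q - 1) * var b" unfolding N_def by (rule prod_translates)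
  have rho_fix: "?T c (?rho g) = ?rho g" for c g
    unfolding psubst_psubst by (rule psubst_cong) (auto simp: var_subst_def)
  define f' where "f' = f - ?rho f"
  have T_f': "?T c f' = f'" for c by (simp add: f'_def rho_fix less.prems)
  have "var b dvd f'" using dvd_psubst_diff[of b 0 f] by (simp add: f'_def)
  then have "var b + cst c * var a dvd f'" for c
    using T_f'[of c] by (metis dvd_def psubst_mult psubst_var var_subst_def)
  moreover have "normalized (var b + cst c * var a)" for c
    unfolding normalized_def using assms(1) by (blast intro: V_scale V_var)
  ultimately have "(\<Prod>(range (\<lambda>c. var b + cst c * var a))) ^ 1 dvd f'"
    by (intro prod_power_dvd finite_imageI finite) (auto simp only: power_one_right)
  moreover have "\<Prod>(range (\<lambda>c. var b + cst c * var a)) = N"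
  proof -
    have "inj (\<lambda>c. var b + cst c * var a :: 'k sym_alg)"
      using coeff_separates[OF V_0 V_0] by (auto simp: inj_def)
    then show ?thesis by (simp add: N_def prod.reindex)
  qed
  ultimately have "N dvd f'" by simp
  then obtain h where h: "f' = N * h" by blast
  have homN: "homogeneous q N"
    unfolding N using homogeneous_power[OF homogeneous_var, of q b]
      homogeneous_mult[OF homogeneous_power[OF homogeneous_var, of "q - 1" a] homogeneous_var, of b] q_pos
    by (intro homogeneous_diff) auto
  have hom_rho: "homogeneous d (?rho f)"
    by (rule homogeneous_psubst[OF less.prems(1)]) (auto simp: var_subst_def)
  have homf': "homogeneous d (N * h)"
    unfolding h[symmetric] f'_def using less.prems(1) hom_rho by (rule homogeneous_diff)
  have "N \<noteq> 0"
  proof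
    assume "N = 0"
    then have "?eps N = 0" by simp
    then have "var b ^ q = (0 :: 'k sym_alg)" using assms(1) q_gt_1 by (simp add: N zero_power)
    then have "psubst (\<lambda>_. 1) (var b ^ q) = psubst (\<lambda>_. 1) (0 :: 'k sym_alg)" by (rule arg_cong)
    then show False by simp
  qed
  have TN: "?T c N = N" for c
  proof -
    have "?T c N = (var b + cst c * var a) ^ q - var a ^ (q - 1) * (var b + cst c * var a)"
      using assms(1) by (simp add: N)
    also have "(var b + cst c * var a) ^ q = var b ^ q + cst c * var a ^ q"
      using frob_add[of "var b" "cst c * var a" 1] frob_scale[of c "var a" 1]
      unfolding power_one_right by (rule trans[OF _ arg_cong])
    also have "var a ^ q = var a ^ (q - 1) * (var a :: 'k sym_alg)"
      using power_minus_mult[OF q_pos] by (rule sym)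
    finally show ?thesis unfolding N by (simp add: algebra_simps)
  qed
  have Th: "?T c h = h" for c
  proof (rule sym_alg_mult_left_cancel[OF \<open>N \<noteq> 0\<close>])
    show "N * ?T c h = N * h" using T_f'[of c] unfolding h psubst_mult TN .
  qed
  have IH: "\<forall>m\<in>keys (?eps h). q dvd lookup m b"
  proof (cases "d < q")
    case True
    then have "h = 0" using homogeneous_cancel(2)[OF homf' homN \<open>N \<noteq> 0\<close>] by blast
    then show ?thesis by simp
  next
    case False
    then show ?thesis
      using less.IH[of "d - q" h] homogeneous_cancel(1)[OF homf' homN \<open>N \<noteq> 0\<close>] Th q_pos by auto
  qed
  \<comment> \<open>Induction on the degree closes here: \<open>x_b\<close> does not occur in
    \<open>?rho f\<close>, and in the other summand its exponent is \<open>q\<close> plus an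
    exponent coming from \<open>h\<close>, whose degree is smaller by \<open>q\<close>.\<close>
  have "f = ?rho f + N * h" unfolding h[symmetric] f'_def by simp
  then have "?eps f = ?eps (?rho f) + ?eps N * ?eps h" by (metis psubst_add psubst_mult)
  also have "?eps N = var b ^ q" using assms(1) q_gt_1 by (simp add: N zero_power)
  finally have eps_f: "?eps f = ?eps (?rho f) + single (single b q) 1 * ?eps h"
    by (simp add: var_power_conv)
  show ?case
  proof
    fix m assume "m \<in> keys (?eps f)"
    then consider "m \<in> keys (?eps (?rho f))" | "m \<in> keys (single (single b q) 1 * ?eps h)"
      unfolding eps_f using keys_add[of "?eps (?rho f)" "single (single b q) 1 * ?eps h"] by blast
    then show "q dvd lookup m b"
    proof cases
      case 1
      have "vars_in (UNIV - {b}) (?eps (?rho f))"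
        unfolding psubst_psubst
        by (rule vars_in_psubst[of UNIV]) (auto simp: vars_in_def[of UNIV] var_subst_def)
      then have "b \<notin> keys m" using 1 by (auto simp: vars_in_def)
      then show ?thesis by (simp add: in_keys_iff)
    next
      case 2
      then obtain m' where "m' \<in> keys (?eps h)" "m = single b q + m'"
        using keys_mult[of "single (single b q) 1" "?eps h"] by auto
      then show ?thesis using IH by (simp add: lookup_add)
    qed
  qed
qed

text \<open>Scalars are their own q-th powers, so dividing all exponents by \<open>q\<close> gives a
  root. In a degree not divisible by \<open>q\<close> there are no such monomials at all.\<close>

lemma q_th_root:
  fixes p :: "'k sym_alg"
  assumes "\<And>m k. m \<in> keys p \<Longrightarrow> q dvd lookup m k"
    and "homogeneous d p"
  obtains h where "p = h ^ q" "homogeneous (d div q) h" "\<not> q dvd d \<Longrightarrow> h = 0"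
proof
  let ?r = "Poly_Mapping.map (\<lambda>i. i div q) :: (nat \<Rightarrow>\<^sub>0 nat) \<Rightarrow> _"
  define h where "h = (\<Sum>m\<in>keys p. single (?r m) (lookup p m))"
  have r: "Poly_Mapping.map ((*) q) (?r m) = m" if "m \<in> keys p" for m
  proof (rule poly_mapping_eqI)
    fix k
    have "q dvd lookup m k" by (rule assms(1)[OF that])
    then obtain i where "lookup m k = q * i" ..
    then show "lookup (Poly_Mapping.map ((*) q) (?r m)) k = lookup m k"
      using q_pos by (simp add: Poly_Mapping.map.rep_eq when_def)
  qed
  have "h ^ q = (\<Sum>m\<in>keys p. single (?r m) (lookup p m) ^ q)"
  proof -
    have "sum g A ^ q = (\<Sum>m\<in>A. g m ^ q)" for g :: "_ \<Rightarrow> 'k sym_alg" and A :: "(nat \<Rightarrow>\<^sub>0 nat) set"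
      by (induction A rule: infinite_finite_induct)
        (use q_pos frob_add[of _ _ 1] in \<open>auto simp: zero_power\<close>)
    then show ?thesis by (simp add: h_def)
  qed
  also have "\<dots> = (\<Sum>m\<in>keys p. single m (lookup p m))"
    by (rule sum.cong) (simp_all add: single_power r field_power_q)
  finally show "p = h ^ q" by (simp flip: poly_mapping_sum_single[OF finite_keys subset_refl])
  have deg: "d = q * monom_deg (?r m)" if "m \<in> keys p" for m
  proof -
    have "d = (\<Sum>k\<in>keys m. lookup m k)" using assms(2) that
      by (auto simp: homogeneous_def monom_deg_def)
    also have "\<dots> = (\<Sum>k\<in>keys m. q * lookup (?r m) k)"
      using assms(1)[OF that] by (intro sum.cong) (auto simp: Poly_Mapping.map.rep_eq when_def)
    also have "\<dots> = q * monom_deg (?r m)"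
      by (subst monom_deg_superset[of "keys m" "?r m"])
        (auto simp: sum_distrib_left in_keys_iff Poly_Mapping.map.rep_eq when_def split: if_splits)
    finally show ?thesis .
  qed
  show "homogeneous (d div q) h"
    unfolding h_def
  proof (rule homogeneous_sum)
    fix m assume "m \<in> keys p"
    then show "homogeneous (d div q) (single (?r m) (lookup p m))"
      using deg[of m] q_pos by (auto simp: homogeneous_def)
  qed
  show "h = 0" if "\<not> q dvd d"
  proof -
    have "keys p = {}" using deg that by (metis all_not_in_conv dvd_triv_left)
    then show ?thesis by (simp add: h_def)
  qed
qed

end

section \<open>Polynomial invariants of a flag stabiliser\<close>

text \<open>
  The block of \<open>b\<close> is \<open>{st b..<e b}\<close>. For the induction that sets \<open>x\<^sub>0, x\<^sub>1, \<dots>\<close> to 0 one after the other,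
  the notions below have a parameter \<open>a\<close>: only the variables \<open>x\<^sub>k\<close> with \<open>a \<le> k < n\<close> take part.
  Upper bounds use invariance under elementary substitutions only.
\<close>

locale flag = coeff_field q ground for q and ground :: "'k::{field, finite} itself" +
  fixes n :: nat and st e :: "nat \<Rightarrow> nat"
  assumes st_le: "b < n \<Longrightarrow> st b \<le> b" and e_gt: "b < n \<Longrightarrow> b < e b" and e_le: "b < n \<Longrightarrow> e b \<le> n"
    and block: "b < n \<Longrightarrow> st b \<le> c \<Longrightarrow> c < e b \<Longrightarrow> st c = st b \<and> e c = e b"
begin

lemma e_mono:
  assumes "b \<le> c" "c < n" shows "e b \<le> e c"
proof (cases "st c \<le> b")
  case True
  then have "e b = e c" using block[of c b] assms e_gt[of c] by auto
  then show ?thesis by simp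
next
  case False
  have "e b \<le> st c"
  proof (rule ccontr)
    assume "\<not> e b \<le> st c"
    then have "st (st c) = st b" using block[of b "st c"] st_le[of b] False assms by auto
    moreover have "st (st c) = st c" using block[of c "st c"] st_le[of c] e_gt[of c] assms by auto
    ultimately show False using st_le[of b] assms False by auto
  qed
  then show ?thesis using st_le[of c] e_gt[of c] assms by auto
qed

text \<open>These are the matrices that differ from the identity in one column. As \<open>v\<close>
  avoids \<open>x_b\<close>, the condition on \<open>c\<close> makes them invertible; torus elements
  and transvections are the special cases \<open>v = 0\<close> and \<open>c = 1\<close>.\<close>

definition elementary :: "nat \<Rightarrow> (nat \<Rightarrow> 'k sym_alg) set" where
  "elementary a = {var_subst b (cst c * var b + v) | b c v.
     a \<le> b \<and> b < n \<and> c \<noteq> 0 \<and> v \<in> V a (e b) \<and> vars_in (- {b}) v}"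

definition invariant :: "nat \<Rightarrow> 'k sym_alg \<Rightarrow> bool" where
  "invariant a f \<longleftrightarrow> (\<forall>\<sigma>\<in>elementary a. psubst \<sigma> f = f)"

lemma elementary_Suc: "elementary (Suc a) \<subseteq> elementary a"
  unfolding elementary_def using V_mono[of a "Suc a"] by fastforce

lemma invariantD:
  "invariant a f \<Longrightarrow> a \<le> b \<Longrightarrow> b < n \<Longrightarrow> c \<noteq> 0 \<Longrightarrow> v \<in> V a (e b) \<Longrightarrow> vars_in (- {b}) v \<Longrightarrow>
    psubst (var_subst b (cst c * var b + v)) f = f"
  unfolding invariant_def elementary_def by blast

lemma invariant_transvection:
  "invariant a f \<Longrightarrow> a \<le> b \<Longrightarrow> b < n \<Longrightarrow> v \<in> V a (e b) \<Longrightarrow> vars_in (- {b}) v \<Longrightarrow>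
    psubst (var_subst b (var b + v)) f = f"
  using invariantD[of a f b 1 v] by simp

lemma invariant_torus:
  "invariant a f \<Longrightarrow> a \<le> b \<Longrightarrow> b < n \<Longrightarrow> c \<noteq> 0 \<Longrightarrow> psubst (var_subst b (cst c * var b)) f = f"
  using invariantD[of a f b c 0] by simp

lemma invariant_0 [simp]: "invariant a 0"
  by (simp add: invariant_def)

lemma invariant_cst [simp]: "invariant a (cst c)"
  by (simp add: invariant_def)

lemma invariant_add: "invariant a f \<Longrightarrow> invariant a g \<Longrightarrow> invariant a (f + g)"
  by (simp add: invariant_def)

lemma invariant_diff: "invariant a f \<Longrightarrow> invariant a g \<Longrightarrow> invariant a (f - g)"
  by (simp add: invariant_def)

lemma invariant_mult: "invariant a f \<Longrightarrow> invariant a g \<Longrightarrow> invariant a (f * g)"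
  by (simp add: invariant_def)

lemma invariant_cancel:
  assumes "invariant a (f * g)" "invariant a f" "f \<noteq> 0" shows "invariant a g"
  unfolding invariant_def
proof
  fix \<sigma> assume "\<sigma> \<in> elementary a"
  then have "psubst \<sigma> f = f" "psubst \<sigma> f * psubst \<sigma> g = f * g"
    using assms unfolding invariant_def psubst_mult[symmetric] by blast+
  then show "psubst \<sigma> g = g" using sym_alg_mult_left_cancel[OF assms(3)] by metis
qed

lemma dvd_psubst: "g dvd f \<Longrightarrow> psubst \<sigma> f = f \<Longrightarrow> psubst \<sigma> g dvd f"
  by (metis dvd_def psubst_mult)

text \<open>Inside a block \<open>x_c\<close> has to be carried to \<open>x_b + v\<close>. The
  exchange of \<open>x_c\<close> and \<open>x_b\<close> is not elementary, so it is replaced by the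
  substitutions \<open>x_c\<close> to \<open>x_c + x_b\<close> and \<open>x_b\<close> to
  \<open>x_b - x_c\<close>; a last transvection adds \<open>v\<close>.\<close>

lemma orbit_dvd:
  assumes "invariant a f" "a \<le> c" "c \<le> b" "b < e c" "c < n" "v \<in> V a b" "var c ^ r dvd f"
  shows "(var b + v) ^ r dvd f"
proof -
  have eb: "e b = e c" using block[of c b] st_le[of c] assms by auto
  have "e c \<le> n" using e_le assms by auto
  have avoid: "vars_in (- {b}) v" using V_vars_in[OF assms(6)] by (rule vars_in_mono) auto
  have v: "v \<in> V a (e b)" using V_mono[of a a b "e b"] assms eb by auto
  show ?thesis
  proof (cases "b = c")
    case True
    show ?thesis
      using dvd_psubst[OF assms(7) invariant_transvection[OF assms(1) _ _ v avoid]] True assms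
        by simp
  next
    case False
    have "psubst (var_subst c (var c + var b)) f = f"
      by (rule invariant_transvection[OF assms(1)]) (use assms False in \<open>auto intro: V_var\<close>)
    from dvd_psubst[OF assms(7) this] have 1: "(var c + var b) ^ r dvd f" by simp
    have "- var c \<in> V a (e b)" by (rule V_uminus[OF V_var]) (use assms eb in auto)
    moreover have "vars_in (- {b}) (- var c :: 'k sym_alg)" using False by simp
    ultimately have "psubst (var_subst b (var b + - var c)) f = f"
      using assms \<open>e c \<le> n\<close> by (intro invariant_transvection[OF assms(1)]) auto
    from dvd_psubst[OF 1 this] have 2: "var b ^ r dvd f" using False by simp
    have "psubst (var_subst b (var b + v)) f = f"
      by (rule invariant_transvection[OF assms(1)]) (use assms \<open>e c \<le> n\<close> v avoid in auto)
    from dvd_psubst[OF 2 this] show ?thesis by simp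
  qed
qed

definition inv_space :: "nat \<Rightarrow> nat \<Rightarrow> 'k sym_alg set" where
  "inv_space a d = {f. homogeneous d f \<and> vars_in {a..<n} f \<and> invariant a f}"

text \<open>The property shared by elementary substitutions and by all elements of the parabolic
  subgroup; it is all that invariance of the Dickson coefficients asks for.\<close>

definition stabilizes :: "nat \<Rightarrow> (nat \<Rightarrow> 'k sym_alg) \<Rightarrow> bool" where
  "stabilizes a \<sigma> \<longleftrightarrow> (\<forall>b. a \<le> b \<longrightarrow> b < n \<longrightarrow> inj_on (psubst \<sigma>) (V a (e b)) \<and> psubst \<sigma> ` V a (e b) = V a (e b))"

text \<open>For \<open>k < e b\<close> one has \<open>e k \<le> e b\<close>, so each flag subspace
  is mapped into itself; being finite, it is mapped onto itself by an injective map.\<close>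

lemma stabilizesI:
  assumes "\<And>b. a \<le> b \<Longrightarrow> b < n \<Longrightarrow> \<sigma> b \<in> V a (e b)" "inj_on (psubst \<sigma>) (V a n)"
  shows "stabilizes a \<sigma>"
  unfolding stabilizes_def
proof (intro allI impI)
  fix b assume b: "a \<le> b" "b < n"
  have inj: "inj_on (psubst \<sigma>) (V a (e b))"
    by (rule inj_on_subset[OF assms(2)]) (use V_mono[of a a] e_le b in auto)
  have "psubst \<sigma> ` V a (e b) \<subseteq> V a (e b)"
  proof (rule image_subsetI, rule psubst_in_V)
    fix k assume k: "a \<le> k" "k < e b"
    have "e k \<le> e b"
    proof (cases "k \<le> b")
      case True then show ?thesis using e_mono b by auto
    next
      case False
      then show ?thesis using block[of b k] st_le[of b] k b by auto
    qed
    moreover have "k < n" using k e_le b by (meson less_le_trans)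
    ultimately show "\<sigma> k \<in> V a (e b)" using assms(1)[of k] k V_mono[of a a "e k" "e b"] by auto
  qed
  then show "inj_on (psubst \<sigma>) (V a (e b)) \<and> psubst \<sigma> ` V a (e b) = V a (e b)"
    using inj endo_inj_surj[OF finite_V] by blast
qed

lemma elementary_stabilizes:
  assumes "\<sigma> \<in> elementary a" shows "stabilizes a \<sigma>"
proof (rule stabilizesI)
  obtain b c v where \<sigma>: "\<sigma> = var_subst b (cst c * var b + v)" "a \<le> b" "b < n" "c \<noteq> 0"
    "v \<in> V a (e b)" "vars_in (- {b}) v"
    using assms unfolding elementary_def by blast
  show "\<sigma> k \<in> V a (e k)" if "a \<le> k" "k < n" for k
    using \<sigma> that e_gt[of k] by (auto simp: var_subst_def intro!: V_add V_scale V_var)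
  define \<tau> where "\<tau> = var_subst b (cst (1 / c) * (var b - v))"
  have "psubst \<tau> (\<sigma> k) = var k" for k
  proof (cases "k = b")
    case True
    have "psubst \<tau> v = psubst var v" by (rule psubst_vars_in_cong[OF \<sigma>(6)]) (simp add: \<tau>_def)
    moreover have "cst c * (cst (1 / c) * (var b - v)) = var b - v"
      using \<sigma>(4) by (simp add: mult_single flip: mult.assoc)
    moreover have "psubst \<tau> (\<sigma> k) = cst c * (cst (1 / c) * (var b - v)) + psubst \<tau> v"
      using True by (simp add: \<sigma>(1)) (simp add: \<tau>_def)
    ultimately show ?thesis using True by (simp only: psubst_id diff_add_cancel)
  qed (simp add: \<sigma>(1) \<tau>_def)
  then have "psubst \<tau> (psubst \<sigma> f) = f" for f by (simp add: psubst_psubst)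
  then show "inj_on (psubst \<sigma>) (V a n)" by (rule inj_on_inverseI)
qed

section \<open>Dickson coefficients of the flag\<close>

lemma psubst_V_coeff:
  assumes "stabilizes a \<sigma>" "a \<le> b" "b < n"
  shows "psubst \<sigma> (Polynomial.coeff (\<Prod>v\<in>V a (e b). [:v, 1:]) k) =
      Polynomial.coeff (\<Prod>v\<in>V a (e b). [:v, 1:]) k"
proof -
  have "(\<Prod>v\<in>V a (e b). [:psubst \<sigma> v, 1:]) = (\<Prod>v\<in>psubst \<sigma> ` V a (e b). [:v, 1:])"
    using assms by (subst prod.reindex) (auto simp: stabilizes_def)
  also have "psubst \<sigma> ` V a (e b) = V a (e b)" using assms by (auto simp: stabilizes_def)
  finally show ?thesis by (simp add: psubst_coeff_prod[OF finite_V])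
qed

text \<open>A Dickson invariant of the flag subspace ending with the block of \<open>b\<close>. Only
  the coefficients whose index belongs to that block are selected, so there is one generator for
  each variable, and their degrees are the exponents in the denominator of the Hilbert
  series.\<close>

definition dickson :: "nat \<Rightarrow> nat \<Rightarrow> 'k sym_alg" where
  "dickson a b = Polynomial.coeff (\<Prod>v\<in>V a (e b). [:v, 1:]) (q ^ (b - a))"

lemma dickson_stable: "stabilizes a \<sigma> \<Longrightarrow> a \<le> b \<Longrightarrow> b < n \<Longrightarrow> psubst \<sigma> (dickson a b) = dickson a b"
  unfolding dickson_def by (rule psubst_V_coeff)

lemma dickson_homogeneous: "homogeneous (q ^ (e b - a) - q ^ (b - a)) (dickson a b)"
  using homogeneous_coeff_prod[OF finite_V, of a "e b" "\<lambda>v. v"] V_homogeneous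
  unfolding dickson_def by (simp add: card_V)

lemma dickson_vars_in: 
  assumes "b < n" shows "vars_in {a..<n} (dickson a b)"
  unfolding dickson_def
proof (rule vars_in_coeff_prod[OF finite_V])
  fix v assume "v \<in> V a (e b)"
  then show "vars_in {a..<n} v"
    using vars_in_mono[OF V_vars_in, of v a "e b" "{a..<n}"] e_le[OF assms] by auto
qed

text \<open>The factor for \<open>v = 0\<close> is the polynomial variable itself, so its linear
  coefficient is the constant term of the other factors.\<close>

lemma dickson_diag: "dickson a a = nz_prod a (e a)"
proof -
  have "V a (e a) = insert 0 (V a (e a) - {0})" by auto
  then have "dickson a a = Polynomial.coeff (\<Prod>v\<in>insert 0 (V a (e a) - {0}). [:v, 1:]) (Suc 0)"
    by (simp add: dickson_def)
  also have "\<dots> = Polynomial.coeff (\<Prod>v\<in>V a (e a) - {0}. [:v, 1:]) 0"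
    using coeff_prod_linear(2)[of "V a (e a) - {0}" 0 "\<lambda>v. v" 0] finite_V by simp
  also have "\<dots> = nz_prod a (e a)"
    unfolding nz_prod_def by (simp add: poly_prod flip: poly_0_coeff_0)
  finally show ?thesis .
qed

text \<open>At \<open>x_a = 0\<close> every vector of \<open>V (Suc a) (e b)\<close> is the image of
  \<open>q\<close> vectors. The defining product becomes a q-th power, and the coefficients of a
  q-th power are q-th powers.\<close>

lemma dickson_restrict:
  assumes "a < b" "b < n"
  shows "psubst (var_subst a 0) (dickson a b) = dickson (Suc a) b ^ q"
proof -
  have ae: "a < e b" using e_gt[of b] assms by linarith
  have eps: "psubst (var_subst a 0) v = v" if "v \<in> V (Suc a) (e b)" for v
    by (rule psubst_V_id[OF that]) auto
  have "(\<Prod>v\<in>V a (e b). [:psubst (var_subst a 0) v, 1:]) =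
      (\<Prod>(v, c)\<in>V (Suc a) (e b) \<times> (UNIV :: 'k set). [:v, 1:])"
    unfolding V_lower(1)[OF ae] prod.reindex[OF V_lower(2)[OF ae]]
    by (rule prod.cong) (auto simp: eps)
  also have "\<dots> = (\<Prod>v\<in>V (Suc a) (e b). [:v, 1:]) ^ q"
    by (simp add: prod.cartesian_product[symmetric] q_card prod_power_distrib)
  moreover have "q ^ (b - a) = q * q ^ (b - Suc a)"
    using assms by (simp flip: power_Suc add: Suc_diff_Suc)
  ultimately show ?thesis
    unfolding dickson_def psubst_coeff_prod[OF finite_V] by (simp only: coeff_poly_power_q)
qed

inductive dickson_alg :: "nat \<Rightarrow> nat \<Rightarrow> 'k sym_alg \<Rightarrow> bool" for a where
  zero: "dickson_alg a d 0"
| const: "dickson_alg a 0 (cst c)"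
| gen: "a \<le> b \<Longrightarrow> b < n \<Longrightarrow> dickson_alg a (q ^ (e b - a) - q ^ (b - a)) (dickson a b)"
| add: "dickson_alg a d f \<Longrightarrow> dickson_alg a d g \<Longrightarrow> dickson_alg a d (f + g)"
| mult: "dickson_alg a d f \<Longrightarrow> dickson_alg a d' g \<Longrightarrow> dickson_alg a (d + d') (f * g)"

lemma dickson_alg_stable:
  "dickson_alg a d f \<Longrightarrow> stabilizes a \<sigma> \<Longrightarrow> psubst \<sigma> f = f"
  by (induction rule: dickson_alg.induct) (auto simp: dickson_stable)

lemma dickson_alg_inv_space: "dickson_alg a d f \<Longrightarrow> f \<in> inv_space a d"
proof (induction rule: dickson_alg.induct)
  case (gen b)
  then show ?case
    using dickson_homogeneous dickson_vars_in dickson_stable[OF elementary_stabilizes]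
    by (auto simp: inv_space_def invariant_def)
qed (auto simp: inv_space_def intro: homogeneous_add homogeneous_mult vars_in_add vars_in_mult
    invariant_add invariant_mult)

text \<open>Taking q-th powers is additive, multiplicative and trivial on scalars, so lifting the
  generators by \<open>dickson_restrict\<close> is enough.\<close>

lemma dickson_alg_lift:
  assumes "dickson_alg (Suc a) d h" "a < n"
  shows "\<exists>f. dickson_alg a (q * d) f \<and> psubst (var_subst a 0) f = h ^ q"
  using assms(1)
proof (induction rule: dickson_alg.induct)
  case (zero d)
  show ?case by (rule exI[of _ 0]) (use q_pos in \<open>auto simp: zero_power intro: dickson_alg.zero\<close>)
next
  case (const c)
  show ?case by (rule exI[of _ "cst c"]) (simp add: cst_power field_power_q dickson_alg.const)
next
  case (gen b)
  have "q * (q ^ (e b - Suc a) - q ^ (b - Suc a)) = q ^ (e b - a) - q ^ (b - a)"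
    using gen e_gt[of b] by (simp add: diff_mult_distrib2 Suc_diff_Suc flip: power_Suc)
  then show ?case
    using dickson_alg.gen[of a b] dickson_restrict[of a b] gen
      by (intro exI[of _ "dickson a b"]) auto
next
  case (add d f g)
  then obtain F G where "dickson_alg a (q * d) F" "psubst (var_subst a 0) F = f ^ q"
    "dickson_alg a (q * d) G" "psubst (var_subst a 0) G = g ^ q" by blast
  then show ?case
    using frob_add[of f g 1] by (intro exI[of _ "F + G"]) (auto intro: dickson_alg.add)
next
  case (mult d f d' g)
  then obtain F G where "dickson_alg a (q * d) F" "psubst (var_subst a 0) F = f ^ q"
    "dickson_alg a (q * d') G" "psubst (var_subst a 0) G = g ^ q" by blast
  then show ?case
    using dickson_alg.mult[of a "q * d" F "q * d'" G]
    by (intro exI[of _ "F * G"]) (auto simp: distrib_left power_mult_distrib)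
qed

section \<open>Kernel and image of setting the lowest variable to 0\<close>

lemma dickson_diag_invariant: "a < n \<Longrightarrow> invariant a (nz_prod a (e a))"
  using dickson_stable[OF elementary_stabilizes, of _ a a]
    by (auto simp: invariant_def dickson_diag)

text \<open>The torus makes the positive exponents of \<open>x_a\<close> multiples of
  \<open>q - 1\<close>; the orbit of \<open>x_a\<close> reaches all normalized vectors of the
  subspace.\<close>

lemma dvd_var_imp_nz_prod_dvd:
  assumes "a < n" "invariant a f" "var a dvd f"
  shows "nz_prod a (e a) dvd f"
proof (rule nz_prod_dvd)
  show "a \<le> e a" using e_gt assms by (simp add: less_imp_le)
  have "var a ^ (q - 1) dvd f"
    unfolding var_power_dvd_iff
  proof
    fix m assume m: "m \<in> keys f"
    have "(q - 1) dvd lookup m a + 0"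
      by (rule torus_keys[OF _ m]) (use invariant_torus[OF assms(2)] assms(1) in simp)
    moreover have "1 \<le> lookup m a" using assms(3) m var_power_dvd_iff[of a 1 f] by auto
    ultimately show "q - 1 \<le> lookup m a" by (auto dest: dvd_imp_le)
  qed
  then show "\<alpha> ^ (q - 1) dvd f" if "\<alpha> \<in> norm_set a (e a)" for \<alpha>
    using that orbit_dvd[OF assms(2) order_refl _ _ assms(1)] by (auto simp: norm_set_def)
qed

text \<open>The quotient inherits invariance, variables and degree by cancellation in a domain. The
  conditional accounts for degrees too small for a nonzero quotient.\<close>

lemma inv_space_kernel:
  assumes "a < n" "f \<in> inv_space a d" "psubst (var_subst a 0) f = 0"
  shows "\<exists>g. f = nz_prod a (e a) * g \<and>
    (if q ^ (e a - a) - 1 \<le> d then g \<in> inv_space a (d - (q ^ (e a - a) - 1)) else g = 0)"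
proof -
  have f: "homogeneous d f" "vars_in {a..<n} f" "invariant a f" using assms
    by (auto simp: inv_space_def)
  have "var a dvd f" using assms(3) by (simp add: var_dvd_iff)
  then obtain g where g: "f = nz_prod a (e a) * g"
    using dvd_var_imp_nz_prod_dvd[OF assms(1) f(3)] by blast
  have vars: "vars_in {a..<n} (nz_prod a (e a))"
    by (rule vars_in_mono[OF nz_prod_vars_in]) (use e_le[OF assms(1)] in auto)
  have inv: "invariant a g"
    using invariant_cancel[OF f(3)[unfolded g] dickson_diag_invariant[OF assms(1)] nz_prod_nonzero] .
  have "vars_in {a..<n} g" using vars_in_cancel[OF f(2)[unfolded g] vars nz_prod_nonzero] .
  moreover note homogeneous_cancel[OF f(1)[unfolded g] nz_prod_homogeneous nz_prod_nonzero]
  ultimately show ?thesis using g inv by (intro exI[of _ g]) (auto simp: inv_space_def)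
qed

text \<open>Transvections with root \<open>x_a\<close> force all remaining exponents to be divisible
  by \<open>q\<close>. The root \<open>h\<close> inherits the invariance of its q-th power because
  the Frobenius map is injective.\<close>

lemma inv_space_restrict:
  assumes "a < n" "f \<in> inv_space a d"
  shows "\<exists>h. psubst (var_subst a 0) f =
      h ^ q \<and> (if q dvd d then h \<in> inv_space (Suc a) (d div q) else h = 0)"
proof -
  let ?eps = "psubst (var_subst a 0)"
  have f: "homogeneous d f" "vars_in {a..<n} f" "invariant a f" using assms
    by (auto simp: inv_space_def)
  have vars: "vars_in {Suc a..<n} (?eps f)"
    by (rule vars_in_psubst[OF f(2)]) (auto simp: var_subst_def)
  have hom: "homogeneous d (?eps f)"
    by (rule homogeneous_psubst[OF f(1)]) (auto simp: var_subst_def)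
  have div: "q dvd lookup m k" if m: "m \<in> keys (?eps f)" for m k
  proof (cases "k \<in> keys m")
    case True
    then have "k \<in> {Suc a..<n}" using vars m unfolding vars_in_def by blast
    then have k: "a < k" "k < n" by auto
    have "psubst (var_subst k (var k + cst c * var a)) f = f" for c
      by (rule invariant_transvection[OF f(3)])
        (use k e_gt[of k] in \<open>auto intro!: V_scale V_var vars_in_mult\<close>)
    then show ?thesis using exponents_divisible[OF k(1) f(1)] m by blast
  qed (simp add: in_keys_iff)
  obtain h where h: "?eps f = h ^ q" "homogeneous (d div q) h" "\<not> q dvd d \<Longrightarrow> h = 0"
    using q_th_root[OF div hom] by blast
  have "psubst (restrict_vars {Suc a..<n}) h ^ q = h ^ q"
    using vars unfolding h(1) vars_in_iff psubst_power .
  then have hvars: "vars_in {Suc a..<n} h" unfolding vars_in_iff by (rule frob_inject)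
  have "psubst \<sigma> h = h" if el: "\<sigma> \<in> elementary (Suc a)" for \<sigma>
  proof (rule frob_inject)
    obtain b c v where \<sigma>: "\<sigma> = var_subst b (cst c * var b + v)" "Suc a \<le> b" "v \<in> V (Suc a) (e b)"
      using el unfolding elementary_def by blast
    have "psubst (var_subst a 0) v = v" by (rule psubst_V_id[OF \<sigma>(3)]) auto
    then have "psubst \<sigma> (var_subst a 0 k) = ?eps (\<sigma> k)" for k
      using \<sigma>(2) by (simp add: \<sigma>(1) var_subst_def)
    then have "psubst \<sigma> (?eps f) = ?eps (psubst \<sigma> f)" by (simp add: psubst_psubst)
    also have "psubst \<sigma> f = f" using f(3) el elementary_Suc[of a] by (auto simp: invariant_def)
    finally show "psubst \<sigma> h ^ q = h ^ q" by (simp add: h(1))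
  qed
  then have "invariant (Suc a) h" by (simp add: invariant_def)
  then show ?thesis using h hvars by (intro exI[of _ h]) (auto simp: inv_space_def)
qed

lemma inv_space_n: "f \<in> inv_space n d \<Longrightarrow> f = cst (lookup f 0) \<and> (d \<noteq> 0 \<longrightarrow> f = 0)"
proof -
  assume f: "f \<in> inv_space n d"
  have "m = 0" if "m \<in> keys f" for m
    using f that by (auto simp: inv_space_def vars_in_def)
  then have "homogeneous 0 f" unfolding homogeneous_def by (metis monom_deg_0)
  then have "f = cst (lookup f 0)" by (rule homogeneous_0_imp_cst)
  moreover have "f = 0" if "d \<noteq> 0"
  proof -
    have "homogeneous d f" using f by (simp add: inv_space_def)
    then have "hcomp 0 f = 0" using hcomp_homogeneous[of d f 0] that by simp
    then show "f = 0" using hcomp_homogeneous[OF \<open>homogeneous 0 f\<close>, of 0] by simp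
  qed
  ultimately show ?thesis by blast
qed

lemma inv_space_diff: "f \<in> inv_space a d \<Longrightarrow> g \<in> inv_space a d \<Longrightarrow> f - g \<in> inv_space a d"
  by (auto simp: inv_space_def intro: homogeneous_diff vars_in_diff invariant_diff)

text \<open>Downward induction on \<open>a\<close>, and inside it induction on the degree: lift the
  restriction of \<open>f\<close> to some \<open>F\<close> in the algebra, then divide the kernel
  element \<open>f - F\<close> by its forced factor. The conclusion is what turns invariance under
  elementary substitutions into invariance under the whole group.\<close>

theorem inv_space_dickson_alg:
  assumes "a \<le> n" "f \<in> inv_space a d"
  shows "dickson_alg a d f"
  using assms
proof (induction a arbitrary: d f rule: inc_induct)
  case base
  then show ?case using inv_space_n[of f d] dickson_alg.zero dickson_alg.const by metis
next
  case (step a)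
  have "a < n" using step by simp
  show ?case using step.prems
  proof (induction d arbitrary: f rule: less_induct)
    case (less d)
    obtain h where h: "psubst (var_subst a 0) f = h ^ q"
      "if q dvd d then h \<in> inv_space (Suc a) (d div q) else h = 0"
      using inv_space_restrict[OF \<open>a < n\<close> less.prems] by blast
    have "\<exists>F. dickson_alg a d F \<and> psubst (var_subst a 0) F = h ^ q"
    proof (cases "q dvd d")
      case True
      then have "dickson_alg (Suc a) (d div q) h" using step.IH h by auto
      then show ?thesis using dickson_alg_lift[OF _ \<open>a < n\<close>] True by fastforce
    next
      case False
      then show ?thesis using h q_pos
        by (intro exI[of _ 0]) (auto simp: zero_power intro: dickson_alg.zero)
    qed
    then obtain F where F: "dickson_alg a d F" "psubst (var_subst a 0) F = h ^ q" by blast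
    have "f - F \<in> inv_space a d" using less.prems dickson_alg_inv_space[OF F(1)]
      by (rule inv_space_diff)
    moreover have "psubst (var_subst a 0) (f - F) = 0" using F h by simp
    ultimately obtain g where g: "f - F = nz_prod a (e a) * g"
      "if q ^ (e a - a) - 1 \<le> d then g \<in> inv_space a (d - (q ^ (e a - a) - 1)) else g = 0"
      using inv_space_kernel[OF \<open>a < n\<close>] by blast
    \<comment> \<open>The forced factor has positive degree, so the inner induction
      descends.\<close>
    have pos: "q ^ (e a - a) - 1 > 0"
      using one_less_power[OF q_gt_1, of "e a - a"] e_gt[OF \<open>a < n\<close>] by simp
    have D: "dickson_alg a (q ^ (e a - a) - 1) (nz_prod a (e a))"
      using dickson_alg.gen[of a a] \<open>a < n\<close> by (simp add: dickson_diag)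
    have "dickson_alg a d (nz_prod a (e a) * g)"
    proof (cases "q ^ (e a - a) - 1 \<le> d")
      case True
      then have "dickson_alg a (d - (q ^ (e a - a) - 1)) g"
        using less.IH[of "d - (q ^ (e a - a) - 1)" g] g(2) pos by auto
      from dickson_alg.mult[OF D this] show ?thesis using True by simp
    qed (use g in \<open>auto intro: dickson_alg.zero\<close>)
    then have "dickson_alg a d (F + (f - F))" unfolding g(1) using F(1) by (intro dickson_alg.add)
    then show ?case by simp
  qed
qed

text \<open>A counterpart of the exact sequence kernel, space, image. The lifts \<open>L h\<close>
  are chosen arbitrarily and involve q-th powers, so the map is only a bijection of sets, which
  suffices for counting.\<close>

lemma inv_space_bij:
  assumes "a < n"
  defines "A \<equiv> \<lambda>d. if q ^ (e a - a) - 1 \<le> d then inv_space a (d - (q ^ (e a - a) - 1)) else {0}"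
    and "B \<equiv> \<lambda>d. if q dvd d then inv_space (Suc a) (d div q) else {0}"
  shows "\<exists>\<phi>. bij_betw \<phi> (A d \<times> B d) (inv_space a d)"
proof -
  have "\<exists>F. F \<in> inv_space a d \<and> psubst (var_subst a 0) F = h ^ q" if "h \<in> B d" for h
  proof (cases "q dvd d")
    case True
    then have "dickson_alg (Suc a) (d div q) h"
      using inv_space_dickson_alg[of "Suc a"] assms(1) that by (auto simp: B_def)
    from dickson_alg_lift[OF this assms(1)] show ?thesis
      using True dickson_alg_inv_space by fastforce
  next
    case False
    then show ?thesis using that q_pos
      by (intro exI[of _ 0]) (auto simp: B_def zero_power inv_space_def)
  qed
  then obtain L where L: "\<And>h. h \<in> B d \<Longrightarrow> L h \<in> inv_space a d \<and> psubst (var_subst a 0) (L h) = h ^ q"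
    by metis
  let ?D = "nz_prod a (e a)" and ?eps = "psubst (var_subst a 0)"
  have D: "?D \<in> inv_space a (q ^ (e a - a) - 1)"
    using dickson_alg_inv_space[OF dickson_alg.gen[of a a]] assms(1) by (simp add: dickson_diag)
  have epsD: "?eps ?D = 0"
  proof -
    have "var a \<in> V a (e a) - {0}"
    proof
      show "var a \<in> V a (e a)" using e_gt assms(1) by (intro V_var) auto
      show "(var a :: 'k sym_alg) \<notin> {0}" by simp
    qed
    then have "var a dvd ?D" unfolding nz_prod_def using finite_V by (intro dvd_prodI) auto
    then show ?thesis by (simp add: var_dvd_iff)
  qed
  have "bij_betw (\<lambda>(g, h). ?D * g + L h) (A d \<times> B d) (inv_space a d)"
  proof (rule bij_betw_imageI)
    show "inj_on (\<lambda>(g, h). ?D * g + L h) (A d \<times> B d)"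
    proof (rule inj_onI, clarify)
      fix g h g' h' assume *: "g \<in> A d" "h \<in> B d" "g' \<in> A d" "h' \<in> B d" "?D * g + L h =
          ?D * g' + L h'"
      have "h ^ q = h' ^ q" using arg_cong[OF *(5), of ?eps] L *(2,4) epsD by simp
      then have "h = h'" by (rule frob_inject)
      then have "?D * g = ?D * g'" using *(5) by simp
      then show "g = g' \<and> h = h'" using \<open>h = h'\<close> sym_alg_mult_left_cancel[OF nz_prod_nonzero]
        by blast
    qed
    show "(\<lambda>(g, h). ?D * g + L h) ` (A d \<times> B d) = inv_space a d"
    proof (intro equalityI subsetI)
      fix f assume "f \<in> (\<lambda>(g, h). ?D * g + L h) ` (A d \<times> B d)"
      then obtain g h where f: "f = ?D * g + L h" "g \<in> A d" "h \<in> B d" by auto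
      have "?D * g \<in> inv_space a d"
      proof (cases "q ^ (e a - a) - 1 \<le> d")
        case True
        then have g: "g \<in> inv_space a (d - (q ^ (e a - a) - 1))" using f by (simp add: A_def)
        have "homogeneous (q ^ (e a - a) - 1 + (d - (q ^ (e a - a) - 1))) (?D * g)"
          by (rule homogeneous_mult) (use D g in \<open>auto simp: inv_space_def\<close>)
        then show ?thesis using True D g
          by (auto simp: inv_space_def intro: vars_in_mult invariant_mult)
      next
        case False
        then show ?thesis using f by (auto simp: A_def inv_space_def)
      qed
      then show "f \<in> inv_space a d" using L[OF f(3)] unfolding f(1)
        by (auto simp: inv_space_def intro: homogeneous_add vars_in_add invariant_add)
    next
      fix f assume f: "f \<in> inv_space a d"
      then obtain h where h: "?eps f = h ^ q" "h \<in> B d"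
        using inv_space_restrict[OF assms(1) f] by (auto simp: B_def split: if_splits)
      have "f - L h \<in> inv_space a d" "?eps (f - L h) = 0"
        using L[OF h(2)] h(1) f by (auto intro: inv_space_diff)
      from inv_space_kernel[OF assms(1) this] obtain g where g: "f - L h = ?D * g"
        "if q ^ (e a - a) - 1 \<le> d then g \<in> inv_space a (d - (q ^ (e a - a) - 1)) else g = 0"
        by blast
      then have "g \<in> A d" by (simp add: A_def split: if_splits)
      with g(1) have "f = (\<lambda>(g, h). ?D * g + L h) (g, h)" "(g, h) \<in> A d \<times> B d"
        using h(2) by (simp_all add: diff_eq_eq)
      then show "f \<in> (\<lambda>(g, h). ?D * g + L h) ` (A d \<times> B d)" by (rule image_eqI)
    qed
  qed
  then show ?thesis by blast
qed

end

section \<open>Alternating forms and contractions\<close>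

text \<open>
  An element \<open>\<Sum>\<^sub>J w\<^sub>J x\<^sub>J\<close> of \<open>R \<otimes> \<And>(V)\<close> is represented by the function \<open>J \<mapsto> w\<^sub>J\<close>.
  Contraction with \<open>u\<close> is the antiderivation that sends \<open>x\<^sub>j\<close> (in degree one) to \<open>u\<^sub>j\<close>.
\<close>

definition ext_sign :: "nat \<Rightarrow> nat set \<Rightarrow> 'r::comm_ring_1" where
  "ext_sign j K = (- 1) ^ card {k \<in> K. k < j}"

definition contraction :: "nat \<Rightarrow> (nat \<Rightarrow> 'r::comm_ring_1) \<Rightarrow> (nat set \<Rightarrow> 'r) \<Rightarrow> nat set \<Rightarrow> 'r" where
  "contraction n u w K = (\<Sum>j\<in>{..<n} - K. u j * ext_sign j K * w (insert j K))"

definition ext_mult :: "nat \<Rightarrow> (nat \<Rightarrow> 'r::comm_ring_1) \<Rightarrow> (nat set \<Rightarrow> 'r) \<Rightarrow> nat set \<Rightarrow> 'r" where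
  "ext_mult n v w K = (\<Sum>k\<in>{..<n} \<inter> K. v k * ext_sign k K * w (K - {k}))"

abbreviation contractions ::
  "nat \<Rightarrow> (nat \<Rightarrow> 'r::comm_ring_1) list \<Rightarrow> (nat set \<Rightarrow> 'r) \<Rightarrow> nat set \<Rightarrow> 'r" where
  "contractions n us w \<equiv> foldr (contraction n) us w"

lemma ext_sign_insert:
  "k \<notin> K \<Longrightarrow> ext_sign j (insert k K) = (if k < j then - ext_sign j K else ext_sign j K)"
proof -
  assume "k \<notin> K"
  then have "{i \<in> insert k K. i < j} = (if k < j then insert k {i \<in> K. i < j} else {i \<in> K. i < j})"
    by auto
  then show ?thesis using \<open>k \<notin> K\<close> by (simp add: ext_sign_def)
qed

lemma ext_sign_insert_self: "ext_sign j (insert j K) = ext_sign j K"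
  unfolding ext_sign_def by (rule arg_cong[of _ _ "\<lambda>A. (- 1) ^ card A"]) auto

lemma ext_sign_Diff:
  "k \<in> K \<Longrightarrow> ext_sign j (K - {k}) = (if k < j then - ext_sign j K else ext_sign j K)"
proof -
  assume "k \<in> K"
  then have "ext_sign j K = (if k < j then - ext_sign j (K - {k}) else (ext_sign j (K - {k}) :: 'a))"
    using ext_sign_insert[of k "K - {k}" j] by (simp add: insert_absorb)
  then show ?thesis by simp
qed

lemma ext_sign_square [simp]: "ext_sign j K * ext_sign j K = 1"
  by (simp add: ext_sign_def flip: power_mult_distrib)

lemma ext_sign_cases: "ext_sign j K = 1 \<or> ext_sign j K = - 1"
  by (cases "even (card {k \<in> K. k < j})") (simp_all add: ext_sign_def)

section \<open>Iterated contractions\<close>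

lemma contraction_0 [simp]: "contraction n u (\<lambda>_. 0) = (\<lambda>_. 0)"
  by (simp add: contraction_def fun_eq_iff)

lemma contractions_0 [simp]: "contractions n us (\<lambda>_. 0) = (\<lambda>_. 0)"
  by (induction us) auto

lemma contraction_add: "contraction n u (\<lambda>K. w K + w' K) =
    (\<lambda>K. contraction n u w K + contraction n u w' K)"
  by (simp add: contraction_def fun_eq_iff distrib_left sum.distrib)

lemma contractions_add: "contractions n us (\<lambda>K. w K + w' K) =
    (\<lambda>K. contractions n us w K + contractions n us w' K)"
  by (induction us) (auto simp: contraction_add)

lemma contraction_scale: "contraction n u (\<lambda>K. c * w K) = (\<lambda>K. c * contraction n u w K)"
  by (auto simp: contraction_def fun_eq_iff sum_distrib_left mult_ac intro!: sum.cong)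

lemma contractions_scale: "contractions n us (\<lambda>K. c * w K) = (\<lambda>K. c * contractions n us w K)"
  by (induction us) (auto simp: contraction_scale)

lemma contractions_uminus: "contractions n us (\<lambda>K. - w K) = (\<lambda>K. - contractions n us w K)"
  using contractions_scale[of n us "- 1" w] by simp

lemma contractions_sum:
  "contractions n us (\<lambda>K. \<Sum>i\<in>I. w i K) = (\<lambda>K. \<Sum>i\<in>I. contractions n us (w i) K)"
  by (induction I rule: infinite_finite_induct) (auto simp: contractions_add)

lemma contraction_vec_add: "contraction n (\<lambda>j. u j + v j) w =
    (\<lambda>K. contraction n u w K + contraction n v w K)"
  by (simp add: contraction_def fun_eq_iff distrib_right sum.distrib)

lemma contraction_vec_scale: "contraction n (\<lambda>j. c * u j) w = (\<lambda>K. c * contraction n u w K)"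
  by (auto simp: contraction_def fun_eq_iff sum_distrib_left mult_ac intro!: sum.cong)

text \<open>Removing \<open>j\<close> and \<open>k\<close> in the two possible orders gives opposite
  signs, so 2 by 2 minors of the vectors appear. Anticommutation and, in every characteristic, the
  vanishing of a repeated contraction can be read off.\<close>

lemma contraction_contraction:
  "contraction n u (contraction n v w) K =
    (\<Sum>(j, k)\<in>{(j, k). j < k \<and> k < n \<and> j \<notin> K \<and> k \<notin> K}.
      (u k * v j - u j * v k) * (ext_sign j K * ext_sign k K * w (insert j (insert k K))))"
proof -
  define P where "P = {(j, k). j < k \<and> k < n \<and> j \<notin> K \<and> k \<notin> K}"
  define T where "T j k = u j * v k * (ext_sign j K * ext_sign k (insert j K)) * w (insert j (insert k K))" for j k
  have fin: "finite P" by (rule finite_subset[of _ "{..<n} \<times> {..<n}"]) (auto simp: P_def)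
  have "contraction n u (contraction n v w) K =
      (\<Sum>j\<in>{..<n} - K. \<Sum>k\<in>{..<n} - insert j K. T j k)"
    by (auto simp: contraction_def T_def sum_distrib_left insert_commute mult_ac intro!: sum.cong)
  also have "\<dots> = (\<Sum>(j, k)\<in>Sigma ({..<n} - K) (\<lambda>j. {..<n} - insert j K). T j k)"
    by (rule sum.Sigma) auto
  also have "Sigma ({..<n} - K) (\<lambda>j. {..<n} - insert j K) = P \<union> prod.swap ` P"
    by (auto simp: P_def image_iff)
  also have "(\<Sum>(j, k)\<in>P \<union> prod.swap ` P. T j k) =
      (\<Sum>(j, k)\<in>P. T j k) + (\<Sum>(j, k)\<in>prod.swap ` P. T j k)"
    using fin by (intro sum.union_disjoint) (auto simp: P_def)
  also have "(\<Sum>(j, k)\<in>prod.swap ` P. T j k) = (\<Sum>(j, k)\<in>P. T k j)"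
    by (subst sum.reindex) (auto simp: split_def)
  also have "(\<Sum>(j, k)\<in>P. T j k) + (\<Sum>(j, k)\<in>P. T k j) = (\<Sum>(j, k)\<in>P. T j k + T k j)"
    by (simp add: sum.distrib split_def)
  also have "\<dots> = (\<Sum>(j, k)\<in>P. (u k * v j - u j * v k) * (ext_sign j K * ext_sign k K * w (insert j (insert k K))))"
    by (rule sum.cong) (auto simp: P_def T_def ext_sign_insert insert_commute algebra_simps)
  finally show ?thesis by (simp add: P_def)
qed

lemma contraction_anticommute: "contraction n u (contraction n v w) =
    (\<lambda>K. - contraction n v (contraction n u w) K)"
  by (auto simp: contraction_contraction fun_eq_iff algebra_simps sum_subtractf split_def intro!: sum.cong
      simp flip: sum_negf)

lemma contraction_self [simp]: "contraction n u (contraction n u w) = (\<lambda>_. 0)"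
  by (auto simp: contraction_contraction fun_eq_iff mult.commute)

text \<open>Signs of reorderings are left open: only divisibility and vanishing of contractions are
  used.\<close>

definition same_up_to_sign :: "('b \<Rightarrow> 'r::comm_ring_1) \<Rightarrow> ('b \<Rightarrow> 'r) \<Rightarrow> bool" where
  "same_up_to_sign w w' \<longleftrightarrow> w = w' \<or> w = (\<lambda>K. - w' K)"

lemma same_up_to_sign_trans: "same_up_to_sign u v \<Longrightarrow> same_up_to_sign v w \<Longrightarrow> same_up_to_sign u w"
  by (auto simp: same_up_to_sign_def)

lemma same_up_to_sign_contraction: "same_up_to_sign w w' \<Longrightarrow>
    same_up_to_sign (contraction n u w) (contraction n u w')"
  using contractions_uminus[of n "[u]" w'] by (auto simp: same_up_to_sign_def)

lemma contractions_move: "same_up_to_sign (contractions n (us @ u # vs) w) (contractions n (u # us @ vs) w)"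
proof (induction us)
  case (Cons a us)
  let ?w = "contractions n (us @ vs) w"
  have "same_up_to_sign (contraction n a (contractions n (us @ u # vs) w)) (contraction n a (contraction n u ?w))"
    using same_up_to_sign_contraction[OF Cons, of n a] by simp
  moreover have "same_up_to_sign (contraction n a (contraction n u ?w)) (contraction n u (contraction n a ?w))"
    using contraction_anticommute[of n a u ?w] by (simp add: same_up_to_sign_def)
  ultimately show ?case by (auto intro: same_up_to_sign_trans)
qed (simp add: same_up_to_sign_def)

lemma contractions_perm:
  "mset us = mset vs \<Longrightarrow> same_up_to_sign (contractions n us w) (contractions n vs w)"
proof (induction us arbitrary: vs)
  case (Cons u us)
  then have "u \<in> set vs" by (metis list.set_intros(1) mset_eq_setD)
  then obtain ps ss where vs: "vs = ps @ u # ss" by (meson split_list)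
  have "mset us = mset (ps @ ss)" using Cons.prems vs by simp
  then have "same_up_to_sign (contractions n us w) (contractions n (ps @ ss) w)" by (rule Cons.IH)
  from same_up_to_sign_contraction[OF this, of n u] show ?case
    using contractions_move[of n ps u ss w] by (auto simp: vs same_up_to_sign_def)
qed (simp add: same_up_to_sign_def)

lemma contractions_not_distinct:
  assumes "\<not> distinct us" shows "contractions n us w = (\<lambda>_. 0)"
proof -
  obtain as u bs cs where us: "us = as @ [u] @ bs @ [u] @ cs"
    using not_distinct_decomp[OF assms] by blast
  have "same_up_to_sign (contractions n (u # bs @ [u] @ cs) w) (\<lambda>_. 0)"
    using same_up_to_sign_contraction[OF contractions_move[of n bs u cs w], of n u]
    by (auto simp: same_up_to_sign_def)
  then have "contractions n (u # bs @ [u] @ cs) w = (\<lambda>_. 0)" by (auto simp: same_up_to_sign_def)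
  then show ?thesis unfolding us by (simp add: foldr_append)
qed

text \<open>The antiderivation rule for a product with a form of degree one on the left.\<close>

lemma contraction_ext_mult:
  assumes "K \<subseteq> {..<n}"
  shows "contraction n u (ext_mult n v w) K =
      (\<Sum>k<n. u k * v k) * w K - ext_mult n v (contraction n u w) K"
proof -
  define C where "C = {..<n} - K"
  have K: "{..<n} \<inter> K = K" "finite K" using assms finite_subset by auto
  have CK: "{..<n} = C \<union> K" "C \<inter> K = {}" "finite C" using assms by (auto simp: C_def)
  have S1: "ext_mult n v w (insert j K) = v j * ext_sign j K * w K +
      (\<Sum>k\<in>K. v k * ext_sign k (insert j K) * w (insert j K - {k}))" if "j \<in> C" for j
  proof -
    have "{..<n} \<inter> insert j K = insert j K" "j \<notin> K" using that K by (auto simp: C_def)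
    then show ?thesis using K by (simp add: ext_mult_def ext_sign_insert_self)
  qed
  have S2: "contraction n u w (K - {k}) = u k * ext_sign k K * w K +
      (\<Sum>j\<in>C. u j * ext_sign j (K - {k}) * w (insert j (K - {k})))" if "k \<in> K" for k
  proof -
    have "{..<n} - (K - {k}) = insert k C" "k \<notin> C" using that assms by (auto simp: C_def)
    then show ?thesis using CK that by (simp add: contraction_def ext_sign_Diff insert_absorb)
  qed
  \<comment> \<open>The cross term in which \<open>j\<close> is contracted and \<open>k\<close> is
    multiplied; it occurs in both expansions, with opposite signs.\<close>
  define X where "X j k = u j * v k * (ext_sign j K * ext_sign k (insert j K)) * w (insert j K - {k})" for j k
  have "contraction n u (ext_mult n v w) K = (\<Sum>j\<in>C. u j * v j * w K + (\<Sum>k\<in>K. X j k))"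
    unfolding contraction_def C_def[symmetric]
  proof (rule sum.cong[OF refl])
    fix j assume j: "j \<in> C"
    have "u j * ext_sign j K * (v j * ext_sign j K * w K) =
        (u j * v j * w K) * (ext_sign j K * ext_sign j K)"
      by (simp only: mult_ac)
    moreover have "u j * ext_sign j K * (v k * ext_sign k (insert j K) * w (insert j K - {k})) =
        X j k" for k
      unfolding X_def by (simp only: mult_ac)
    ultimately show "u j * ext_sign j K * ext_mult n v w (insert j K) =
        u j * v j * w K + (\<Sum>k\<in>K. X j k)"
      unfolding S1[OF j] by (simp add: distrib_left sum_distrib_left)
  qed
  moreover have "ext_mult n v (contraction n u w) K = (\<Sum>k\<in>K. u k * v k * w K - (\<Sum>j\<in>C. X j k))"
    unfolding ext_mult_def K(1)
  proof (rule sum.cong)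
    fix k assume k: "k \<in> K"
    have "v k * ext_sign k K * (u j * ext_sign j (K - {k}) * w (insert j (K - {k}))) = - X j k"
      if "j \<in> C" for j
    proof -
      have j: "j \<notin> K" "j \<noteq> k" using that k by (auto simp: C_def)
      then have "insert j (K - {k}) = insert j K - {k}" by auto
      then show ?thesis using j k by (auto simp: X_def ext_sign_insert ext_sign_Diff algebra_simps)
    qed
    then have "v k * ext_sign k K * (\<Sum>j\<in>C. u j * ext_sign j (K - {k}) * w (insert j (K - {k}))) =
        (\<Sum>j\<in>C. - X j k)"
      unfolding sum_distrib_left by (rule sum.cong[OF refl])
    moreover have "v k * ext_sign k K * (u k * ext_sign k K * w K) =
        (u k * v k * w K) * (ext_sign k K * ext_sign k K)"
      by (simp only: mult_ac)
    ultimately show "v k * ext_sign k K * contraction n u w (K - {k}) =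
        u k * v k * w K - (\<Sum>j\<in>C. X j k)"
      unfolding S2[OF k] distrib_left by (simp add: sum_negf)
  qed simp
  moreover have "(\<Sum>k\<in>K. \<Sum>j\<in>C. X j k) = (\<Sum>j\<in>C. \<Sum>k\<in>K. X j k)" by (rule sum.swap)
  moreover have "(\<Sum>k<n. u k * v k) * w K = (\<Sum>k\<in>C. u k * v k * w K) + (\<Sum>k\<in>K. u k * v k * w K)"
    unfolding CK(1) sum_distrib_right using CK K by (intro sum.union_disjoint) auto
  ultimately show ?thesis by (simp add: sum.distrib sum_subtractf)
qed

lemma ext_mult_sum: "ext_mult n v (\<lambda>K. \<Sum>i\<in>I. c i * w i K) K = (\<Sum>i\<in>I. c i * ext_mult n v (w i) K)"
  unfolding ext_mult_def sum_distrib_left by (subst sum.swap) (simp add: mult_ac)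

text \<open>The image of \<open>x\<^sub>J\<close> under the endomorphism \<open>x\<^sub>j \<mapsto> \<Sum>\<^sub>k g k j x\<^sub>k\<close>.\<close>

definition ext_image :: "nat \<Rightarrow> (nat \<Rightarrow> nat \<Rightarrow> 'k::field) \<Rightarrow> nat set \<Rightarrow> nat set \<Rightarrow> 'k sym_alg" where
  "ext_image n g J = foldr (\<lambda>j. ext_mult n (\<lambda>k. cst (g k j))) (sorted_list_of_set J) (\<lambda>K. if K = {} then 1 else 0)"

section \<open>Linear maps acting on forms\<close>

definition lin_subst :: "nat \<Rightarrow> (nat \<Rightarrow> nat \<Rightarrow> 'k::field) \<Rightarrow> nat \<Rightarrow> 'k sym_alg" where
  "lin_subst n g j = (if j < n then (\<Sum>k<n. cst (g k j) * var k) else var j)"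

definition form_act :: "nat \<Rightarrow> (nat \<Rightarrow> nat \<Rightarrow> 'k::field) \<Rightarrow> (nat set \<Rightarrow> 'k sym_alg) \<Rightarrow> nat set \<Rightarrow> 'k sym_alg" where
  "form_act n g w K = (\<Sum>J\<in>Pow {..<n}. psubst (lin_subst n g) (w J) * ext_image n g J K)"

lemma ext_image_empty: "ext_image n g {} K = (if K = {} then 1 else 0)"
  by (simp add: ext_image_def)

lemma ext_image_insert:
  assumes "finite A" "\<forall>a\<in>A. b < a"
  shows "ext_image n g (insert b A) = ext_mult n (\<lambda>k. cst (g k b)) (ext_image n g A)"
proof -
  have "b \<notin> A" using assms by auto
  moreover have "insort b (sorted_list_of_set A) = b # sorted_list_of_set A"
    by (rule insort_is_Cons) (use assms in \<open>auto intro: less_imp_le\<close>)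
  ultimately have "sorted_list_of_set (insert b A) = b # sorted_list_of_set A"
    using assms by simp
  then show ?thesis by (simp add: ext_image_def)
qed

text \<open>Each column indexed by \<open>J\<close> has its entries in the rows of \<open>M\<close>.
  With \<open>M\<close> an initial segment this expresses block triangularity; with
  \<open>M = UNIV\<close> it only bounds sizes.\<close>

lemma ext_image_support:
  assumes "finite J" "ext_image n g J K \<noteq> 0" "\<And>j k. j \<in> J \<Longrightarrow> k < n \<Longrightarrow> k \<notin> M \<Longrightarrow> g k j = 0"
  shows "finite K \<and> card K = card J \<and> K \<subseteq> M \<and> K \<subseteq> {..<n}"
  using assms
proof (induction J arbitrary: K rule: finite_linorder_min_induct)
  case empty
  then show ?case by (auto simp: ext_image_empty split: if_splits)
next
  case (insert b A)
  have "(\<Sum>k\<in>{..<n} \<inter> K. cst (g k b) * ext_sign k K * ext_image n g A (K - {k})) \<noteq> 0"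
    using insert.prems(1) unfolding ext_image_insert[OF insert(1,2)] ext_mult_def .
  from sum.not_neutral_contains_not_neutral[OF this] obtain k
    where k: "k < n" "k \<in> K" "cst (g k b) * ext_sign k K * ext_image n g A (K - {k}) \<noteq> 0"
    by blast
  then have "ext_image n g A (K - {k}) \<noteq> 0" "g k b \<noteq> 0" by auto
  then have "k \<in> M" using insert.prems(2)[of b k] k by auto
  have IH: "finite (K - {k}) \<and> card (K - {k}) = card A \<and> K - {k} \<subseteq> M \<and> K - {k} \<subseteq> {..<n}"
    using \<open>ext_image n g A (K - {k}) \<noteq> 0\<close> insert.prems(2) by (intro insert.IH) auto
  have "b \<notin> A" using insert(2) by auto
  have "K = insert k (K - {k})" using k by auto
  then show ?case
    using IH \<open>k \<in> M\<close> k \<open>b \<notin> A\<close> insert(1)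
    by (metis Diff_iff card_insert_disjoint finite_insert insert_subset lessThan_iff singletonI)
qed

text \<open>The coefficients are minors of \<open>g\<close>.\<close>

lemma ext_image_const: "finite J \<Longrightarrow> \<exists>c. ext_image n g J K = cst c"
proof (induction J arbitrary: K rule: finite_linorder_min_induct)
  case empty
  have "1 = cst 1" "0 = cst 0" by simp_all
  then show ?case unfolding ext_image_empty by (metis)
next
  case (insert b A)
  have sign: "\<exists>c. ext_sign k K = cst c" for k K
    using ext_sign_cases[of k K] single_uminus[of 0 1] by (metis single_one)
  have mult: "\<exists>c. x * y = cst c" if "\<exists>c. x = cst c" "\<exists>c. y = cst c" for x y :: "'a sym_alg"
    using that by (auto simp: mult_single)
  have sum: "\<exists>c. (\<Sum>i\<in>I. f i) = cst c"
    if "\<And>i. i \<in> I \<Longrightarrow> \<exists>c. f i = cst c" for f :: "nat \<Rightarrow> 'a sym_alg" and I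
    using that
  proof (induction I rule: infinite_finite_induct)
    case (insert i I)
    then obtain c d where "f i = cst c" "sum f I = cst d" by (metis insertCI)
    then show ?case using insert(1,2) by (auto simp: single_add[symmetric])
  qed (metis single_zero sum.empty sum.infinite)+
  show ?case
    unfolding ext_image_insert[OF insert(1,2)] ext_mult_def
    by (intro sum mult insert.IH sign) blast
qed

text \<open>The last assumption says that \<open>u\<close>, as a linear map from \<open>V\<close> to
  polynomials, is equivariant. The least element of \<open>J\<close> is split off as a left factor
  and the antiderivation rule applies.\<close>

lemma contraction_ext_image:
  assumes "finite J" "J \<subseteq> {..<n}" "K \<subseteq> {..<n}"
    "\<And>j. j < n \<Longrightarrow> (\<Sum>k<n. u k * cst (g k j)) = psubst (lin_subst n g) (u j)"
  shows "contraction n u (ext_image n g J) K =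
    (\<Sum>j\<in>J. psubst (lin_subst n g) (u j) * ext_sign j J * ext_image n g (J - {j}) K)"
  using assms(1-3)
proof (induction J arbitrary: K rule: finite_linorder_min_induct)
  case empty
  show ?case by (auto simp: contraction_def ext_image_empty)
next
  case (insert b A)
  let ?v = "\<lambda>k. cst (g k b)" and ?p = "psubst (lin_subst n g)"
  have b: "b \<notin> A" "b < n" using insert by auto
  have "ext_mult n ?v (contraction n u (ext_image n g A)) K =
      ext_mult n ?v (\<lambda>K. \<Sum>j\<in>A. (?p (u j) * ext_sign j A) * ext_image n g (A - {j}) K) K"
    unfolding ext_mult_def
    by (rule sum.cong[OF refl], subst insert.IH) (use insert.prems in auto)
  also have "\<dots> = (\<Sum>j\<in>A. (?p (u j) * ext_sign j A) * ext_mult n ?v (ext_image n g (A - {j})) K)"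
    by (rule ext_mult_sum)
  also have "\<dots> = - (\<Sum>j\<in>A. ?p (u j) * ext_sign j (insert b A) * ext_image n g (insert b A - {j}) K)"
    unfolding sum_negf[symmetric]
  proof (rule sum.cong[OF refl])
    fix j assume j: "j \<in> A"
    then have "b < j" using insert by auto
    then have "insert b A - {j} = insert b (A - {j})" by auto
    moreover have "ext_image n g (insert b (A - {j})) = ext_mult n ?v (ext_image n g (A - {j}))"
      by (rule ext_image_insert) (use insert in auto)
    ultimately show "?p (u j) * ext_sign j A * ext_mult n ?v (ext_image n g (A - {j})) K =
        - (?p (u j) * ext_sign j (insert b A) * ext_image n g (insert b A - {j}) K)"
      using b \<open>b < j\<close> by (simp add: ext_sign_insert)
  qed
  finally have 1: "ext_mult n ?v (contraction n u (ext_image n g A)) K =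
      - (\<Sum>j\<in>A. ?p (u j) * ext_sign j (insert b A) * ext_image n g (insert b A - {j}) K)" .
  have "{k \<in> insert b A. k < b} = {}" using insert(2) by auto
  then have "ext_sign b (insert b A) = (1 :: 'a sym_alg)"
    by (simp only: ext_sign_def card.empty power_0)
  moreover have "insert b A - {b} = A" using b by auto
  ultimately show ?case
    unfolding ext_image_insert[OF insert(1,2)] contraction_ext_mult[OF insert.prems(2)] 1 assms(4)[OF b(2)]
    using b insert(1) by simp
qed

lemma form_act_contraction:
  assumes "K \<subseteq> {..<n}"
    "\<And>j. j < n \<Longrightarrow> (\<Sum>k<n. u k * cst (g k j)) = psubst (lin_subst n g) (u j)"
  shows "contraction n u (form_act n g w) K = form_act n g (contraction n u w) K"
proof -
  let ?p = "psubst (lin_subst n g)" and ?P = "Pow {..<n}"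
  have "contraction n u (form_act n g w) K =
      (\<Sum>J\<in>?P. ?p (w J) * contraction n u (ext_image n g J) K)"
    unfolding contraction_def form_act_def sum_distrib_left by (subst sum.swap) (simp add: mult_ac)
  also have "\<dots> = (\<Sum>J\<in>?P. \<Sum>j\<in>J. ?p (w J) * (?p (u j) * ext_sign j J * ext_image n g (J - {j}) K))"
    unfolding sum_distrib_left[symmetric]
    by (rule sum.cong[OF refl], subst contraction_ext_image[OF _ _ assms]) (auto intro: finite_subset)
  also have "\<dots> = (\<Sum>(J, j)\<in>Sigma ?P (\<lambda>J. J). ?p (w J) * (?p (u j) * ext_sign j J * ext_image n g (J - {j}) K))"
    by (rule sum.Sigma) (auto intro: finite_subset)
  \<comment> \<open>Pairs of a set and one of its elements are traded for pairs of the remaining set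
    and an element outside it.\<close>
  also have "\<dots> = (\<Sum>(J, j)\<in>Sigma ?P (\<lambda>J. {..<n} - J). ?p (u j) * ext_sign j J * ?p (w (insert j J)) * ext_image n g J K)"
    by (rule sum.reindex_bij_witness[of _ "\<lambda>(J, j). (insert j J, j)" "\<lambda>(J, j). (J - {j}, j)"])
      (auto simp: insert_absorb ext_sign_Diff mult_ac)
  also have "\<dots> = (\<Sum>J\<in>?P. \<Sum>j\<in>{..<n} - J. ?p (u j) * ext_sign j J * ?p (w (insert j J)) * ext_image n g J K)"
    by (rule sum.Sigma[symmetric]) auto
  also have "\<dots> = form_act n g (contraction n u w) K"
  proof -
    have "?p (ext_sign j J) = ext_sign j J" for j J using ext_sign_cases[of j J]
      by (metis psubst_1 psubst_uminus)
    then show ?thesis by (simp add: form_act_def contraction_def sum_distrib_right)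
  qed
  finally show ?thesis .
qed

lemma form_act_empty: "form_act n g w {} = psubst (lin_subst n g) (w {})"
proof -
  have "ext_image n g J {} = 0" if "J \<in> Pow {..<n} - {{}}" for J
    using that ext_image_support[of J n g "{}" UNIV]
      by (auto intro: finite_subset[of J "{..<n}"] dest: finite_subset)
  then have "form_act n g w {} = (\<Sum>J\<in>{{}}. psubst (lin_subst n g) (w J) * ext_image n g J {})"
    unfolding form_act_def by (intro sum.mono_neutral_right) auto
  then show ?thesis by (simp add: ext_image_empty)
qed

lemma form_act_singleton:
  assumes "c < n"
  shows "form_act n g w {c} = (\<Sum>j<n. psubst (lin_subst n g) (w {j}) * cst (g c j))"
proof -
  have "ext_image n g J {c} = 0" if "J \<in> Pow {..<n} - (\<lambda>j. {j}) ` {..<n}" for J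
  proof (rule ccontr)
    assume "ext_image n g J {c} \<noteq> 0"
    moreover have "finite J" using that by (auto intro: finite_subset)
    ultimately have "card J = 1" using ext_image_support[of J n g "{c}" UNIV] by auto
    then show False using that by (auto simp: card_1_singleton_iff)
  qed
  then have "form_act n g w {c} =
      (\<Sum>J\<in>(\<lambda>j. {j}) ` {..<n}. psubst (lin_subst n g) (w J) * ext_image n g J {c})"
    unfolding form_act_def by (intro sum.mono_neutral_right) auto
  also have "\<dots> = (\<Sum>j<n. psubst (lin_subst n g) (w {j}) * ext_image n g {j} {c})"
    by (subst sum.reindex) auto
  also have "\<dots> = (\<Sum>j<n. psubst (lin_subst n g) (w {j}) * cst (g c j))"
  proof (rule sum.cong[OF refl])
    fix j
    have "ext_sign c {c} = (1 :: 'a sym_alg)"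
      using ext_sign_insert_self[of c "{}"] by (simp add: ext_sign_def)
    then have "ext_image n g {j} {c} = cst (g c j)"
      using assms ext_image_insert[of "{}" j n g] by (simp add: ext_mult_def ext_image_empty)
    then show "psubst (lin_subst n g) (w {j}) * ext_image n g {j} {c} =
        psubst (lin_subst n g) (w {j}) * cst (g c j)"
      by simp
  qed
  finally show ?thesis .
qed

lemma contraction_cong: "(\<And>J. J \<subseteq> {..<n} \<Longrightarrow> w J = w' J) \<Longrightarrow> K \<subseteq> {..<n} \<Longrightarrow>
    contraction n u w K = contraction n u w' K"
  unfolding contraction_def by (intro sum.cong) auto

definition form_fixed :: "nat \<Rightarrow> (nat \<Rightarrow> nat \<Rightarrow> 'k::field) \<Rightarrow> (nat set \<Rightarrow> 'k sym_alg) \<Rightarrow> bool" where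
  "form_fixed n g w \<longleftrightarrow> (\<forall>K\<subseteq>{..<n}. form_act n g w K = w K)"

lemma form_fixed_contraction:
  assumes "form_fixed n g w" "\<And>j. j < n \<Longrightarrow> (\<Sum>k<n. u k * cst (g k j)) = psubst (lin_subst n g) (u j)"
  shows "form_fixed n g (contraction n u w)"
  unfolding form_fixed_def
proof (intro allI impI)
  fix K assume K: "K \<subseteq> {..<n}"
  have "form_act n g (contraction n u w) K = contraction n u (form_act n g w) K"
    using form_act_contraction[OF K assms(2)] by simp
  also have "\<dots> = contraction n u w K"
    by (rule contraction_cong) (use assms(1) K in \<open>auto simp: form_fixed_def\<close>)
  finally show "form_act n g (contraction n u w) K = contraction n u w K" .
qed

text \<open>
  Contraction with the coordinate functions \<open>A\<close> removes \<open>x\<^sub>A\<close> and commutes with \<open>g\<close> if \<open>g\<close> fixes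
  these functions; so questions about single coefficients reduce to forms of degree at most one.
\<close>

lemma form_fixed_remove:
  assumes "finite A" "A \<subseteq> {..<n}" "form_fixed n g w"
    "\<And>i j. i \<in> A \<Longrightarrow> j < n \<Longrightarrow> g i j = (if i = j then 1 else 0)"
  shows "\<exists>w'. form_fixed n g w' \<and> (\<forall>K. K \<inter> A = {} \<longrightarrow> w' K = w (K \<union> A) \<or> w' K = - w (K \<union> A))"
  using assms
proof (induction A)
  case empty
  then show ?case by (intro exI[of _ w]) auto
next
  case (insert i A)
  then obtain w' where w': "form_fixed n g w'" "\<And>K. K \<inter> A = {} \<Longrightarrow>
      w' K = w (K \<union> A) \<or> w' K = - w (K \<union> A)"
    by auto
  define d :: "nat \<Rightarrow> 'a sym_alg" where "d k = (if k = i then 1 else 0)" for k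
  have i: "i < n" using insert by auto
  have delta: "(\<Sum>k<n. d k * f k) = f i" for f
  proof -
    have "(\<Sum>k<n. d k * f k) = (\<Sum>k<n. if k = i then f k else 0)"
      by (rule sum.cong) (auto simp: d_def)
    then show ?thesis using i by simp
  qed
  have "form_fixed n g (contraction n d w')"
  proof (rule form_fixed_contraction[OF w'(1)])
    fix j assume j: "j < n"
    show "(\<Sum>k<n. d k * cst (g k j)) = psubst (lin_subst n g) (d j)"
      unfolding delta using insert.prems(3)[of i j] j by (auto simp: d_def)
  qed
  moreover have "contraction n d w' K = w (K \<union> insert i A) \<or> contraction n d w' K =
      - w (K \<union> insert i A)"
    if K: "K \<inter> insert i A = {}" for K
  proof -
    have "contraction n d w' K = (\<Sum>k\<in>{i}. d k * ext_sign k K * w' (insert k K))"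
      unfolding contraction_def by (rule sum.mono_neutral_right) (use K i in \<open>auto simp: d_def\<close>)
    then have "contraction n d w' K = ext_sign i K * w' (insert i K)" by (simp add: d_def)
    moreover have "w' (insert i K) = w (insert i K \<union> A) \<or> w' (insert i K) = - w (insert i K \<union> A)"
      by (rule w'(2)) (use K insert(2) in auto)
    moreover have "insert i K \<union> A = K \<union> insert i A" by auto
    moreover have "ext_sign i K = (1 :: 'a sym_alg) \<or> ext_sign i K = (- 1 :: 'a sym_alg)"
      by (rule ext_sign_cases)
    ultimately show ?thesis by (elim disjE) simp_all
  qed
  ultimately show ?case by blast
qed

section \<open>Invariant forms\<close>

context coeff_field
begin

lemmas norm_poly_add = norm_poly_linear_Suc(1)[OF le0]
lemmas norm_poly_scale = norm_poly_linear_Suc(2)[OF le0]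
lemmas norm_poly_Suc = norm_poly_linear_Suc(3)[OF le0]

lemma norm_poly_vanish: "k < m \<Longrightarrow> norm_poly 0 m (var k) = 0"
proof -
  assume "k < m"
  then have "- var k \<in> V 0 m" by (intro V_uminus V_var) auto
  then have "(\<Prod>v\<in>V 0 m. var k + v) = 0"
    using finite_V prod.remove[of "V 0 m" "- var k" "\<lambda>v. var k + v"] by simp
  then show ?thesis by (simp add: norm_poly_def)
qed

lemma norm_poly_dvd: "f dvd norm_poly 0 m f"
  unfolding norm_poly_def using dvd_prodI[OF finite_V V_0, of "\<lambda>v. f + v" 0 m] by simp

lemma norm_poly_homogeneous: "homogeneous (Suc 0) f \<Longrightarrow> homogeneous (q ^ m) (norm_poly 0 m f)"
  unfolding norm_poly_def
  using homogeneous_prod[of "V 0 m" "\<lambda>_. Suc 0" "\<lambda>v. f + v"] homogeneous_add V_homogeneous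
  by (fastforce simp: card_V)

lemma norm_poly_vars_in:
  "vars_in A f \<Longrightarrow> {0..<m} \<subseteq> A \<Longrightarrow> vars_in A (norm_poly 0 m f)"
  unfolding norm_poly_def using vars_in_mono[OF V_vars_in]
    by (intro vars_in_prod vars_in_add) blast+

lemma prod_norm_set: "\<Prod>(norm_set 0 m) = (\<Prod>t<m. norm_poly 0 t (var t))"
proof (induction m)
  case 0
  then show ?case by (simp add: norm_set_empty)
next
  case (Suc m)
  have "\<Prod>(norm_set 0 (Suc m)) = \<Prod>(norm_set 0 m) * norm_poly 0 m (var m)"
    unfolding norm_set_Suc[OF le0] norm_poly_def
    by (subst prod.union_disjoint)
      (use norm_set_disjoint finite_norm_set finite_V in \<open>auto simp: prod.reindex inj_on_def\<close>)
  then show ?case using Suc by (simp add: mult.commute)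
qed

lemma norm_poly_var_nonzero: "norm_poly 0 t (var t) \<noteq> 0"
proof -
  have "prod f A \<noteq> 0" if "finite A" "\<And>x. x \<in> A \<Longrightarrow> f x \<noteq> 0" for A and f :: "'k sym_alg \<Rightarrow> 'k sym_alg"
    using that by (induction A) (auto dest: sym_alg_mult_eq_0)
  moreover have "var t + v \<noteq> 0" if "v \<in> V 0 t" for v
    using normalized_nonzero that unfolding normalized_def by blast
  ultimately show ?thesis unfolding norm_poly_def using finite_V by blast
qed

end

context flag
begin

lemma st_st: "b < n \<Longrightarrow> st (st b) = st b"
  using block[of b "st b"] st_le[of b] e_gt[of b] by auto

text \<open>The space spanned by the variables before a block is itself a member of the flag, hence
  stable.\<close>

lemma e_pred_st: "b < n \<Longrightarrow> 0 < st b \<Longrightarrow> e (st b - 1) = st b"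
proof -
  assume b: "b < n" "0 < st b"
  let ?c = "st b - 1"
  have c: "?c < n" using b st_le[of b] by linarith
  have "st b \<le> e ?c" using e_gt[OF c] b by linarith
  moreover have "\<not> st b < e ?c"
  proof
    assume "st b < e ?c"
    then have "st (st b) = st ?c" using block[OF c, of "st b"] st_le[OF c] b by simp
    then show False using st_st[OF b(1)] st_le[OF c] b by simp
  qed
  ultimately show ?thesis by simp
qed

text \<open>
  The vectors \<open>uvec t\<close> are equivariant and vanish on the subspaces of the flag before the block of \<open>t\<close>.
  The vectors \<open>tvec t\<close> arise from them by a unitriangular change of basis; they are not equivariant, but triangular.
\<close>

definition uvec :: "nat \<Rightarrow> nat \<Rightarrow> 'k sym_alg" where
  "uvec t j = norm_poly 0 (st t) (var j) ^ q ^ (t - st t)"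

definition tvec :: "nat \<Rightarrow> nat \<Rightarrow> 'k sym_alg" where
  "tvec t j = norm_poly 0 t (var j)"

lemma uvec_vanish: "j < st t \<Longrightarrow> uvec t j = 0"
  using q_pos by (simp add: uvec_def norm_poly_vanish zero_power)

lemma tvec_vanish: "j < t \<Longrightarrow> tvec t j = 0"
  by (simp add: tvec_def norm_poly_vanish)

lemma var_dvd_uvec: "var j dvd uvec t j"
proof -
  have "norm_poly 0 (st t) (var j) dvd uvec t j"
    unfolding uvec_def using q_pos by (intro dvd_power) simp
  then show ?thesis using norm_poly_dvd dvd_trans by blast
qed

lemma uvec_homogeneous: "t < n \<Longrightarrow> homogeneous (q ^ t) (uvec t j)"
proof -
  assume t: "t < n"
  have "homogeneous (q ^ st t * q ^ (t - st t)) (uvec t j)"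
    unfolding uvec_def by (intro homogeneous_power norm_poly_homogeneous homogeneous_var)
  also have "q ^ st t * q ^ (t - st t) = q ^ t" using st_le[OF t] by (simp flip: power_add)
  finally show ?thesis .
qed

lemma uvec_vars_in: "t < n \<Longrightarrow> j < n \<Longrightarrow> vars_in {0..<n} (uvec t j)"
  unfolding uvec_def using st_le[of t] by (intro vars_in_power norm_poly_vars_in) auto

text \<open>The polynomial linear combinations of the \<open>uvec i\<close>, made inductive so that
  closure under q-th powers and vanishing of contractions follow by rule induction.\<close>

inductive comb :: "nat set \<Rightarrow> (nat \<Rightarrow> 'k sym_alg) \<Rightarrow> bool" for T where
  zero: "comb T (\<lambda>_. 0)"
| base: "i \<in> T \<Longrightarrow> comb T (uvec i)"
| add: "comb T u \<Longrightarrow> comb T v \<Longrightarrow> comb T (\<lambda>j. u j + v j)"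
| scale: "comb T u \<Longrightarrow> comb T (\<lambda>j. c * u j)"

lemma comb_mono: "comb T u \<Longrightarrow> T \<subseteq> T' \<Longrightarrow> comb T' u"
  by (induction rule: comb.induct) (auto intro: comb.intros)

lemma comb_contraction:
  assumes "comb T u" "\<And>i. i \<in> T \<Longrightarrow> contractions n us (contraction n (uvec i) w) = (\<lambda>_. 0)"
  shows "contractions n us (contraction n u w) = (\<lambda>_. 0)"
  using assms(1)
proof (induction rule: comb.induct)
  case zero
  have "contraction n (\<lambda>_. 0) w = (\<lambda>_. 0)" by (simp add: contraction_def fun_eq_iff)
  then show ?case by simp
next
  case (base i)
  then show ?case using assms(2) by simp
next
  case (add u v)
  then show ?case by (simp add: contraction_vec_add contractions_add fun_eq_iff)
next
  case (scale u c)
  then show ?case by (simp add: contraction_vec_scale contractions_scale fun_eq_iff)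
qed

text \<open>Inside a block the q-th power shifts \<open>uvec i\<close> to
  \<open>uvec (Suc i)\<close>. The recursion for \<open>norm_poly\<close> takes a q-th power and
  subtracts a multiple of the previous vector, so leading coefficient 1 is preserved.\<close>

lemma tvec_comb:
  assumes "t < n"
  shows "\<exists>u. comb {st t..<t} u \<and> tvec t = (\<lambda>j. uvec t j + u j)"
proof -
  have "s < e (st t) \<longrightarrow> (\<exists>u. comb {st t..<s} u \<and> tvec s = (\<lambda>j. uvec s j + u j))" if "st t \<le> s" for s
    using that
  proof (induction rule: dec_induct)
    case base
    have "tvec (st t) = (\<lambda>j. uvec (st t) j + 0)" using st_st[OF assms]
      by (simp add: tvec_def uvec_def fun_eq_iff)
    then show ?case using comb.zero by blast
  next
    case (step s)
    show ?case
    proof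
      assume s: "Suc s < e (st t)"
      have et: "e (st t) = e t" using block[OF assms, of "st t"] e_gt[OF assms] st_le[OF assms]
        by auto
      have st: "st s = st t" "st (Suc s) = st t"
        using block[OF assms, of s] block[OF assms, of "Suc s"] step(1) s et by auto
      obtain u where u: "comb {st t..<s} u" "tvec s = (\<lambda>j. uvec s j + u j)" using step s by auto
      \<comment> \<open>The coefficient in the recursion for \<open>norm_poly\<close>; it is the
        same for all entries \<open>j\<close> of the vector.\<close>
      define c where "c = norm_poly 0 s (var s) ^ (q - 1)"
      have pow: "uvec i j ^ q = uvec (Suc i) j" if "st t \<le> i" "i \<le> s" for i j
      proof -
        have "st i = st t" "st (Suc i) = st t"
          using block[OF assms, of i] block[OF assms, of "Suc i"] that s et by auto
        then show ?thesis using that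
          by (simp add: uvec_def Suc_diff_le mult.commute flip: power_mult)
      qed
      have comb_pow: "comb {st t..<Suc s} (\<lambda>j. v j ^ q)" if "comb {st t..<s} v" for v
        using that
      proof (induction rule: comb.induct)
        case zero
        then show ?case using q_pos by (simp add: zero_power comb.zero)
      next
        case (base i)
        then have "(\<lambda>j. uvec i j ^ q) = uvec (Suc i)" using pow by (auto simp: fun_eq_iff)
        then show ?case using base by (auto intro: comb.base)
      next
        case (add u v)
        then show ?case using frob_add[of _ _ 1] by (auto intro: comb.add)
      next
        case (scale u c)
        then show ?case by (auto simp: power_mult_distrib intro: comb.scale)
      qed
      have "comb {st t..<Suc s} (\<lambda>j. u j ^ q + (- c) * (uvec s j + u j))"
        using comb_pow[OF u(1)] comb_mono[OF u(1), of "{st t..<Suc s}"] step(1)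
        by (intro comb.add comb.scale comb.base) auto
      moreover have "tvec (Suc s) j = uvec (Suc s) j + (u j ^ q + (- c) * (uvec s j + u j))" for j
      proof -
        have "tvec (Suc s) j = tvec s j ^ q - c * tvec s j"
          by (simp only: tvec_def norm_poly_Suc c_def)
        also have "tvec s j ^ q = uvec (Suc s) j + u j ^ q"
          using frob_add[of "uvec s j" "u j" 1] pow[of s j] step(1) by (simp add: u(2))
        also have "c * tvec s j = c * (uvec s j + u j)" by (simp add: u(2))
        finally show ?thesis by simp
      qed
      ultimately show "\<exists>u. comb {st t..<Suc s} u \<and> tvec (Suc s) = (\<lambda>j. uvec (Suc s) j + u j)"
        by (intro exI[of _ "\<lambda>j. u j ^ q + (- c) * (uvec s j + u j)"]) auto
    qed
  qed
  moreover have "t < e (st t)"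
    using block[OF assms, of "st t"] e_gt[OF assms] st_le[OF assms] by auto
  ultimately show ?thesis using st_le[OF assms] by auto
qed

lemma tvec_comb': "t < n \<Longrightarrow> comb {..<n} (tvec t)"
proof -
  assume t: "t < n"
  obtain u where "comb {st t..<t} u" "tvec t = (\<lambda>j. uvec t j + u j)" using tvec_comb[OF t] by blast
  moreover have "{st t..<t} \<subseteq> {..<n}" using t by auto
  ultimately show ?thesis using comb.add[OF comb.base comb_mono] t by auto
qed

section \<open>The volume form and its full contraction\<close>

definition vol :: "nat \<Rightarrow> nat set \<Rightarrow> 'k sym_alg" where
  "vol m K = (if K = {..<m} then 1 else 0)"

text \<open>The correction terms in \<open>tvec m\<close> are combinations of vectors that are
  contracted again later, and repeated contractions vanish.\<close>

lemma contractions_uvec_tvec: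
  assumes "m \<le> n"
  shows "contractions n (map uvec [0..<m]) w = contractions n (map tvec [0..<m]) w"
  using assms
proof (induction m arbitrary: w)
  case (Suc m)
  obtain u where u: "comb {st m..<m} u" "tvec m = (\<lambda>j. uvec m j + u j)"
    using tvec_comb[of m] Suc by auto
  have "contractions n (map uvec [0..<m]) (contraction n u w) = (\<lambda>_. 0)"
  proof (rule comb_contraction[OF u(1)])
    fix i assume i: "i \<in> {st m..<m}"
    have "\<not> distinct (map uvec [0..<m] @ [uvec i])" using i by auto
    from contractions_not_distinct[OF this, of n w]
    show "contractions n (map uvec [0..<m]) (contraction n (uvec i) w) = (\<lambda>_. 0)" by simp
  qed
  then have "contractions n (map uvec [0..<m]) (contraction n (tvec m) w) =
      contractions n (map uvec [0..<m]) (contraction n (uvec m) w)"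
    unfolding u(2) contraction_vec_add contractions_add by simp
  then show ?case using Suc by simp
qed simp

lemma contraction_tvec_vol:
  assumes "m < n"
  shows "same_up_to_sign (contraction n (tvec m) (vol (Suc m))) (\<lambda>K. tvec m m * vol m K)"
proof -
  have "contraction n (tvec m) (vol (Suc m)) K = ext_sign m {..<m} * (tvec m m * vol m K)" for K
  proof (cases "K = {..<m}")
    case True
    have "{..<Suc m} = insert m {..<m}" by auto
    have "contraction n (tvec m) (vol (Suc m)) K =
        (\<Sum>j\<in>{m}. tvec m j * ext_sign j K * vol (Suc m) (insert j K))"
      unfolding contraction_def
    proof (rule sum.mono_neutral_right)
      show "\<forall>i\<in>{..<n} - K - {m}. tvec m i * ext_sign i K * vol (Suc m) (insert i K) = 0"
        using True \<open>{..<Suc m} = insert m {..<m}\<close> by (auto simp: vol_def insert_eq_iff)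
    qed (use True assms in auto)
    then show ?thesis using True \<open>{..<Suc m} = insert m {..<m}\<close> by (simp add: vol_def mult_ac)
  next
    case False
    have "tvec m j * ext_sign j K * vol (Suc m) (insert j K) = 0" if j: "j \<in> {..<n} - K" for j
    proof (cases "insert j K = {..<Suc m}")
      case True
      then have "j \<noteq> m" using False j by (auto simp: set_eq_iff less_Suc_eq) 
      moreover have "j < Suc m" using True by auto
      ultimately show ?thesis by (simp add: tvec_vanish)
    qed (simp add: vol_def)
    then have "contraction n (tvec m) (vol (Suc m)) K = 0"
      unfolding contraction_def by (intro sum.neutral) blast
    then show ?thesis using False by (simp add: vol_def)
  qed
  moreover have "ext_sign m {..<m} = (1 :: 'k sym_alg) \<or> ext_sign m {..<m} = (- 1 :: 'k sym_alg)"
    by (rule ext_sign_cases)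
  ultimately show ?thesis by (auto simp: same_up_to_sign_def fun_eq_iff)
qed

text \<open>Up to sign the determinant of the entries \<open>uvec t j\<close> with
  \<open>t, j < m\<close>, a variant of the Moore determinant.\<close>

definition Lpoly :: "nat \<Rightarrow> 'k sym_alg" where
  "Lpoly m = contractions n (map uvec [0..<m]) (vol m) {}"

text \<open>For the vectors \<open>tvec\<close> the determinant is triangular. Its diagonal entries
  are the products of the normalized vectors with a fixed highest variable.\<close>

lemma Lpoly_conv:
  assumes "m \<le> n"
  shows "Lpoly m = \<Prod>(norm_set 0 m) \<or> Lpoly m = - \<Prod>(norm_set 0 m)"
proof -
  have "same_up_to_sign (contractions n (map tvec [0..<m]) (vol m)) (\<lambda>K. (\<Prod>t<m. tvec t t) * vol 0 K)"
    using assms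
  proof (induction m)
    case 0
    then show ?case by (simp add: same_up_to_sign_def)
  next
    case (Suc m)
    have "same_up_to_sign (contractions n (map tvec [0..<m]) (contraction n (tvec m) (vol (Suc m))))
        (\<lambda>K. tvec m m * contractions n (map tvec [0..<m]) (vol m) K)"
    proof -
      have "same_up_to_sign (contraction n (tvec m) (vol (Suc m))) (\<lambda>K. tvec m m * vol m K)"
        by (rule contraction_tvec_vol) (use Suc in simp)
      then show ?thesis
        using contractions_uminus[of n "map tvec [0..<m]" "\<lambda>K. tvec m m * vol m K"]
        by (auto simp: same_up_to_sign_def contractions_scale)
    qed
    then show ?case using Suc by (auto simp: same_up_to_sign_def fun_eq_iff mult_ac)
  qed
  then show ?thesis
    unfolding Lpoly_def contractions_uvec_tvec[OF assms] prod_norm_set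
    by (auto simp: same_up_to_sign_def tvec_def vol_def)
qed

lemma Lpoly_power:
  assumes "m \<le> n" shows "\<exists>k. k \<noteq> 0 \<and> Lpoly m ^ (q - 1) = cst k * nz_prod 0 m"
proof -
  obtain k where k: "k \<noteq> 0" "nz_prod 0 m = cst k * (\<Prod>(norm_set 0 m)) ^ (q - 1)"
    using nz_prod_conv[of 0 m] by blast
  have "cst (1 / k) * nz_prod 0 m = (\<Prod>(norm_set 0 m)) ^ (q - 1)"
    using k(1) by (simp add: k(2) mult_single flip: mult.assoc)
  moreover have "Lpoly m ^ (q - 1) = (\<Prod>(norm_set 0 m)) ^ (q - 1) \<or>
      Lpoly m ^ (q - 1) = - ((\<Prod>(norm_set 0 m)) ^ (q - 1))"
    using Lpoly_conv[OF assms]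
      by (auto simp: power_minus_even power_minus_odd) (metis power_minus_even power_minus_odd)
  ultimately have "Lpoly m ^ (q - 1) = cst (1 / k) * nz_prod 0 m \<or> Lpoly m ^ (q - 1) =
      cst (- 1 / k) * nz_prod 0 m"
    by (auto simp: single_uminus)
  then show ?thesis using k(1) by (metis divide_eq_0_iff neg_equal_0_iff_equal one_neq_zero)
qed

text \<open>Choose \<open>t\<close> as the largest index occurring in \<open>w\<close>. Then
  \<open>tvec t\<close> vanishes below \<open>t\<close>, nothing occurs above \<open>t\<close>, and
  the contraction just strips off \<open>x_t\<close> and multiplies by the nonzero
  \<open>tvec t t\<close>.\<close>

lemma contractions_tvec_inject:
  assumes "\<And>K. w K \<noteq> 0 \<Longrightarrow> K \<subseteq> {..<n} \<and> card K = k" "w \<noteq> (\<lambda>_. 0)"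
  shows "\<exists>ts. length ts = k \<and> set ts \<subseteq> {..<n} \<and> contractions n (map tvec ts) w \<noteq> (\<lambda>_. 0)"
  using assms
proof (induction k arbitrary: w)
  case 0
  then show ?case by (intro exI[of _ "[]"]) simp
next
  case (Suc k)
  define M where "M = (\<Union>K\<in>{K. w K \<noteq> 0}. K)"
  have sub: "M \<subseteq> {..<n}" using Suc.prems(1) by (auto simp: M_def)
  then have fin: "finite M" using finite_subset by blast
  obtain K0 where K0: "w K0 \<noteq> 0" using Suc.prems(2) by (auto simp: fun_eq_iff)
  have "K0 \<noteq> {}" using Suc.prems(1)[OF K0] by auto
  then have "M \<noteq> {}" using K0 by (auto simp: M_def)
  define t where "t = Max M"
  have "t \<in> M" using fin \<open>M \<noteq> {}\<close> by (simp add: t_def)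
  then obtain J where J: "w J \<noteq> 0" "t \<in> J" by (auto simp: M_def)
  have t: "t < n" using sub \<open>t \<in> M\<close> by auto
  have max: "w K = 0" if "j \<in> K" "t < j" for j K
  proof (rule ccontr)
    assume "w K \<noteq> 0"
    then have "j \<in> M" using that by (auto simp: M_def)
    then show False using Max_ge[OF fin, of j] that by (simp add: t_def)
  qed
  have val: "contraction n (tvec t) w K =
      (if t \<in> K then 0 else tvec t t * ext_sign t K * w (insert t K))" for K
  proof -
    have zero: "tvec t j * ext_sign j K * w (insert j K) = 0" if "j \<noteq> t" for j
      using that max[of j "insert j K"] tvec_vanish[of j t] by (cases j t rule: linorder_cases) auto
    show ?thesis
    proof (cases "t \<in> K")
      case True
      then have "tvec t j * ext_sign j K * w (insert j K) = 0" if "j \<in> {..<n} - K" for j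
        using that by (intro zero) auto
      then have "contraction n (tvec t) w K = 0"
        unfolding contraction_def by (intro sum.neutral) blast
      then show ?thesis using True by simp
    next
      case False
      have "contraction n (tvec t) w K = (\<Sum>j\<in>{t}. tvec t j * ext_sign j K * w (insert j K))"
        unfolding contraction_def using zero t False by (intro sum.mono_neutral_right) auto
      then show ?thesis using False by simp
    qed
  qed
  have "contraction n (tvec t) w (J - {t}) \<noteq> 0"
  proof -
    have "tvec t t * w J \<noteq> 0"
      using norm_poly_var_nonzero[of t] J(1) sym_alg_mult_eq_0 unfolding tvec_def by blast
    moreover have "ext_sign t (J - {t}) = (1 :: 'k sym_alg) \<or> ext_sign t (J - {t}) =
        (- 1 :: 'k sym_alg)"
      by (rule ext_sign_cases)
    ultimately show ?thesis using J(2) by (auto simp: val insert_absorb)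
  qed
  then have nz: "contraction n (tvec t) w \<noteq> (\<lambda>_. 0)" by (auto simp: fun_eq_iff)
  have "\<exists>ts. length ts = k \<and> set ts \<subseteq> {..<n} \<and>
      contractions n (map tvec ts) (contraction n (tvec t) w) \<noteq> (\<lambda>_. 0)"
  proof (rule Suc.IH[OF _ nz])
    fix K assume "contraction n (tvec t) w K \<noteq> 0"
    then have "t \<notin> K" "w (insert t K) \<noteq> 0" by (auto simp: val split: if_splits)
    from Suc.prems(1)[OF this(2)] this(1) show "K \<subseteq> {..<n} \<and> card K = k"
      using finite_subset[of K "{..<n}"] by auto
  qed
  then obtain ts where "length ts = k" "set ts \<subseteq> {..<n}"
    "contractions n (map tvec ts) (contraction n (tvec t) w) \<noteq> (\<lambda>_. 0)" by blast
  then show ?case using t by (intro exI[of _ "ts @ [t]"]) (auto simp: foldr_append)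
qed

text \<open>Each \<open>tvec t\<close> is expanded into the \<open>uvec i\<close>, one contraction
  at a time; the hypothesis is about arbitrary lists because the expansion may repeat and disorder
  indices.\<close>

lemma contractions_uvec_imp_tvec:
  assumes "\<And>ts. length ts = k \<Longrightarrow> set ts \<subseteq> {..<n} \<Longrightarrow> contractions n (map uvec ts) w = (\<lambda>_. 0)"
    "length ts = k" "set ts \<subseteq> {..<n}"
  shows "contractions n (map tvec ts) w = (\<lambda>_. 0)"
  using assms
proof (induction k arbitrary: w ts)
  case (Suc k)
  obtain ts' t where ts: "ts = ts' @ [t]" using Suc.prems(2)
    by (metis Zero_not_Suc length_0_conv rev_exhaust)
  have "contractions n (map tvec ts') (contraction n (tvec t) w) = (\<lambda>_. 0)"
  proof (rule Suc.IH)
    fix us :: "nat list" assume us: "length us = k" "set us \<subseteq> {..<n}"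
    show "contractions n (map uvec us) (contraction n (tvec t) w) = (\<lambda>_. 0)"
    proof (rule comb_contraction[OF tvec_comb'])
      show "t < n" using Suc.prems ts by auto
      fix i assume "i \<in> {..<n}"
      then have "contractions n (map uvec (us @ [i])) w = (\<lambda>_. 0)" using us
        by (intro Suc.prems(1)) auto
      then show "contractions n (map uvec us) (contraction n (uvec i) w) = (\<lambda>_. 0)" by simp
    qed
  qed (use Suc.prems ts in auto)
  then show ?case by (simp add: ts)
qed auto

text \<open>The contraction with the largest index is applied first.\<close>

definition iota_set :: "nat set \<Rightarrow> (nat set \<Rightarrow> 'k sym_alg) \<Rightarrow> nat set \<Rightarrow> 'k sym_alg" where
  "iota_set S w = contractions n (map uvec (sorted_list_of_set S)) w"

definition is_form :: "nat \<Rightarrow> (nat set \<Rightarrow> 'k sym_alg) \<Rightarrow> bool" where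
  "is_form k w \<longleftrightarrow> (\<forall>K. w K \<noteq> 0 \<longrightarrow> K \<subseteq> {..<n} \<and> card K = k)"

section \<open>Injectivity and degrees of iterated contractions\<close>

lemma is_form_contraction: "is_form (Suc k) w \<Longrightarrow> is_form k (contraction n u w)"
  unfolding is_form_def
proof (intro allI impI)
  fix K assume w: "\<forall>K. w K \<noteq> 0 \<longrightarrow> K \<subseteq> {..<n} \<and> card K = Suc k" and "contraction n u w K \<noteq> 0"
  from sum.not_neutral_contains_not_neutral[OF this(2)[unfolded contraction_def]]
  obtain j where j: "j \<notin> K" "u j * ext_sign j K * w (insert j K) \<noteq> 0" by blast
  then have "w (insert j K) \<noteq> 0" by auto
  then have "insert j K \<subseteq> {..<n}" "card (insert j K) = Suc k" using w by auto
  then show "K \<subseteq> {..<n} \<and> card K = k" using j(1) finite_subset[of K "{..<n}"] by auto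
qed

lemma is_form_contractions: "is_form (length us + k) w \<Longrightarrow> is_form k (contractions n us w)"
proof (induction us arbitrary: k)
  case (Cons u us)
  then have "is_form (Suc k) (contractions n us w)" by simp
  then show ?case by (simp add: is_form_contraction)
qed simp

lemma is_form_0_eq: "is_form 0 w \<Longrightarrow> w {} = 0 \<Longrightarrow> w = (\<lambda>_. 0)"
  unfolding is_form_def fun_eq_iff
  by (metis card_eq_0_iff finite_lessThan finite_subset)

lemma iota_inject:
  assumes "is_form k w" "\<And>S. S \<subseteq> {..<n} \<Longrightarrow> card S = k \<Longrightarrow> iota_set S w {} = 0"
  shows "w = (\<lambda>_. 0)"
proof (rule ccontr)
  assume "w \<noteq> (\<lambda>_. 0)"
  then obtain ts where ts: "length ts =
      k" "set ts \<subseteq> {..<n}" "contractions n (map tvec ts) w \<noteq> (\<lambda>_. 0)"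
    using contractions_tvec_inject assms(1) unfolding is_form_def by blast
  have "contractions n (map uvec us) w = (\<lambda>_. 0)" if us: "length us = k" "set us \<subseteq> {..<n}" for us
  proof (cases "distinct us")
    case False
    then have "\<not> distinct (map uvec us)" by (simp add: distinct_map)
    then show ?thesis by (rule contractions_not_distinct)
  next
    case True
    have "mset (map uvec us) = mset (map uvec (sorted_list_of_set (set us)))"
    proof -
      have "mset us = mset (sorted_list_of_set (set us))"
        using True by (metis distinct_sorted_list_of_set finite_set mset_set_set set_sorted_list_of_set)
      then show ?thesis by simp
    qed
    then have *: "same_up_to_sign (contractions n (map uvec us) w) (iota_set (set us) w)"
      unfolding iota_set_def by (rule contractions_perm)
    have "iota_set (set us) w {} = 0" using assms(2) us True distinct_card[of us] by auto
    moreover have "is_form 0 (iota_set (set us) w)"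
      unfolding iota_set_def using assms(1) us True distinct_card[of us]
        by (intro is_form_contractions) simp
    ultimately have "iota_set (set us) w = (\<lambda>_. 0)" using is_form_0_eq by blast
    then show ?thesis using * by (auto simp: same_up_to_sign_def)
  qed
  then show False using contractions_uvec_imp_tvec ts by blast
qed

definition homog_form :: "nat \<Rightarrow> (nat set \<Rightarrow> 'k sym_alg) \<Rightarrow> bool" where
  "homog_form d w \<longleftrightarrow> (\<forall>K. homogeneous d (w K) \<and> vars_in {0..<n} (w K))"

lemma homog_form_contraction:
  assumes "homog_form d w" "t < n"
  shows "homog_form (d + q ^ t) (contraction n (uvec t) w)"
  unfolding homog_form_def contraction_def
proof (intro allI conjI)
  fix K
  have sign: "homogeneous 0 (ext_sign j K :: 'k sym_alg)"
    "vars_in {0..<n} (ext_sign j K :: 'k sym_alg)" for j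
    using ext_sign_cases[of j K, where 'a = "'k sym_alg"]
    by (metis homogeneous_1 homogeneous_uminus, metis vars_in_1 vars_in_uminus)
  show "homogeneous (d + q ^ t) (\<Sum>j\<in>{..<n} - K. uvec t j * ext_sign j K * w (insert j K))"
  proof (rule homogeneous_sum)
    fix j
    have "homogeneous (q ^ t + 0 + d) (uvec t j * ext_sign j K * w (insert j K))"
      using assms by (intro homogeneous_mult uvec_homogeneous sign) (auto simp: homog_form_def)
    then show "homogeneous (d + q ^ t) (uvec t j * ext_sign j K * w (insert j K))"
      by (simp add: add.commute)
  qed
  show "vars_in {0..<n} (\<Sum>j\<in>{..<n} - K. uvec t j * ext_sign j K * w (insert j K))"
    using assms by (intro vars_in_sum vars_in_mult uvec_vars_in sign) (auto simp: homog_form_def)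
qed

lemma homog_form_contractions:
  "homog_form d w \<Longrightarrow> set ts \<subseteq> {..<n} \<Longrightarrow>
      homog_form (d + (\<Sum>t\<leftarrow>ts. q ^ t)) (contractions n (map uvec ts) w)"
proof (induction ts)
  case (Cons t ts)
  then have "homog_form (d + (\<Sum>t\<leftarrow>ts. q ^ t) + q ^ t) (contraction n (uvec t) (contractions n (map uvec ts) w))"
    by (intro homog_form_contraction) auto
  then show ?case by (simp add: add_ac)
qed simp

lemma sum_sorted_list: "finite S \<Longrightarrow> (\<Sum>t\<leftarrow>sorted_list_of_set S. f t) = (\<Sum>t\<in>S. f t :: nat)"
  by (simp add: sum_list_distinct_conv_sum_set)

lemma homog_form_iota_set:
  "homog_form d w \<Longrightarrow> S \<subseteq> {..<n} \<Longrightarrow> homog_form (d + (\<Sum>t\<in>S. q ^ t)) (iota_set S w)"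
  unfolding iota_set_def
  using homog_form_contractions[of d w "sorted_list_of_set S"] finite_subset[of S "{..<n}"]
  by (simp add: sum_sorted_list)

text \<open>The value 0 for the empty set makes \<open>q ^ end_of S - 1\<close> vanish, so that the
  generator 1 has degree 0.\<close>

definition end_of :: "nat set \<Rightarrow> nat" where
  "end_of S = (if S = {} then 0 else e (Max S))"

text \<open>
  Contracting the volume form of \<open>V\<^sub>m\<close> with the complement of \<open>S\<close> gives the form dual to \<open>iota_set S\<close> up to
  the factor \<open>Lpoly m\<close>; it is invariant up to the determinant on \<open>V\<^sub>m\<close>, which \<open>Lpoly m ^ (q - 2)\<close> compensates.
\<close>

definition omega :: "nat set \<Rightarrow> nat set \<Rightarrow> 'k sym_alg" where
  "omega S K = (if S = {} then vol 0 K
     else Lpoly (end_of S) ^ (q - 2) * iota_set ({..<end_of S} - S) (vol (end_of S)) K)"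

text \<open>Up to a nonzero scalar this is \<open>nz_prod 0 (end_of S)\<close>. It divides
  \<open>iota_set S w {}\<close> for every invariant form \<open>w\<close>, and
  \<open>omega S\<close> attains it up to sign.\<close>

definition denom :: "nat set \<Rightarrow> 'k sym_alg" where
  "denom S = (if S = {} then 1 else Lpoly (end_of S) ^ (q - 1))"

end

section \<open>Matrix sets stabilising the flag\<close>

lemma form_act_scale: "form_act n g (\<lambda>K. c * w K) K = psubst (lin_subst n g) c * form_act n g w K"
  by (simp add: form_act_def sum_distrib_left mult_ac)

lemma form_act_sum: "form_act n g (\<lambda>K. \<Sum>i\<in>I. w i K) K = (\<Sum>i\<in>I. form_act n g (w i) K)"
  unfolding form_act_def by (subst sum.swap) (simp add: sum_distrib_right)

definition elem_mat :: "nat \<Rightarrow> (nat \<Rightarrow> 'k::field) \<Rightarrow> nat \<Rightarrow> nat \<Rightarrow> 'k" where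
  "elem_mat b d k j = (if j = b then d k else if k = j then 1 else 0)"

lemma lin_subst_elem_mat:
  assumes "b < n" shows "lin_subst n (elem_mat b d) = var_subst b (\<Sum>k<n. cst (d k) * var k)"
proof
  fix j
  have "(\<Sum>k<n. cst (if k = j then 1 else 0) * var k) = var j" if "j < n"
  proof -
    have "(\<Sum>k<n. cst (if k = j then 1 else 0) * var k) = (\<Sum>k<n. if k = j then var k else 0)"
      by (rule sum.cong) auto
    then show ?thesis using that by simp
  qed
  then show "lin_subst n (elem_mat b d) j = var_subst b (\<Sum>k<n. cst (d k) * var k) j"
    using assms by (auto simp: lin_subst_def elem_mat_def var_subst_def)
qed

text \<open>The first assumption provides the elementary matrices for the upper bounds; the other
  two make every element of \<open>G\<close> permute each flag subspace.\<close>

locale flag_group = flag q ground n st e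
  for q and ground :: "'k::{field, finite} itself" and n st e +
  fixes G :: "(nat \<Rightarrow> nat \<Rightarrow> 'k) set"
  assumes elem_mat_in: "b < n \<Longrightarrow> d b \<noteq> 0 \<Longrightarrow> (\<And>k. e b \<le> k \<Longrightarrow> d k = 0) \<Longrightarrow> elem_mat b d \<in> G"
    and below_blocks: "g \<in> G \<Longrightarrow> j < n \<Longrightarrow> e j \<le> k \<Longrightarrow> k < n \<Longrightarrow> g k j = 0"
    and inj_mat: "g \<in> G \<Longrightarrow> inj_on (psubst (lin_subst n g)) (V 0 n)"
begin

lemma elementary_in_G:
  assumes "\<sigma> \<in> elementary 0" shows "\<exists>g\<in>G. lin_subst n g = \<sigma>"
proof -
  obtain b c v where \<sigma>: "\<sigma> = var_subst b (cst c * var b + v)" "b < n" "c \<noteq> 0"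
    "v \<in> V 0 (e b)" "vars_in (- {b}) v"
    using assms unfolding elementary_def by blast
  obtain c' where v: "v = (\<Sum>k = 0..<e b. cst (c' k) * var k)" using \<sigma>(4) by (auto simp: V_def)
  have "psubst (var_subst b 0) v = v"
    using psubst_vars_in_cong[OF \<sigma>(5), of "var_subst b 0" var] by simp
  \<comment> \<open>The chosen representation of \<open>v\<close> has a term at
    \<open>k = b\<close>; setting \<open>x_b = 0\<close> removes it, so that the entry
    \<open>d b\<close> can be \<open>c\<close> alone.\<close>
  then have v': "v = (\<Sum>k = 0..<e b. cst (c' k) * var_subst b 0 k)" unfolding v by simp
  define d where "d k = (if k = b then c else if k < e b then c' k else 0)" for k
  have eb: "b < e b" "e b \<le> n" using e_gt e_le \<sigma> by auto
  have "(\<Sum>k<n. cst (d k) * var k) = (\<Sum>k\<in>{0..<e b}. cst (d k) * var k)"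
    using eb by (intro sum.mono_neutral_right) (auto simp: d_def)
  also have "\<dots> = (\<Sum>k\<in>{0..<e b}. cst (c' k) * var_subst b 0 k + (if k = b then cst c * var b else 0))"
    by (rule sum.cong) (auto simp: d_def var_subst_def)
  also have "\<dots> = cst c * var b + v" unfolding sum.distrib v'[symmetric] using eb by simp
  finally have "lin_subst n (elem_mat b d) = \<sigma>" unfolding lin_subst_elem_mat[OF \<sigma>(2)] \<sigma>(1) by simp
  moreover have "elem_mat b d \<in> G" by (rule elem_mat_in) (use \<sigma> eb in \<open>auto simp: d_def\<close>)
  ultimately show ?thesis by blast
qed

lemma G_stabilizes: "g \<in> G \<Longrightarrow> stabilizes 0 (lin_subst n g)"
proof (rule stabilizesI)
  fix b assume g: "g \<in> G" and b: "b < n"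
  show "lin_subst n g b \<in> V 0 (e b)"
    unfolding lin_subst_def using b
  proof (simp, intro V_sum)
    fix k assume "k \<in> {..<n}"
    then show "cst (g k b) * var k \<in> V 0 (e b)"
      using below_blocks[OF g b, of k] by (cases "k < e b") (auto intro: V_scale V_var)
  qed
qed (rule inj_mat)

text \<open>Invariance under elementary substitutions puts \<open>f\<close> into the Dickson
  algebra, and this is fixed by every substitution that stabilises the flag.\<close>

lemma inv_space_fixed: "f \<in> inv_space 0 d \<Longrightarrow> g \<in> G \<Longrightarrow> psubst (lin_subst n g) f = f"
  using dickson_alg_stable[OF inv_space_dickson_alg G_stabilizes] by blast

lemma invariant_if_fixed: "(\<And>g. g \<in> G \<Longrightarrow> psubst (lin_subst n g) f = f) \<Longrightarrow> invariant 0 f"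
  unfolding invariant_def using elementary_in_G by metis

lemma norm_poly_sum: "norm_poly 0 m (\<Sum>k\<in>I. cst (c k) * f k) =
    (\<Sum>k\<in>I. cst (c k) * norm_poly 0 m (f k))"
proof (induction I rule: infinite_finite_induct)
  case (insert x I)
  then show ?case by (simp add: norm_poly_add norm_poly_scale)
qed (use norm_poly_scale[of m 0] in simp_all)

text \<open>\<open>V 0 (st t)\<close> is zero or the flag member ending with the previous block, so
  \<open>g\<close> permutes the factors.\<close>

lemma psubst_norm_poly:
  assumes "g \<in> G" "t < n"
  shows "psubst (lin_subst n g) (norm_poly 0 (st t) f) =
      norm_poly 0 (st t) (psubst (lin_subst n g) f)"
proof (cases "st t = 0")
  case True
  then show ?thesis by (simp add: norm_poly_trivial)
next
  case False
  let ?p = "psubst (lin_subst n g)"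
  have "st t - 1 < n" using st_le[OF assms(2)] assms(2) by linarith
  then have "inj_on ?p (V 0 (e (st t - 1))) \<and> ?p ` V 0 (e (st t - 1)) = V 0 (e (st t - 1))"
    using G_stabilizes[OF assms(1)] unfolding stabilizes_def by blast
  moreover have "e (st t - 1) = st t" using e_pred_st[OF assms(2)] False by simp
  ultimately have *: "inj_on ?p (V 0 (st t))" "?p ` V 0 (st t) = V 0 (st t)" by simp_all
  have "norm_poly 0 (st t) (?p f) = (\<Prod>v\<in>?p ` V 0 (st t). ?p f + v)"
    by (simp add: norm_poly_def *(2))
  then show ?thesis unfolding prod.reindex[OF *(1)] by (simp add: norm_poly_def)
qed

text \<open>\<open>norm_poly\<close> and the Frobenius map are both additive and commute with
  scalars, so applying \<open>uvec t\<close> commutes with expanding the image of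
  \<open>x_j\<close>.\<close>

lemma uvec_equivariant:
  assumes "g \<in> G" "t < n" "j < n"
  shows "(\<Sum>k<n. uvec t k * cst (g k j)) = psubst (lin_subst n g) (uvec t j)"
proof -
  let ?N = "norm_poly 0 (st t)" and ?Q = "q ^ (t - st t)"
  have pow_sum: "(\<Sum>k\<in>I. f k) ^ ?Q = (\<Sum>k\<in>I. f k ^ ?Q)" for f :: "nat \<Rightarrow> 'k sym_alg" and I
    by (induction I rule: infinite_finite_induct) (use q_pos in \<open>auto simp: frob_add zero_power\<close>)
  have "psubst (lin_subst n g) (uvec t j) = ?N (\<Sum>k<n. cst (g k j) * var k) ^ ?Q"
    using assms(3) by (simp add: uvec_def psubst_norm_poly[OF assms(1,2)] lin_subst_def)
  also have "\<dots> = (\<Sum>k<n. cst (g k j) * ?N (var k) ^ ?Q)"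
    unfolding norm_poly_sum pow_sum frob_scale ..
  finally show ?thesis by (simp add: uvec_def mult.commute)
qed

lemma form_fixed_contractions:
  assumes "g \<in> G" "form_fixed n g w" "set ts \<subseteq> {..<n}"
  shows "form_fixed n g (contractions n (map uvec ts) w)"
  using assms(3)
proof (induction ts)
  case (Cons t ts)
  then show ?case using uvec_equivariant[OF assms(1), of t] by (auto intro!: form_fixed_contraction)
qed (simp add: assms)

lemma form_act_contractions:
  assumes "g \<in> G" "set ts \<subseteq> {..<n}" "K \<subseteq> {..<n}"
  shows "form_act n g (contractions n (map uvec ts) w) K =
      contractions n (map uvec ts) (form_act n g w) K"
  using assms(2,3)
proof (induction ts arbitrary: K)
  case (Cons t ts)
  let ?W = "contractions n (map uvec ts) w"
  have "form_act n g (contraction n (uvec t) ?W) K = contraction n (uvec t) (form_act n g ?W) K"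
    by (rule form_act_contraction[symmetric]) (use Cons.prems uvec_equivariant[OF assms(1), of t] in auto)
  also have "\<dots> = contraction n (uvec t) (contractions n (map uvec ts) (form_act n g w)) K"
    by (rule contraction_cong) (use Cons in auto)
  finally show ?case by simp
qed simp

definition forms :: "nat \<Rightarrow> nat \<Rightarrow> (nat set \<Rightarrow> 'k sym_alg) set" where
  "forms k d = {w. is_form k w \<and> homog_form d w \<and> (\<forall>g\<in>G. form_fixed n g w)}"

section \<open>Divisibility of the coefficients of invariant forms\<close>

lemma reduce_coefficient:
  assumes "form_fixed n (elem_mat b d) w" "b < n" "J \<subseteq> {..<n}" "c < n" "K \<subseteq> J"
    "\<And>i. i \<in> J - K \<Longrightarrow> d i = (if i = b then 1 else 0)"
  shows "\<exists>w'. form_fixed n (elem_mat b d) w' \<and>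
      (\<forall>L. L \<inter> (J - K) = {} \<longrightarrow> w' L = w (L \<union> (J - K)) \<or> w' L = - w (L \<union> (J - K)))"
proof (rule form_fixed_remove)
  show "elem_mat b d i j = (if i = j then 1 else 0)" if "i \<in> J - K" for i j
    using assms(6)[OF that] by (auto simp: elem_mat_def)
qed (use assms finite_subset[of J "{..<n}"] in auto)

text \<open>Scaling \<open>x_c\<close> acts on a term through its exponent of \<open>x_c\<close>
  plus one more if \<open>x_c\<close> is a factor of \<open>x_J\<close>; for an invariant form this
  total weight is trivial modulo \<open>q - 1\<close>. Removing the other factors of
  \<open>x_J\<close> reduces the claim to forms of degree at most one.\<close>

lemma torus_coefficient:
  assumes "w \<in> forms k d" "c < n" "J \<subseteq> {..<n}" "m \<in> keys (w J)"
  shows "(q - 1) dvd lookup m c + (if c \<in> J then 1 else 0)"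
proof (rule torus_keys[OF _ assms(4)])
  fix l :: 'k assume l: "l \<noteq> 0"
  define D where "D k = (if k = c then l else 0)" for k
  have D: "elem_mat c D \<in> G" by (rule elem_mat_in) (use assms(2) l e_gt[of c] in \<open>auto simp: D_def\<close>)
  have "(\<Sum>k<n. cst (D k) * var k) = (\<Sum>k<n. if k = c then cst l * var c else 0)"
    by (rule sum.cong) (auto simp: D_def)
  then have \<sigma>: "lin_subst n (elem_mat c D) = var_subst c (cst l * var c)"
    using assms(2) by (simp add: lin_subst_elem_mat)
  let ?p = "psubst (var_subst c (cst l * var c))"
  have "form_fixed n (elem_mat c D) w" using assms(1) D by (auto simp: forms_def)
  then obtain w' where w': "form_fixed n (elem_mat c D) w'"
    "\<And>L. L \<inter> (J - {c}) = {} \<Longrightarrow> w' L = w (L \<union> (J - {c})) \<or> w' L = - w (L \<union> (J - {c}))"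
  proof -
    assume fixed: "form_fixed n (elem_mat c D) w"
      and *: "\<And>w'. form_fixed n (elem_mat c D) w' \<Longrightarrow>
        (\<And>L. L \<inter> (J - {c}) = {} \<Longrightarrow> w' L = w (L \<union> (J - {c})) \<or> w' L = - w (L \<union> (J - {c}))) \<Longrightarrow> thesis"
    have JK: "J - (J \<inter> {c}) = J - {c}" by auto
    show thesis
      using reduce_coefficient[OF fixed assms(2,3,2), of "J \<inter> {c}"] * unfolding JK
        by (auto simp: D_def)
  qed
  show "cst (l ^ (if c \<in> J then 1 else 0)) * ?p (w J) = w J"
  proof (cases "c \<in> J")
    case True
    have "w' {c} = (\<Sum>j<n. ?p (w' {j}) * cst (elem_mat c D c j))"
      using w'(1) form_act_singleton[OF assms(2), of "elem_mat c D" w'] assms(2)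
      unfolding form_fixed_def \<sigma> by simp
    also have "\<dots> = (\<Sum>j<n. if j = c then ?p (w' {c}) * cst l else 0)"
      by (rule sum.cong) (auto simp: elem_mat_def D_def)
    finally have "cst l * ?p (w' {c}) = w' {c}" using assms(2) by (simp add: mult.commute)
    moreover have "w' {c} = w J \<or> w' {c} = - w J"
      using w'(2)[of "{c}"] True by (simp add: insert_absorb)
    ultimately show ?thesis using True by auto
  next
    case False
    have "?p (w' {}) = w' {}"
      using w'(1) form_act_empty[of n "elem_mat c D" w'] unfolding form_fixed_def \<sigma> by simp
    moreover have "w' {} = w J \<or> w' {} = - w J" using w'(2)[of "{}"] False by simp
    ultimately show ?thesis using False by auto
  qed
qed

text \<open>Under \<open>x_b\<close> to \<open>x_b + x_c\<close> the coefficient of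
  \<open>x_b\<close> leaks into that of \<open>x_c\<close>. At \<open>x_c = 0\<close> the
  substitution is trivial on polynomials, so there the leaked term has to vanish.\<close>

lemma transvection_coefficient:
  assumes "w \<in> forms k d" "b < n" "c < b" "J \<subseteq> {..<n}" "b \<in> J" "c \<notin> J"
  shows "var c dvd w J"
proof -
  define D :: "nat \<Rightarrow> 'k" where "D k = (if k = b \<or> k = c then 1 else 0)" for k
  have c: "c < n" using assms by simp
  have D: "elem_mat b D \<in> G" by (rule elem_mat_in) (use assms(2,3) e_gt[of b] in \<open>auto simp: D_def\<close>)
  have "(\<Sum>k<n. cst (D k) * var k) =
      (\<Sum>k<n. (if k = b then var b else 0) + (if k = c then var c else 0))"
    by (rule sum.cong) (use assms(3) in \<open>auto simp: D_def\<close>)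
  then have \<sigma>: "lin_subst n (elem_mat b D) = var_subst b (var b + var c)"
    using assms(2) c by (simp add: lin_subst_elem_mat sum.distrib)
  let ?p = "psubst (var_subst b (var b + var c))" and ?eps = "psubst (var_subst c 0)"
  have fixed: "form_fixed n (elem_mat b D) w" using assms(1) D by (auto simp: forms_def)
  have JK: "J - (J \<inter> {b}) = J - {b}" by auto
  have "\<exists>w'. form_fixed n (elem_mat b D) w' \<and>
      (\<forall>L. L \<inter> (J - {b}) = {} \<longrightarrow> w' L = w (L \<union> (J - {b})) \<or> w' L = - w (L \<union> (J - {b})))"
  proof (rule reduce_coefficient[OF fixed assms(2,4) c, of "J \<inter> {b}", unfolded JK])
    show "D i = (if i = b then 1 else 0)" if "i \<in> J - {b}" for i
      using that assms(6) by (auto simp: D_def)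
  qed simp
  then obtain w' where w': "form_fixed n (elem_mat b D) w'"
    "\<And>L. L \<inter> (J - {b}) = {} \<Longrightarrow> w' L = w (L \<union> (J - {b})) \<or> w' L = - w (L \<union> (J - {b}))"
    by blast
  have "w' {c} = (\<Sum>j<n. ?p (w' {j}) * cst (elem_mat b D c j))"
    using w'(1) form_act_singleton[OF c, of "elem_mat b D" w'] c
    unfolding form_fixed_def \<sigma> by simp
  also have "\<dots> = (\<Sum>j<n. (if j = b then ?p (w' {b}) else 0) + (if j = c then ?p (w' {c}) else 0))"
    by (rule sum.cong) (use assms(3) in \<open>auto simp: elem_mat_def D_def\<close>)
  also have "\<dots> = ?p (w' {b}) + ?p (w' {c})" using assms(2) c by (simp add: sum.distrib)
  finally have eq: "w' {c} = ?p (w' {b}) + ?p (w' {c})" .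
  have epsp: "?eps (?p f) = ?eps f" for f
    unfolding psubst_psubst by (rule psubst_cong) (use assms(3) in \<open>auto simp: var_subst_def\<close>)
  have "?eps (w' {c}) = ?eps (w' {b}) + ?eps (w' {c})"
    using arg_cong[OF eq, of ?eps] by (simp only: psubst_add epsp)
  then have "var c dvd w' {b}" by (simp add: var_dvd_iff)
  moreover have "w' {b} = w J \<or> w' {b} = - w J"
    using w'(2)[of "{b}"] assms(5) by (simp add: insert_absorb)
  ultimately show ?thesis by auto
qed

text \<open>
  For \<open>c\<close> at the start of its block, coefficients of invariant forms have this property except those of
  \<open>x\<^sub>J\<close> with \<open>J \<subseteq> {..<c}\<close>; a contraction that vanishes below \<open>c\<close> removes the exceptions.
\<close>

definition mild :: "nat \<Rightarrow> (nat set \<Rightarrow> 'k sym_alg) \<Rightarrow> bool" where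
  "mild c w \<longleftrightarrow> (\<forall>J\<subseteq>{..<n}. (c \<in> J \<longrightarrow> var c ^ (q - 2) dvd w J) \<and> (c \<notin> J \<longrightarrow> var c ^ (q - 1) dvd w J))"

text \<open>If \<open>c\<close> is not in the remaining set, the term that removes
  \<open>x_c\<close> gains the missing factor \<open>x_c\<close> from \<open>uvec t c\<close>; every
  other term needs the full power in its coefficient.\<close>

lemma mild_contractionI:
  assumes in_J: "\<And>J. J \<subseteq> {..<n} \<Longrightarrow> c \<in> J \<Longrightarrow> var c ^ (q - 2) dvd w J"
    and not_in_J: "\<And>J j. J \<subseteq> {..<n} \<Longrightarrow> c \<notin> J \<Longrightarrow> j \<in> J \<Longrightarrow> uvec t j \<noteq> 0 \<Longrightarrow> var c ^ (q - 1) dvd w J"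
  shows "mild c (contraction n (uvec t) w)"
  unfolding mild_def contraction_def
proof (intro allI impI conjI dvd_sum)
  fix J j assume J: "J \<subseteq> {..<n}" "c \<in> J" and j: "j \<in> {..<n} - J"
  show "var c ^ (q - 2) dvd uvec t j * ext_sign j J * w (insert j J)"
    by (rule dvd_mult[OF in_J]) (use J j in auto)
next
  fix J j assume J: "J \<subseteq> {..<n}" "c \<notin> J" and j: "j \<in> {..<n} - J"
  consider "j = c" | "j \<noteq> c" "uvec t j = 0" | "j \<noteq> c" "uvec t j \<noteq> 0" by blast
  then show "var c ^ (q - 1) dvd uvec t j * ext_sign j J * w (insert j J)"
  proof cases
    case 1
    have "var c * var c ^ (q - 2) dvd uvec t j * w (insert j J)"
      by (rule mult_dvd_mono) (use 1 var_dvd_uvec in_J J j in auto)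
    moreover have "Suc (q - 2) = q - 1" using q_ge_2 by linarith
    then have "var c * var c ^ (q - 2) = (var c :: 'k sym_alg) ^ (q - 1)" by (metis power_Suc)
    ultimately have "var c ^ (q - 1) dvd (uvec t j * w (insert j J)) * ext_sign j J" by simp
    then show ?thesis by (simp add: mult_ac)
  next
    case 2
    then show ?thesis by simp
  next
    case 3
    show ?thesis by (rule dvd_mult[OF not_in_J]) (use J j 3 in auto)
  qed
qed

text \<open>Exponents of \<open>x_c\<close> are -1 or 0 modulo \<open>q - 1\<close>, according to
  whether \<open>c\<close> is in \<open>J\<close>. In the second case they are positive by a
  transvection from some \<open>j > c\<close> in \<open>J\<close>; terms with \<open>j < c\<close>
  drop out because \<open>uvec t\<close> vanishes there.\<close>

lemma mild_contraction_upper: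
  assumes "w \<in> forms k d" "c < n" "t < n" "c \<le> st t"
  shows "mild c (contraction n (uvec t) w)"
proof (rule mild_contractionI)
  fix J assume J: "J \<subseteq> {..<n}" "c \<in> J"
  show "var c ^ (q - 2) dvd w J"
    unfolding var_power_dvd_iff
  proof
    fix m assume "m \<in> keys (w J)"
    then have "(q - 1) dvd lookup m c + 1" using torus_coefficient[OF assms(1,2) J(1)] J(2)
      by fastforce
    then have "q - 1 \<le> lookup m c + 1" by (rule dvd_imp_le) simp
    then show "q - 2 \<le> lookup m c" by simp
  qed
next
  fix J j assume J: "J \<subseteq> {..<n}" "c \<notin> J" "j \<in> J" "uvec t j \<noteq> 0"
  have "c < j"
    using J assms(4) uvec_vanish[of j t] by (cases c j rule: linorder_cases) auto
  show "var c ^ (q - 1) dvd w J"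
    unfolding var_power_dvd_iff
  proof
    fix m assume m: "m \<in> keys (w J)"
    then have "(q - 1) dvd lookup m c" using torus_coefficient[OF assms(1,2) J(1)] J(2) by fastforce
    moreover have "var c ^ 1 dvd w J"
      using transvection_coefficient[OF assms(1) _ \<open>c < j\<close> J(1,3,2)] J by auto
    then have "1 \<le> lookup m c" using m unfolding var_power_dvd_iff by blast
    ultimately show "q - 1 \<le> lookup m c" by (auto dest: dvd_imp_le)
  qed
qed

lemma mild_contractions: "mild c w \<Longrightarrow> mild c (contractions n (map uvec ts) w)"
proof (induction ts)
  case (Cons t ts)
  then have "mild c (contractions n (map uvec ts) w)" by blast
  then have "mild c (contraction n (uvec t) (contractions n (map uvec ts) w))"
    by (intro mild_contractionI) (simp_all add: mild_def)
  then show ?case by simp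
qed simp

lemma sorted_list_of_set_Max:
  "finite S \<Longrightarrow> S \<noteq> {} \<Longrightarrow> sorted_list_of_set S = sorted_list_of_set (S - {Max S}) @ [Max S]"
proof -
  assume S: "finite S" "S \<noteq> {}"
  have "sorted (sorted_list_of_set (S - {Max S}) @ [Max S])"
    using S by (auto simp: sorted_append)
  then show ?thesis
    using S Max_in[OF S] by (intro sorted_distinct_set_unique) (auto simp: insert_absorb)
qed

lemma iota_set_Max:
  "finite S \<Longrightarrow> S \<noteq> {} \<Longrightarrow> iota_set S w = iota_set (S - {Max S}) (contraction n (uvec (Max S)) w)"
  unfolding iota_set_def by (subst sorted_list_of_set_Max) simp_all

lemma Max_lt: "S \<subseteq> {..<n} \<Longrightarrow> S \<noteq> {} \<Longrightarrow> Max S < n"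
  using Max_in[of S] finite_subset[of S "{..<n}"] by auto

lemma end_of_le: "S \<subseteq> {..<n} \<Longrightarrow> end_of S \<le> n"
  using e_le[OF Max_lt] by (auto simp: end_of_def)

text \<open>Orbits reduce a normalized vector with highest variable \<open>x_b\<close> to
  \<open>x_c\<close> at the start \<open>c\<close> of the block of \<open>b\<close>. This
  \<open>c\<close> is at most the start of the block of \<open>Max S\<close>, whose contraction is
  applied first and makes the form mild at \<open>c\<close>.\<close>

lemma nz_prod_dvd_lambda:
  assumes "w \<in> forms k d" "S \<subseteq> {..<n}" "S \<noteq> {}" "invariant 0 (iota_set S w {})"
  shows "nz_prod 0 (end_of S) dvd iota_set S w {}"
proof (rule nz_prod_dvd[OF le0])
  fix \<alpha> assume "\<alpha> \<in> norm_set 0 (end_of S)"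
  then obtain b v where \<alpha>: "\<alpha> = var b + v" "b < end_of S" "v \<in> V 0 b" by (auto simp: norm_set_def)
  define t where "t = Max S"
  have t: "t < n" using Max_lt assms by (simp add: t_def)
  have bt: "b < e t" using \<alpha>(2) assms(3) by (simp add: end_of_def t_def)
  then have b: "b < n" using e_le[OF t] by linarith
  define c where "c = st b"
  have c: "c < n" "c \<le> b" "b < e c" using st_le[OF b] b block[OF b, of c] e_gt[OF b]
    by (auto simp: c_def)
  have "c \<le> st t"
  proof (rule ccontr)
    assume "\<not> c \<le> st t"
    then have "st c = st t" using block[OF t, of c] c bt by auto
    moreover have "st c = c" using st_st[OF b] by (simp add: c_def)
    ultimately show False using \<open>\<not> c \<le> st t\<close> by simp
  qed
  then have "mild c (contraction n (uvec t) w)" by (rule mild_contraction_upper[OF assms(1) c(1) t])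
  then have "mild c (iota_set S w)"
    using iota_set_Max[of S w] finite_subset[OF assms(2)] assms(3) mild_contractions
    unfolding iota_set_def t_def by simp
  then have "var c ^ (q - 1) dvd iota_set S w {}" by (auto simp: mild_def)
  from orbit_dvd[OF assms(4) le0 c(2,3,1) \<alpha>(3) this] show "\<alpha> ^ (q - 1) dvd iota_set S w {}"
    by (simp add: \<alpha>(1))
qed

lemma iota_invariant:
  assumes "w \<in> forms k d" "S \<subseteq> {..<n}"
  shows "invariant 0 (iota_set S w {})"
proof (rule invariant_if_fixed)
  fix g assume g: "g \<in> G"
  have "form_fixed n g (iota_set S w)"
    unfolding iota_set_def using assms g finite_subset[OF assms(2)]
    by (intro form_fixed_contractions) (auto simp: forms_def)
  then have "form_act n g (iota_set S w) {} = iota_set S w {}" by (simp add: form_fixed_def)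
  then show "psubst (lin_subst n g) (iota_set S w {}) = iota_set S w {}"
    by (simp add: form_act_empty)
qed

section \<open>Dividing contractions by their forced factor\<close>

lemma nz_prod_fixed:
  assumes "stabilizes 0 \<sigma>" "b < n" shows "psubst \<sigma> (nz_prod 0 (e b)) = nz_prod 0 (e b)"
proof -
  have *: "inj_on (psubst \<sigma>) (V 0 (e b))" "psubst \<sigma> ` V 0 (e b) = V 0 (e b)"
    using assms unfolding stabilizes_def by auto
  have img: "psubst \<sigma> ` (V 0 (e b) - {0}) = V 0 (e b) - {0}"
    using inj_on_image_set_diff[OF *(1), of "V 0 (e b)" "{0}"] *(2) by simp
  have "nz_prod 0 (e b) = (\<Prod>x\<in>psubst \<sigma> ` (V 0 (e b) - {0}). x)" by (simp add: img nz_prod_def)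
  also have "\<dots> = psubst \<sigma> (nz_prod 0 (e b))"
    unfolding nz_prod_def using inj_on_subset[OF *(1)] by (subst prod.reindex) auto
  finally show ?thesis ..
qed

lemma denom_nz_prod: "S \<subseteq> {..<n} \<Longrightarrow> \<exists>k. k \<noteq> 0 \<and> denom S = cst k * nz_prod 0 (end_of S)"
proof (cases "S = {}")
  case True
  then show ?thesis by (intro exI[of _ 1]) (simp add: denom_def end_of_def nz_prod_def V_empty)
next
  case False
  assume "S \<subseteq> {..<n}"
  from Lpoly_power[OF end_of_le[OF this]] False show ?thesis by (simp add: denom_def)
qed

lemma denom_nonzero: "S \<subseteq> {..<n} \<Longrightarrow> denom S \<noteq> 0"
  using denom_nz_prod[of S] nz_prod_nonzero[of 0 "end_of S"] cst_eq_0_iff sym_alg_mult_eq_0 by metis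

lemma denom_fixed:
  assumes "S \<subseteq> {..<n}" "stabilizes 0 \<sigma>" shows "psubst \<sigma> (denom S) = denom S"
proof (cases "S = {}")
  case False
  then show ?thesis
    using denom_nz_prod[OF assms(1)] nz_prod_fixed[OF assms(2) Max_lt[OF assms(1) False]]
    by (auto simp: end_of_def)
qed (simp add: denom_def)

lemma denom_homogeneous: "S \<subseteq> {..<n} \<Longrightarrow> homogeneous (q ^ end_of S - 1) (denom S)"
  using denom_nz_prod[of S] nz_prod_homogeneous[of "end_of S" 0] homogeneous_mult[OF homogeneous_cst] by fastforce

lemma denom_vars_in: "S \<subseteq> {..<n} \<Longrightarrow> vars_in {0..<n} (denom S)"
  using denom_nz_prod[of S] vars_in_mono[OF nz_prod_vars_in[of 0 "end_of S"], of "{0..<n}"] end_of_le[of S]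
  by (auto intro!: vars_in_mult)

text \<open>The invariants of degree \<open>d\<close> minus the degree of the generator
  \<open>omega S\<close>, with the zero space in negative degree.\<close>

definition coeff_space :: "nat \<Rightarrow> nat set \<Rightarrow> 'k sym_alg set" where
  "coeff_space d S = (if q ^ end_of S - 1 \<le> d + (\<Sum>s\<in>S. q ^ s)
     then inv_space 0 (d + (\<Sum>s\<in>S. q ^ s) - (q ^ end_of S - 1)) else {0})"

lemma iota_coeff_space:
  assumes "w \<in> forms k d" "S \<subseteq> {..<n}"
  shows "\<exists>h\<in>coeff_space d S. iota_set S w {} = denom S * h"
proof -
  let ?f = "iota_set S w {}"
  have inv: "invariant 0 ?f" by (rule iota_invariant[OF assms])
  have hom: "homogeneous (d + (\<Sum>s\<in>S. q ^ s)) ?f" "vars_in {0..<n} ?f"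
    using homog_form_iota_set[of d w S] assms by (auto simp: forms_def homog_form_def)
  obtain k where k: "k \<noteq> 0" "denom S = cst k * nz_prod 0 (end_of S)"
    using denom_nz_prod[OF assms(2)] by blast
  have "nz_prod 0 (end_of S) dvd ?f"
  proof (cases "S = {}")
    case True
    then show ?thesis by (simp add: end_of_def nz_prod_def V_empty)
  qed (rule nz_prod_dvd_lambda[OF assms _ inv])
  then obtain g where "?f = nz_prod 0 (end_of S) * g" by blast
  then have f: "?f = denom S * (cst (1 / k) * g)"
    using k(1) by (simp add: k(2) mult_single mult_ac flip: mult.assoc[of "cst _" "cst _"])
  let ?h = "cst (1 / k) * g"
  note nz = denom_nonzero[OF assms(2)]
  have "invariant 0 (denom S)"
    using denom_fixed[OF assms(2) elementary_stabilizes] by (simp add: invariant_def)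
  then have "invariant 0 ?h" using invariant_cancel[OF inv[unfolded f] _ nz] by blast
  moreover have "vars_in {0..<n} ?h"
    by (rule vars_in_cancel[OF hom(2)[unfolded f] denom_vars_in[OF assms(2)] nz])
  moreover note homogeneous_cancel[OF hom(1)[unfolded f] denom_homogeneous[OF assms(2)] nz]
  ultimately have "?h \<in> coeff_space d S" by (auto simp: coeff_space_def inv_space_def)
  then show ?thesis using f by blast
qed

lemma sum_powers: "(q - 1) * (\<Sum>t<m. q ^ t) = q ^ m - 1"
proof (induction m)
  case (Suc m)
  have "q * q ^ m = q ^ m + (q - 1) * q ^ m" using q_pos by (cases q) auto
  moreover have "1 \<le> q ^ m" using q_pos by simp
  ultimately show ?case using Suc by (simp add: distrib_left)
qed simp

lemma end_of_upper:
  assumes "S \<subseteq> {..<n}" "S \<noteq> {}"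
  shows "S \<subseteq> {..<end_of S}" and "\<And>j. j < end_of S \<Longrightarrow> e j \<le> end_of S"
proof -
  let ?t = "Max S"
  have t: "?t < n" "end_of S = e ?t" using Max_lt[OF assms] assms(2) by (auto simp: end_of_def)
  show "S \<subseteq> {..<end_of S}"
  proof
    fix s assume "s \<in> S"
    then have "s \<le> ?t" using finite_subset[OF assms(1)] by simp
    then show "s \<in> {..<end_of S}" using e_gt[OF t(1)] t(2) by simp
  qed
  fix j assume j: "j < end_of S"
  show "e j \<le> end_of S"
  proof (cases "j \<le> ?t")
    case True
    then show ?thesis using e_mono t by simp
  next
    case False
    then have "e j = e ?t" using block[OF t(1), of j] st_le[OF t(1)] j t(2) by simp
    then show ?thesis using t(2) by simp
  qed
qed

text \<open>Ensures that the subtraction in \<open>omega_deg\<close> is never truncated.\<close>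

lemma sum_le_end_of: "S \<subseteq> {..<n} \<Longrightarrow> (\<Sum>s\<in>S. q ^ s) \<le> q ^ end_of S - 1"
proof (cases "S = {}")
  case False
  assume "S \<subseteq> {..<n}"
  then have "(\<Sum>s\<in>S. q ^ s) \<le> (\<Sum>t<end_of S. q ^ t)"
    using end_of_upper(1)[of S] False by (intro sum_mono2) auto
  also have "\<dots> \<le> (q - 1) * (\<Sum>t<end_of S. q ^ t)" using q_gt_1 by (cases "q - 1") auto
  finally show ?thesis unfolding sum_powers .
qed simp

section \<open>The generators are invariant\<close>

lemma is_form_vol: "m \<le> n \<Longrightarrow> is_form m (vol m)"
  by (auto simp: is_form_def vol_def split: if_splits)

lemma homog_form_vol: "homog_form 0 (vol m)"
  by (simp add: homog_form_def vol_def)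

text \<open>The span of the variables below \<open>m\<close> is stable, so only its top minor
  survives; \<open>c\<close> is the determinant of \<open>g\<close> on this span.\<close>

lemma form_act_vol:
  assumes "g \<in> G" "m \<le> n" "\<And>j. j < m \<Longrightarrow> e j \<le> m"
  shows "\<exists>c. form_act n g (vol m) = (\<lambda>K. cst c * vol m K)"
proof -
  obtain c where c: "ext_image n g {..<m} {..<m} = cst c" using ext_image_const by blast
  have "form_act n g (vol m) K = cst c * vol m K" for K
  proof -
    have "form_act n g (vol m) K =
        (\<Sum>J\<in>{{..<m}}. psubst (lin_subst n g) (vol m J) * ext_image n g J K)"
      unfolding form_act_def by (rule sum.mono_neutral_right) (use assms(2) in \<open>auto simp: vol_def\<close>)
    then have act: "form_act n g (vol m) K = ext_image n g {..<m} K" by (simp add: vol_def)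
    show ?thesis
    proof (cases "K = {..<m}")
      case False
      have "ext_image n g {..<m} K = 0"
      proof (rule ccontr)
        assume "ext_image n g {..<m} K \<noteq> 0"
        moreover have "g k j = 0" if "j \<in> {..<m}" "k < n" "k \<notin> {..<m}" for j k
          by (rule below_blocks[OF assms(1)]) (use that assms(2) assms(3)[of j] in auto)
        ultimately have "card K = m" "K \<subseteq> {..<m}"
          using ext_image_support[of "{..<m}" n g K "{..<m}"] by auto
        then show False using card_subset_eq[of "{..<m}" K] False by simp
      qed
      then show ?thesis using act False by (simp add: vol_def)
    next
      case True
      show ?thesis unfolding act unfolding True by (simp add: c vol_def)
    qed
  qed
  then show ?thesis by (intro exI[of _ c]) (simp add: fun_eq_iff)
qed

lemma Lpoly_homogeneous: "m \<le> n \<Longrightarrow> homogeneous (\<Sum>t<m. q ^ t) (Lpoly m) \<and> vars_in {0..<n} (Lpoly m)"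
  using homog_form_contractions[OF homog_form_vol, of "[0..<m]" m]
  by (auto simp: Lpoly_def homog_form_def interv_sum_list_conv_sum_set_nat atLeast0LessThan)

definition omega_deg :: "nat set \<Rightarrow> nat" where
  "omega_deg S = q ^ end_of S - 1 - (\<Sum>s\<in>S. q ^ s)"

lemma omega_forms:
  assumes "S \<subseteq> {..<n}" shows "omega S \<in> forms (card S) (omega_deg S)"
proof (cases "S = {}")
  case True
  have "omega S = vol 0" using True by (auto simp: omega_def)
  moreover have "form_fixed n g (vol 0)" if g: "g \<in> G" for g
  proof -
    obtain c where c: "form_act n g (vol 0) = (\<lambda>K. cst c * vol 0 K)"
      using form_act_vol[OF g, of 0] by auto
    have "form_act n g (vol 0) {} = 1" by (simp add: form_act_empty vol_def)
    then have "cst c = (1 :: 'k sym_alg)" by (simp add: c vol_def)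
    then show ?thesis by (simp add: form_fixed_def c)
  qed
  ultimately show ?thesis
    using True is_form_vol[of 0] homog_form_vol[of 0]
      by (simp add: forms_def omega_deg_def end_of_def)
next
  case False
  define m where "m = end_of S"
  have m: "m \<le> n" "S \<subseteq> {..<m}" "\<And>j. j < m \<Longrightarrow> e j \<le> m"
    using end_of_le[OF assms] end_of_upper[OF assms False] by (auto simp: m_def)
  have fin: "finite S" using assms finite_subset by blast
  define W where "W = iota_set ({..<m} - S) (vol m)"
  have om: "omega S = (\<lambda>K. Lpoly m ^ (q - 2) * W K)" using False
    by (auto simp: omega_def W_def m_def)
  have W_form: "is_form (card S) W"
    unfolding W_def iota_set_def
  proof (rule is_form_contractions)
    have "card ({..<m} - S) + card S = m" using m(2) fin card_mono[of "{..<m}" S]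
      by (simp add: card_Diff_subset)
    then show "is_form (length (map uvec (sorted_list_of_set ({..<m} - S))) + card S) (vol m)"
      using is_form_vol[OF m(1)] by simp
  qed
  have "homog_form (0 + (\<Sum>t\<in>{..<m} - S. q ^ t)) W"
    unfolding W_def by (rule homog_form_iota_set[OF homog_form_vol]) (use m in auto)
  then have W_hom: "homog_form (\<Sum>t\<in>{..<m} - S. q ^ t) W" by simp
  \<comment> \<open>From \<open>q^m - 1 = (q - 1) * (\<Sum>t<m. q ^ t)\<close>: the powers of
    \<open>Lpoly\<close> use \<open>q - 2\<close> copies of the sum, the complement of
    \<open>S\<close> uses one copy without the part over \<open>S\<close>.\<close>
  have deg: "(\<Sum>t<m. q ^ t) * (q - 2) + (\<Sum>t\<in>{..<m} - S. q ^ t) = omega_deg S"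
  proof -
    have "(\<Sum>t\<in>{..<m} - S. q ^ t) + (\<Sum>s\<in>S. q ^ s) = (\<Sum>t<m. q ^ t)"
      using sum.subset_diff[OF m(2), of "\<lambda>t. q ^ t"] by simp
    moreover have "q - 1 = Suc (q - 2)" using q_ge_2 by linarith
    then have "(q - 1) * (\<Sum>t<m. q ^ t) = (\<Sum>t<m. q ^ t) * (q - 2) + (\<Sum>t<m. q ^ t)" by simp
    ultimately show ?thesis using sum_powers[of m] by (simp add: omega_deg_def m_def)
  qed
  have "is_form (card S) (omega S)"
    using W_form unfolding om is_form_def by auto
  moreover have "homog_form (omega_deg S) (omega S)"
    unfolding homog_form_def om deg[symmetric]
    using Lpoly_homogeneous[OF m(1)] W_hom
    by (auto simp: homog_form_def intro!: homogeneous_mult homogeneous_power vars_in_mult vars_in_power)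
  moreover have "form_fixed n g (omega S)" if g: "g \<in> G" for g
  proof -
    let ?p = "psubst (lin_subst n g)" and ?L = "Lpoly m"
    obtain c where c: "form_act n g (vol m) = (\<lambda>K. cst c * vol m K)" using form_act_vol[OF g m(1,3)]
      by auto
    have L0: "?p ?L = cst c * ?L"
    proof -
      have "?p ?L = form_act n g (contractions n (map uvec [0..<m]) (vol m)) {}"
        by (simp add: Lpoly_def form_act_empty)
      also have "\<dots> = contractions n (map uvec [0..<m]) (\<lambda>K. cst c * vol m K) {}"
        unfolding c[symmetric] by (rule form_act_contractions[OF g]) (use m(1) in auto)
      finally show ?thesis by (simp add: contractions_scale Lpoly_def)
    qed
    \<comment> \<open>That \<open>c\<close> is a root of unity of order dividing
      \<open>q - 1\<close> is read off from the invariance of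
      \<open>Lpoly m ^ (q - 1)\<close>.\<close>
    have "?p (denom S) = denom S" by (rule denom_fixed[OF assms G_stabilizes[OF g]])
    then have "cst (c ^ (q - 1)) * denom S = cst 1 * denom S"
      using False by (simp add: denom_def L0 power_mult_distrib cst_power flip: m_def)
    then have "(cst (c ^ (q - 1) - 1) :: 'k sym_alg) * denom S = 0"
      by (simp add: single_diff left_diff_distrib)
    then have c1: "c ^ (q - 1) = 1" using denom_nonzero[OF assms] sym_alg_mult_eq_0 cst_eq_0_iff
      by fastforce
    have W_act: "form_act n g W K = cst c * W K" if "K \<subseteq> {..<n}" for K
    proof -
      have "form_act n g W K = contractions n (map uvec (sorted_list_of_set ({..<m} - S))) (\<lambda>K. cst c * vol m K) K"
        unfolding W_def iota_set_def c[symmetric]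
        by (rule form_act_contractions[OF g _ that]) (use m(1) in auto)
      then show ?thesis by (simp add: contractions_scale W_def iota_set_def)
    qed
    have "c ^ (q - 2) * c = 1"
    proof -
      have "Suc (q - 2) = q - 1" using q_ge_2 by linarith
      then have "c ^ (q - 2) * c = c ^ (q - 1)" by (metis power_Suc2)
      then show ?thesis using c1 by simp
    qed
    then have cc: "cst (c ^ (q - 2)) * cst c = (1 :: 'k sym_alg)" by (simp add: mult_single)
    show ?thesis
      unfolding form_fixed_def
    proof (intro allI impI)
      fix K assume K: "K \<subseteq> {..<n}"
      have "form_act n g (omega S) K = (cst (c ^ (q - 2)) * cst c) * (?L ^ (q - 2) * W K)"
        unfolding om form_act_scale W_act[OF K] psubst_power L0 power_mult_distrib cst_power
          by (simp only: mult_ac)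
      then show "form_act n g (omega S) K = omega S K" by (simp add: cc om)
    qed
  qed
  ultimately show ?thesis by (simp add: forms_def)
qed

lemma iota_set_scale: "iota_set S (\<lambda>K. c * w K) = (\<lambda>K. c * iota_set S w K)"
  by (simp add: iota_set_def contractions_scale)

lemma iota_set_sum: "iota_set S (\<lambda>K. \<Sum>i\<in>I. w i K) = (\<lambda>K. \<Sum>i\<in>I. iota_set S (w i) K)"
  by (simp add: iota_set_def contractions_sum)

lemma contraction_supported:
  assumes "\<And>K. w K \<noteq> 0 \<Longrightarrow> K \<subseteq> M" "contraction n u w K \<noteq> 0" shows "K \<subseteq> M"
proof -
  from sum.not_neutral_contains_not_neutral[OF assms(2)[unfolded contraction_def]]
  obtain j where "u j * ext_sign j K * w (insert j K) \<noteq> 0" by blast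
  then have "w (insert j K) \<noteq> 0" by auto
  then show ?thesis using assms(1)[of "insert j K"] by auto
qed

lemma contractions_supported:
  assumes "\<And>K. w K \<noteq> 0 \<Longrightarrow> K \<subseteq> M" "contractions n us w K \<noteq> 0" shows "K \<subseteq> M"
  using assms(2)
proof (induction us arbitrary: K)
  case (Cons u us)
  show ?case by (rule contraction_supported[of "contractions n us w" M u K]) (use Cons in auto)
qed (use assms(1) in simp)

text \<open>All contractions together are indexed by \<open>S'\<close> and the complement of
  \<open>S\<close>. If \<open>S'\<close> stays below \<open>m\<close>, either they rearrange to one
  full contraction of the volume form or an index is repeated. Otherwise \<open>Max S'\<close> lies
  in a later block, and its vector vanishes on all variables of the volume form.\<close>

lemma iota_omega:
  assumes "S \<subseteq> {..<n}" "S' \<subseteq> {..<n}" "card S' = card S"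
  shows "if S' = S then iota_set S' (omega S) {} = denom S \<or> iota_set S' (omega S) {} = - denom S
    else iota_set S' (omega S) {} = 0"
proof (cases "S = {}")
  case True
  then have "S' = {}" using assms finite_subset[OF assms(2)] by auto
  then show ?thesis using True by (simp add: iota_set_def omega_def denom_def vol_def)
next
  case False
  define m where "m = end_of S"
  have m: "m \<le> n" "S \<subseteq> {..<m}"
    using end_of_le[OF assms(1)] end_of_upper[OF assms(1) False] by (auto simp: m_def)
  have fin: "finite S" "finite S'" using assms finite_subset by blast+
  have S': "S' \<noteq> {}" using assms(3) False fin by auto
  have om: "omega S = (\<lambda>K. Lpoly m ^ (q - 2) * iota_set ({..<m} - S) (vol m) K)"
    using False by (auto simp: omega_def m_def)
  let ?c = "iota_set S' (iota_set ({..<m} - S) (vol m)) {}"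
  have val: "iota_set S' (omega S) {} = Lpoly m ^ (q - 2) * ?c" unfolding om iota_set_scale ..
  have c_append: "?c = contractions n (map uvec (sorted_list_of_set S' @ sorted_list_of_set ({..<m} - S))) (vol m) {}"
    by (simp add: iota_set_def)
  have "if S' = S then ?c = Lpoly m \<or> ?c = - Lpoly m else ?c = 0"
  proof (cases "S' \<subseteq> {..<m}")
    case True
    show ?thesis
    proof (cases "S' \<inter> ({..<m} - S) = {}")
      case disj: True
      then have "S' \<subseteq> S" using True by auto
      then have eq: "S' = S" using assms(3) fin card_subset_eq by blast
      have "mset (sorted_list_of_set S' @ sorted_list_of_set ({..<m} - S)) = mset [0..<m]"
      proof (rule iffD1[OF set_eq_iff_mset_eq_distinct])
        show "set (sorted_list_of_set S' @ sorted_list_of_set ({..<m} - S)) = set [0..<m]"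
          using m(2) fin eq by auto
      qed (use fin disj in auto)
      then have "mset (map uvec (sorted_list_of_set S' @ sorted_list_of_set ({..<m} - S))) =
          mset (map uvec [0..<m])"
        by (metis mset_map)
      from contractions_perm[OF this, of n "vol m"]
      have "?c = Lpoly m \<or> ?c = - Lpoly m" unfolding c_append Lpoly_def same_up_to_sign_def by auto
      then show ?thesis using eq by simp
    next
      case False
      then have "\<not> distinct (sorted_list_of_set S' @ sorted_list_of_set ({..<m} - S))"
        using fin by auto
      then have "\<not> distinct (map uvec (sorted_list_of_set S' @ sorted_list_of_set ({..<m} - S)))"
        unfolding distinct_map by blast
      from contractions_not_distinct[OF this] have "?c = 0" unfolding c_append by simp
      moreover have "S' \<noteq> S" using False by auto
      ultimately show ?thesis by simp
    qed
  next
    case False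
    then obtain s where s: "s \<in> S'" "m \<le> s" by (meson lessThan_iff not_less subsetI)
    define t where "t = Max S'"
    have "s \<le> t" unfolding t_def using fin(2) s(1) by (rule Max_ge)
    then have t: "m \<le> t" "t < n" using s(2) Max_lt[OF assms(2) S'] by (simp_all add: t_def)
    have "m \<le> st t"
    proof (rule ccontr)
      assume lt: "\<not> m \<le> st t"
      then have "e (m - 1) = e t" using block[OF t(2), of "m - 1"] t e_gt[OF t(2)] by simp
      moreover have "e (m - 1) \<le> m"
        unfolding m_def by (rule end_of_upper(2)[OF assms(1) \<open>S \<noteq> {}\<close>]) (use lt in \<open>simp add: m_def\<close>)
      ultimately show False using e_gt[OF t(2)] t by simp
    qed
    let ?W = "iota_set ({..<m} - S) (vol m)"
    have supp: "K \<subseteq> {..<m}" if "?W K \<noteq> 0" for K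
      by (rule contractions_supported[OF _ that[unfolded iota_set_def]])
        (simp add: vol_def split: if_splits)
    have "contraction n (uvec t) ?W K = 0" for K
      unfolding contraction_def
    proof (rule sum.neutral, rule ballI)
      fix j
      show "uvec t j * ext_sign j K * ?W (insert j K) = 0"
      proof (cases "j < m")
        case True
        then show ?thesis using uvec_vanish[of j t] \<open>m \<le> st t\<close> by simp
      next
        case False
        then have "?W (insert j K) = 0" using supp[of "insert j K"] by auto
        then show ?thesis by simp
      qed
    qed
    then have "contraction n (uvec t) ?W = (\<lambda>_. 0)" by (simp add: fun_eq_iff)
    then have "?c = 0" unfolding iota_set_Max[OF fin(2) S'] t_def[symmetric]
      by (simp add: iota_set_def)
    moreover have "S' \<noteq> S" using False m by auto
    ultimately show ?thesis by simp
  qed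
  moreover have "Lpoly m ^ (q - 2) * Lpoly m = denom S"
  proof -
    have "Suc (q - 2) = q - 1" using q_ge_2 by linarith
    then show ?thesis using False by (metis denom_def m_def power_Suc2)
  qed
  ultimately show ?thesis unfolding val by (auto split: if_splits)
qed

section \<open>The generators form a free basis\<close>

definition ksets :: "nat \<Rightarrow> nat set set" where
  "ksets k = {S. S \<subseteq> {..<n} \<and> card S = k}"

lemma finite_ksets: "finite (ksets k)"
  by (rule finite_subset[of _ "Pow {..<n}"]) (auto simp: ksets_def)

lemma coeff_space_fixed: "h \<in> coeff_space d S \<Longrightarrow> g \<in> G \<Longrightarrow> psubst (lin_subst n g) h = h"
  using inv_space_fixed by (auto simp: coeff_space_def split: if_splits)

lemma coeff_space_uminus: "h \<in> coeff_space d S \<Longrightarrow> - h \<in> coeff_space d S"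
  by (auto simp: coeff_space_def inv_space_def invariant_def split: if_splits)

lemma forms_sum:
  assumes "\<And>i. i \<in> I \<Longrightarrow> w i \<in> forms k d" shows "(\<lambda>K. \<Sum>i\<in>I. w i K) \<in> forms k d"
proof -
  have "is_form k (\<lambda>K. \<Sum>i\<in>I. w i K)"
    unfolding is_form_def
  proof (intro allI impI)
    fix K assume "(\<Sum>i\<in>I. w i K) \<noteq> 0"
    from sum.not_neutral_contains_not_neutral[OF this] obtain i where "i \<in> I" "w i K \<noteq> 0" by blast
    then show "K \<subseteq> {..<n} \<and> card K = k" using assms[of i] by (auto simp: forms_def is_form_def)
  qed
  moreover have "homog_form d (\<lambda>K. \<Sum>i\<in>I. w i K)"
    unfolding homog_form_def
    by (intro allI conjI homogeneous_sum vars_in_sum) (use assms in \<open>auto simp: forms_def homog_form_def\<close>)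
  moreover have "form_fixed n g (\<lambda>K. \<Sum>i\<in>I. w i K)" if "g \<in> G" for g
    using assms that by (auto simp: form_fixed_def form_act_sum forms_def)
  ultimately show ?thesis by (simp add: forms_def)
qed

lemma omega_scaled:
  assumes "S \<in> ksets k" "h \<in> coeff_space d S" shows "(\<lambda>K. h * omega S K) \<in> forms k d"
proof -
  have S: "S \<subseteq> {..<n}" "card S = k" using assms by (auto simp: ksets_def)
  have om: "is_form k (omega S)" "homog_form (omega_deg S) (omega S)" "\<And>g. g \<in> G \<Longrightarrow>
      form_fixed n g (omega S)"
    using omega_forms[OF S(1)] S(2) by (auto simp: forms_def)
  have "is_form k (\<lambda>K. h * omega S K)" using om(1) by (auto simp: is_form_def)
  moreover have "homog_form d (\<lambda>K. h * omega S K)"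
  proof (cases "h = 0")
    case False
    then have h: "q ^ end_of S - 1 \<le> d + (\<Sum>s\<in>S. q ^ s)"
      "h \<in> inv_space 0 (d + (\<Sum>s\<in>S. q ^ s) - (q ^ end_of S - 1))"
      using assms(2) by (auto simp: coeff_space_def split: if_splits)
    have "d + (\<Sum>s\<in>S. q ^ s) - (q ^ end_of S - 1) + omega_deg S = d"
      using h(1) sum_le_end_of[OF S(1)] by (simp add: omega_deg_def)
    then show ?thesis
      using homogeneous_mult[of _ h "omega_deg S"] h(2) om(2)
      by (auto simp: homog_form_def inv_space_def intro!: vars_in_mult) metis
  qed (simp add: homog_form_def)
  moreover have "form_fixed n g (\<lambda>K. h * omega S K)" if "g \<in> G" for g
    using om(3)[OF that] coeff_space_fixed[OF assms(2) that]
      by (simp add: form_fixed_def form_act_scale)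
  ultimately show ?thesis by (simp add: forms_def)
qed

text \<open>The contractions form a diagonal pairing with the generators, up to sign, so the
  coefficients are determined. The quotients of \<open>iota_set S w {}\<close> by the diagonal
  entries are admissible coefficients; the difference to the form they define has zero contractions
  and therefore vanishes.\<close>

theorem forms_bij:
  "bij_betw (\<lambda>h K. \<Sum>S\<in>ksets k. h S * omega S K) (PiE (ksets k) (coeff_space d)) (forms k d)"
proof -
  let ?Psi = "\<lambda>h K. \<Sum>S\<in>ksets k. h S * omega S K"
  have pair: "iota_set S (?Psi h) {} = h S * iota_set S (omega S) {}" if "S \<in> ksets k" for h S
  proof -
    have "iota_set S (?Psi h) {} = (\<Sum>S'\<in>ksets k. h S' * iota_set S (omega S') {})"
      by (simp add: iota_set_sum iota_set_scale)
    also have "\<dots> = (\<Sum>S'\<in>{S}. h S' * iota_set S (omega S') {})"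
    proof (rule sum.mono_neutral_right[OF finite_ksets])
      show "\<forall>S'\<in>ksets k - {S}. h S' * iota_set S (omega S') {} = 0"
      proof
        fix S' assume "S' \<in> ksets k - {S}"
        then show "h S' * iota_set S (omega S') {} = 0"
          using iota_omega[of S' S] that by (auto simp: ksets_def split: if_splits)
      qed
    qed (use that in auto)
    finally show ?thesis by simp
  qed
  have pm: "iota_set S (omega S) {} = denom S \<or> iota_set S (omega S) {} = - denom S"
    if "S \<in> ksets k" for S
    using iota_omega[of S S] that by (auto simp: ksets_def)
  have nz: "iota_set S (omega S) {} \<noteq> 0" if "S \<in> ksets k" for S
    using pm[OF that] denom_nonzero[of S] that by (auto simp: ksets_def)
  show ?thesis
  proof (rule bij_betw_imageI)
    show "inj_on ?Psi (PiE (ksets k) (coeff_space d))"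
    proof (rule inj_onI)
      fix h h' assume h: "h \<in> PiE (ksets k) (coeff_space d)" "h' \<in> PiE (ksets k) (coeff_space d)"
        and eq: "?Psi h = ?Psi h'"
      show "h = h'"
      proof (rule PiE_ext[OF h])
        fix S assume S: "S \<in> ksets k"
        have "iota_set S (?Psi h) {} = iota_set S (?Psi h') {}" by (simp only: eq)
        then have "iota_set S (omega S) {} * h S = iota_set S (omega S) {} * h' S"
          unfolding pair[OF S] by (simp only: mult.commute)
        then show "h S = h' S" by (rule sym_alg_mult_left_cancel[OF nz[OF S]])
      qed
    qed
    show "?Psi ` PiE (ksets k) (coeff_space d) = forms k d"
    proof (intro equalityI subsetI)
      fix w assume "w \<in> ?Psi ` PiE (ksets k) (coeff_space d)"
      then show "w \<in> forms k d" by (auto intro!: forms_sum omega_scaled)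
    next
      fix w assume w: "w \<in> forms k d"
      have "\<exists>h\<in>coeff_space d S. iota_set S w {} = h * iota_set S (omega S) {}"
        if S: "S \<in> ksets k" for S
      proof -
        obtain h where h: "h \<in> coeff_space d S" "iota_set S w {} = denom S * h"
          using iota_coeff_space[OF w, of S] S by (auto simp: ksets_def)
        from pm[OF S] show ?thesis
        proof
          assume "iota_set S (omega S) {} = denom S"
          then show ?thesis using h by (auto simp: mult.commute)
        next
          assume "iota_set S (omega S) {} = - denom S"
          then show ?thesis using h coeff_space_uminus[OF h(1)]
            by (intro bexI[of _ "- h"]) (simp_all add: mult.commute)
        qed
      qed
      then obtain h0 where h0: "\<And>S. S \<in> ksets k \<Longrightarrow>
          h0 S \<in> coeff_space d S \<and> iota_set S w {} = h0 S * iota_set S (omega S) {}"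
        by metis
      define h where "h = restrict h0 (ksets k)"
      have h: "h \<in> PiE (ksets k) (coeff_space d)" using h0 by (auto simp: h_def)
      have Psi: "?Psi h \<in> forms k d" using h by (auto intro!: forms_sum omega_scaled)
      define w' where "w' = (\<lambda>K. w K + (- 1) * ?Psi h K)"
      have "is_form k w'"
        unfolding is_form_def
      proof (intro allI impI)
        fix K assume "w' K \<noteq> 0"
        then have "w K \<noteq> 0 \<or> ?Psi h K \<noteq> 0" by (auto simp: w'_def)
        then show "K \<subseteq> {..<n} \<and> card K = k"
          using w Psi unfolding forms_def is_form_def by blast
      qed
      moreover have "iota_set S w' {} = 0" if "S \<subseteq> {..<n}" "card S = k" for S
      proof -
        have S: "S \<in> ksets k" using that by (simp add: ksets_def)
        have "iota_set S w' {} = iota_set S w {} + (- 1) * iota_set S (?Psi h) {}"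
          unfolding w'_def iota_set_def contractions_add contractions_scale ..
        then show ?thesis using h0[OF S] S by (simp add: pair h_def)
      qed
      ultimately have "w' = (\<lambda>_. 0)" by (rule iota_inject)
      then have "w = ?Psi h" by (simp add: w'_def fun_eq_iff)
      then show "w \<in> ?Psi ` PiE (ksets k) (coeff_space d)" using h by blast
    qed
  qed
qed

lemma card_forms: "card (forms k d) = (\<Prod>S\<in>ksets k. card (coeff_space d S))"
  using bij_betw_same_card[OF forms_bij] card_PiE[OF finite_ksets] by metis

end

section \<open>Dimensions and Hilbert series\<close>

text \<open>Over a finite field dimensions can be read off from cardinalities, so that bijections suffice.\<close>

lemma card_finite_subspace:
  fixes U :: "('b \<Rightarrow>\<^sub>0 'k::{field,finite}) set"
  assumes "scale.subspace U" "finite U"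
  shows "card U = card (UNIV :: 'k set) ^ scale.dim U"
proof -
  obtain B where B: "B \<subseteq> U" "scale.independent B" "U \<subseteq> scale.span B" "card B = scale.dim U"
    using scale.basis_exists[of U] by blast
  have fin: "finite B" using B(1) assms(2) finite_subset by blast
  have span: "scale.span B = U"
    using B(1,3) scale.span_minimal[OF B(1) assms(1)] by blast
  let ?\<phi> = "\<lambda>c. \<Sum>b\<in>B. scale (c b) b"
  have "bij_betw ?\<phi> (PiE B (\<lambda>_. UNIV)) U"
  proof (rule bij_betw_imageI)
    show "inj_on ?\<phi> (PiE B (\<lambda>_. UNIV))"
    proof (rule inj_onI)
      fix c d :: "('b \<Rightarrow>\<^sub>0 'k) \<Rightarrow> 'k"
      assume c: "c \<in> PiE B (\<lambda>_. UNIV)" "d \<in> PiE B (\<lambda>_. UNIV)" and eq: "?\<phi> c = ?\<phi> d"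
      have "(\<Sum>b\<in>B. scale (c b - d b) b) = 0"
        using eq by (simp add: scale.scale_left_diff_distrib sum_subtractf)
      then have "c b - d b = 0" if "b \<in> B" for b
        using scale.dependent_finite[OF fin] B(2) that by (auto simp del: right_minus_eq)
      then show "c = d" by (intro PiE_ext[OF c]) simp
    qed
    show "?\<phi> ` PiE B (\<lambda>_. UNIV) = U"
      unfolding span[symmetric] scale.span_finite[OF fin]
    proof (intro equalityI subsetI)
      fix x assume "x \<in> range ?\<phi>"
      then obtain c where "x = ?\<phi> c" by (rule rangeE)
      also have "\<dots> = ?\<phi> (restrict c B)" by (rule sum.cong) auto
      finally show "x \<in> ?\<phi> ` PiE B (\<lambda>_. UNIV)" by (rule image_eqI[where f = ?\<phi>]) auto
    qed (rule subsetD[OF image_mono[OF subset_UNIV]])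
  qed
  then show ?thesis using bij_betw_same_card card_PiE[OF fin, of "\<lambda>_. UNIV :: 'k set"] B(4)
    by fastforce
qed

section \<open>The Hilbert series of the polynomial invariants\<close>

context flag
begin

lemma inv_space_subspace: "scale.subspace (inv_space a d)"
proof (rule scale.subspaceI)
  fix c f assume "f \<in> inv_space a d"
  then show "scale c f \<in> inv_space a d"
    by (auto simp: inv_space_def intro: homogeneous_scale vars_in_scale) 
      (simp add: scale_conv_mult invariant_mult)
qed (auto simp: inv_space_def intro: homogeneous_add vars_in_add invariant_add)

definition inv_dim :: "nat \<Rightarrow> nat \<Rightarrow> nat" where
  "inv_dim a d = scale.dim (inv_space a d)"

lemma finite_inv_space: "a \<le> n \<Longrightarrow> finite (inv_space a d)"
proof (induction a arbitrary: d rule: inc_induct)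
  case base
  have "inv_space n d \<subseteq> range cst" by (metis inv_space_n rangeI subsetI)
  then show ?case by (rule finite_subset) simp
next
  case (step a)
  have "a < n" using step by simp
  show ?case
  proof (induction d rule: less_induct)
    case (less d)
    obtain \<phi> where \<phi>: "bij_betw \<phi>
        ((if q ^ (e a - a) - 1 \<le> d then inv_space a (d - (q ^ (e a - a) - 1)) else {0}) \<times>
         (if q dvd d then inv_space (Suc a) (d div q) else {0})) (inv_space a d)"
      using inv_space_bij[OF \<open>a < n\<close>, of d] by blast
    have "q ^ (e a - a) - 1 > 0"
      using one_less_power[OF q_gt_1, of "e a - a"] e_gt[OF \<open>a < n\<close>] by simp
    then show ?case using less.IH step.IH bij_betw_finite[OF \<phi>] by simp
  qed
qed

lemma card_inv_space: "a \<le> n \<Longrightarrow> card (inv_space a d) = q ^ inv_dim a d"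
  unfolding inv_dim_def q_card
    by (rule card_finite_subspace[OF inv_space_subspace finite_inv_space])

lemma inv_dim_n: "inv_dim n d = (if d = 0 then 1 else 0)"
proof (cases "d = 0")
  case True
  have "inv_space n d = range cst"
    using inv_space_n True by (auto simp: inv_space_def)
  moreover have "inj (cst :: 'k \<Rightarrow> 'k sym_alg)" by (rule injI) (metis lookup_single_eq)
  ultimately have "q ^ inv_dim n d = q ^ 1" using card_inv_space[of n d]
    by (simp add: card_image q_card)
  then show ?thesis using True q_gt_1 by (metis power_inject_exp)
next
  case False
  then have "inv_space n d = {0}" using inv_space_n by (auto simp: inv_space_def)
  then have "q ^ inv_dim n d = q ^ 0" using card_inv_space[of n d] by simp
  then have "inv_dim n d = 0" using power_inject_exp[OF q_gt_1] by blast
  then show ?thesis using False by simp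
qed

lemma inv_dim_rec:
  assumes "a < n"
  shows "inv_dim a d = (if q ^ (e a - a) - 1 \<le> d then inv_dim a (d - (q ^ (e a - a) - 1)) else 0) +
    (if q dvd d then inv_dim (Suc a) (d div q) else 0)"
proof -
  obtain \<phi> where \<phi>: "bij_betw \<phi>
      ((if q ^ (e a - a) - 1 \<le> d then inv_space a (d - (q ^ (e a - a) - 1)) else {0}) \<times>
       (if q dvd d then inv_space (Suc a) (d div q) else {0})) (inv_space a d)"
    using inv_space_bij[OF assms, of d] by blast
  let ?A = "if q ^ (e a - a) - 1 \<le> d then inv_space a (d - (q ^ (e a - a) - 1)) else {0}"
    and ?B = "if q dvd d then inv_space (Suc a) (d div q) else {0}"
  have "card ?A = q ^ (if q ^ (e a - a) - 1 \<le> d then inv_dim a (d - (q ^ (e a - a) - 1)) else 0)"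
    "card ?B = q ^ (if q dvd d then inv_dim (Suc a) (d div q) else 0)"
    using assms by (auto simp: card_inv_space)
  moreover have "q ^ inv_dim a d = card ?A * card ?B"
    using bij_betw_same_card[OF \<phi>] assms
      by (simp only: card_inv_space card_cartesian_product less_imp_le)
  ultimately have "q ^ inv_dim a d =
      q ^ ((if q ^ (e a - a) - 1 \<le> d then inv_dim a (d - (q ^ (e a - a) - 1)) else 0) +
    (if q dvd d then inv_dim (Suc a) (d div q) else 0))"
    by (simp only: power_add)
  then show ?thesis using power_inject_exp[OF q_gt_1] by blast
qed

definition inv_series :: "nat \<Rightarrow> 'c::idom fps" where
  "inv_series a = Abs_fps (\<lambda>d. of_nat (inv_dim a d))"

text \<open>The factor on the left accounts for multiplication by the kernel generator; on the
  right, taking q-th powers multiplies degrees by \<open>q\<close>, which is the substitution of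
  \<open>X^q\<close>.\<close>

lemma inv_series_rec:
  assumes "a < n"
  shows "inv_series a * (1 - fps_X ^ (q ^ (e a - a) - 1)) =
      (inv_series (Suc a) oo fps_X ^ q :: 'c::idom fps)"
proof (rule fps_ext)
  fix d
  let ?\<delta> = "q ^ (e a - a) - 1"
  have "fps_nth (inv_series a * (1 - fps_X ^ ?\<delta>)) d =
      (of_nat (inv_dim a d) - (if d < ?\<delta> then 0 else of_nat (inv_dim a (d - ?\<delta>))) :: 'c)"
    by (simp only: right_diff_distrib mult_1_right fps_sub_nth fps_X_power_mult_right_nth inv_series_def
        fps_nth_Abs_fps)
  also have "\<dots> = (if q dvd d then of_nat (inv_dim (Suc a) (d div q)) else 0)"
    by (subst inv_dim_rec[OF assms]) (auto simp: not_less)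
  also have "\<dots> = fps_nth (inv_series (Suc a) oo fps_X ^ q) d"
    using q_pos by (simp add: fps_nth_compose_X_power inv_series_def)
  finally show "fps_nth (inv_series a * (1 - fps_X ^ ?\<delta>)) d =
      fps_nth (inv_series (Suc a) oo fps_X ^ q :: 'c fps) d" .
qed

text \<open>Downward induction on \<open>a\<close>: substituting \<open>X^q\<close> multiplies the
  exponents for \<open>Suc a\<close> by \<open>q\<close>, which yields those for \<open>a\<close>,
  and the recursion adds the factor for \<open>b = a\<close>.\<close>

theorem inv_series_product:
  assumes "a \<le> n"
  shows "inv_series a * (\<Prod>b = a..<n. 1 - fps_X ^ (q ^ (e b - a) - q ^ (b - a))) =
      (1 :: 'c::idom fps)"
  using assms
proof (induction a rule: inc_induct)
  case base
  show ?case by (rule fps_ext) (simp add: inv_series_def inv_dim_n)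
next
  case (step a)
  then have a: "a < n" by simp
  let ?P = "\<Prod>b = Suc a..<n. 1 - fps_X ^ (q ^ (e b - Suc a) - q ^ (b - Suc a)) :: 'c fps"
  have X0: "fps_nth (fps_X ^ q :: 'c fps) 0 = 0" using q_pos by simp
  have "?P oo fps_X ^ q = (\<Prod>b = Suc a..<n. 1 - fps_X ^ (q ^ (e b - a) - q ^ (b - a)))"
    unfolding fps_compose_prod_distrib[OF X0]
  proof (rule prod.cong[OF refl])
    fix b assume b: "b \<in> {Suc a..<n}"
    then have "q * (q ^ (e b - Suc a) - q ^ (b - Suc a)) = q ^ (e b - a) - q ^ (b - a)"
      using e_gt[of b] by (simp add: diff_mult_distrib2 Suc_diff_Suc flip: power_Suc)
    then show "(1 - fps_X ^ (q ^ (e b - Suc a) - q ^ (b - Suc a))) oo fps_X ^ q =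
        (1 - fps_X ^ (q ^ (e b - a) - q ^ (b - a)) :: 'c fps)"
      by (simp add: fps_compose_sub_distrib fps_X_power_compose[OF X0] flip: power_mult)
  qed
  moreover have "(inv_series (Suc a) * ?P) oo fps_X ^ q = 1"
    unfolding step.IH by simp
  ultimately have "inv_series a * (1 - fps_X ^ (q ^ (e a - a) - 1)) *
      (\<Prod>b = Suc a..<n. 1 - fps_X ^ (q ^ (e b - a) - q ^ (b - a))) = (1 :: 'c fps)"
    unfolding inv_series_rec[OF a] by (simp add: fps_compose_mult_distrib[OF X0])
  then show ?case using a by (simp add: prod.atLeast_Suc_lessThan mult.assoc)
qed

end

section \<open>Counting invariant forms\<close>

context flag_group
begin

lemma card_forms_power:
  "card (forms k d) = q ^ (\<Sum>S\<in>ksets k. if omega_deg S \<le> d then inv_dim 0 (d - omega_deg S) else 0)"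
proof -
  have "card (coeff_space d S) = q ^ (if omega_deg S \<le> d then inv_dim 0 (d - omega_deg S) else 0)"
    if "S \<in> ksets k" for S
  proof -
    have "(\<Sum>s\<in>S. q ^ s) \<le> q ^ end_of S - 1" using sum_le_end_of[of S] that by (simp add: ksets_def)
    then have "q ^ end_of S - 1 \<le> d + (\<Sum>s\<in>S. q ^ s) \<longleftrightarrow> omega_deg S \<le> d"
      "omega_deg S \<le> d \<Longrightarrow> d + (\<Sum>s\<in>S. q ^ s) - (q ^ end_of S - 1) = d - omega_deg S"
      unfolding omega_deg_def by linarith+
    then show ?thesis by (simp add: coeff_space_def card_inv_space)
  qed
  then show ?thesis by (simp add: card_forms power_sum)
qed

lemma finite_forms: "finite (forms k d)"
proof (rule ccontr)
  assume "infinite (forms k d)"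
  then have "card (forms k d) = 0" by (rule card.infinite)
  then show False unfolding card_forms_power using q_pos by simp
qed

end

section \<open>Parabolic subgroups as flag stabilisers\<close>

definition coef :: "'k::field sym_ext \<Rightarrow> nat set \<Rightarrow> 'k sym_alg" where
  "coef u J = Poly_Mapping.map_key (\<lambda>a. (a, J)) u"

lemma lookup_coef [simp]: "lookup (coef u J) a = lookup u (a, J)"
  by (simp add: coef_def Poly_Mapping.map_key.rep_eq inj_def)

lemma keys_coef: "a \<in> keys (coef u J) \<longleftrightarrow> (a, J) \<in> keys u"
  by (simp add: in_keys_iff)

lemma coef_inject: "coef u = coef v \<Longrightarrow> u = v"
proof (rule poly_mapping_eqI)
  fix x assume "coef u = coef v"
  then have "lookup (coef u (snd x)) (fst x) = lookup (coef v (snd x)) (fst x)" by simp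
  then show "lookup u x = lookup v x" by simp
qed

lemma coef_surj:
  assumes "finite {J. w J \<noteq> 0}" shows "\<exists>u. coef u = w"
proof -
  let ?F = "{J. w J \<noteq> 0}"
  define u where "u = (\<Sum>J\<in>?F. \<Sum>a\<in>keys (w J). single (a, J) (lookup (w J) a))"
  have "lookup u (b, K) = lookup (w K) b" for b K
  proof -
    have "lookup u (b, K) = (\<Sum>J\<in>?F. if J = K then lookup (w K) b else 0)"
      unfolding u_def lookup_sum
    proof (rule sum.cong[OF refl])
      fix J
      have "(\<Sum>a\<in>keys (w J). lookup (single (a, J) (lookup (w J) a)) (b, K)) =
          (\<Sum>a\<in>keys (w J). if a = b then (if J = K then lookup (w J) b else 0) else 0)"
        by (rule sum.cong) (auto simp: lookup_single when_def)
      then show "(\<Sum>a\<in>keys (w J). lookup (single (a, J) (lookup (w J) a)) (b, K)) =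
          (if J = K then lookup (w K) b else 0)"
        by (auto simp: in_keys_iff)
    qed
    then show ?thesis using assms by simp
  qed
  then have "coef u K = w K" for K by (intro poly_mapping_eqI) simp
  then show ?thesis by blast
qed

lemma lookup_tensor: "lookup (tensor f w) (a, J) = lookup f a * lookup w J"
proof -
  have "lookup (tensor f w) (a, J) = (\<Sum>b\<in>keys f. \<Sum>K\<in>keys w.
      if K = J then (if b = a then lookup f b * lookup w K else 0) else 0)"
    unfolding tensor_def lookup_sum by (intro sum.cong refl) (auto simp: lookup_single when_def)
  also have "\<dots> = lookup f a * lookup w J"
    by (cases "lookup w J = 0") (auto simp: in_keys_iff)
  finally show ?thesis .
qed

lemma lookup_wedge_linear:
  assumes "finite K"
  shows "lookup (wedge (\<Sum>k<n. scale (c k) (ext_var k)) v) K =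
    (\<Sum>k\<in>{..<n} \<inter> K. c k * ext_sign k K * lookup v (K - {k}))"
proof -
  let ?u = "\<Sum>k<n. scale (c k) (ext_var k)"
  have lu: "lookup ?u J = (\<Sum>k<n. if J = {k} then c k else 0)" for J
    by (auto simp: lookup_sum lookup_scale ext_var_def lookup_single when_def intro!: sum.cong)
  have lu1: "lookup ?u {k} = c k" if "k < n" for k using that by (simp add: lu)
  have sub: "keys ?u \<subseteq> (\<lambda>k. {k}) ` {..<n}"
  proof
    fix J assume "J \<in> keys ?u"
    then have "(\<Sum>k<n. if J = {k} then c k else 0) \<noteq> 0" by (simp add: in_keys_iff lu)
    from sum.not_neutral_contains_not_neutral[OF this]
    obtain k where "k < n" "J = {k}" by (metis lessThan_iff)
    then show "J \<in> (\<lambda>k. {k}) ` {..<n}" by simp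
  qed
  define T where "T J = (\<Sum>L\<in>keys v. lookup (single (J \<union> L) (wedge_sign J L * lookup ?u J * lookup v L)) K)" for J
  have "lookup (wedge ?u v) K = (\<Sum>J\<in>keys ?u. T J)"
    by (simp add: wedge_def lookup_sum T_def)
  also have "\<dots> = (\<Sum>J\<in>(\<lambda>k. {k}) ` {..<n}. T J)"
    using sub by (intro sum.mono_neutral_left) (auto simp: T_def in_keys_iff)
  also have "\<dots> = (\<Sum>k<n. T {k})" by (subst sum.reindex) auto
  also have "\<dots> = (\<Sum>k<n. if k \<in> K then c k * ext_sign k K * lookup v (K - {k}) else 0)"
  proof (rule sum.cong[OF refl])
    fix k assume "k \<in> {..<n}"
    then have k: "k < n" by simp
    have "T {k} = (\<Sum>L\<in>keys v. if L = K - {k} then (if k \<in> K then c k * ext_sign k K * lookup v L else 0) else 0)"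
      unfolding T_def
    proof (rule sum.cong[OF refl])
      fix L
      have sgn: "wedge_sign {k} (K - {k}) = (ext_sign k K :: 'a)"
      proof -
        have "{(j, i). j \<in> {k} \<and> i \<in> K - {k} \<and> i < j} = (\<lambda>i. (k, i)) ` {i \<in> K. i < k}" by auto
        then have "card {(j, i). j \<in> {k} \<and> i \<in> K - {k} \<and> i < j} = card {i \<in> K. i < k}"
          by (simp add: card_image inj_on_def)
        then show ?thesis by (simp add: wedge_sign_def ext_sign_def)
      qed
      show "lookup (single ({k} \<union> L) (wedge_sign {k} L * lookup ?u {k} * lookup v L)) K =
          (if L = K - {k} then (if k \<in> K then c k * ext_sign k K * lookup v L else 0) else 0)"
      proof (cases "k \<in> L")
        case True
        then show ?thesis by (auto simp: wedge_sign_def)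
      next
        case False
        then have "{k} \<union> L = K \<longleftrightarrow> L = K - {k} \<and> k \<in> K" by auto
        then show ?thesis using sgn lu1[OF k] by (auto simp: lookup_single when_def mult_ac)
      qed
    qed
    then show "T {k} = (if k \<in> K then c k * ext_sign k K * lookup v (K - {k}) else 0)"
      by (auto simp: in_keys_iff)
  qed
  also have "\<dots> = (\<Sum>k\<in>{..<n} \<inter> K. c k * ext_sign k K * lookup v (K - {k}))"
    by (rule sum.inter_restrict[symmetric]) simp
  finally show ?thesis .
qed

lemma cst_ext_sign: "cst (ext_sign k K :: 'k::field) = (ext_sign k K :: 'k sym_alg)"
  unfolding ext_sign_def cst_power[symmetric] by (simp add: single_uminus)

lemma cst_sum: "cst (sum f A :: 'k::field) = (\<Sum>a\<in>A. cst (f a))"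
  by (induction A rule: infinite_finite_induct) (auto simp: single_add)

lemma cst_mult: "cst (a * b) = cst a * cst (b :: 'k::field)"
  by (simp add: mult_single)

text \<open>Completed by identity entries outside the matrix range, so that \<open>elem_mat\<close>
  is exactly the function of a matrix and no entry is unspecified.\<close>

definition mat_fun :: "nat \<Rightarrow> 'k::field mat \<Rightarrow> nat \<Rightarrow> nat \<Rightarrow> 'k" where
  "mat_fun n g k j = (if k < n \<and> j < n then g $$ (k, j) else if k = j then 1 else 0)"

lemma ext_act_support:
  assumes "K \<in> keys (ext_act n g (single J (1 :: 'k::field)))" shows "K \<subseteq> {..<n}"
proof -
  have *: "K \<subseteq> {..<n}" if "K \<in> keys (wedge_list (map (\<lambda>j. \<Sum>k<n. scale (g $$ (k, j)) (ext_var k)) js))"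
    for js and K :: "nat set"
    using that
  proof (induction js arbitrary: K)
    case Nil
    then show ?case by (simp add: wedge_list_def ext_one_def)
  next
    case (Cons j js)
    let ?u = "\<Sum>k<n. scale (g $$ (k, j)) (ext_var k)"
      and ?v = "wedge_list (map (\<lambda>j. \<Sum>k<n. scale (g $$ (k, j)) (ext_var k)) js)"
    have "K \<in> keys (wedge ?u ?v)" using Cons.prems by (simp add: wedge_list_def)
    then have "(\<Sum>J\<in>keys ?u. \<Sum>L\<in>keys ?v. lookup (single (J \<union> L) (wedge_sign J L * lookup ?u J * lookup ?v L)) K) \<noteq> 0"
      by (simp add: wedge_def lookup_sum in_keys_iff)
    from sum.not_neutral_contains_not_neutral[OF this] obtain J where J: "J \<in> keys ?u"
      "(\<Sum>L\<in>keys ?v. lookup (single (J \<union> L) (wedge_sign J L * lookup ?u J * lookup ?v L)) K) \<noteq> 0"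
        by blast
    from sum.not_neutral_contains_not_neutral[OF J(2)] obtain L where L: "L \<in> keys ?v"
      "lookup (single (J \<union> L) (wedge_sign J L * lookup ?u J * lookup ?v L)) K \<noteq> 0" by blast
    have K: "K = J \<union> L" by (rule ccontr) (use L(2) in \<open>simp add: lookup_single when_def\<close>)
    have "(\<Sum>k<n. lookup (scale (g $$ (k, j)) (ext_var k)) J) \<noteq> 0"
      using J(1) by (simp add: in_keys_iff lookup_sum)
    from sum.not_neutral_contains_not_neutral[OF this] obtain k where k: "k < n"
      "lookup (scale (g $$ (k, j)) (ext_var k)) J \<noteq> 0" by blast
    then have "J = {k}" by (metis ext_var_def lookup_scale lookup_single_not_eq mult_zero_right)
    then show ?case using K k(1) Cons.IH[OF L(1)] by simp
  qed
  have eq: "ext_act n g (single J (1 :: 'k)) =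
      wedge_list (map (\<lambda>j. \<Sum>k<n. scale (g $$ (k, j)) (ext_var k)) (sorted_list_of_set J))"
    by (simp add: ext_act_def)
  show ?thesis using assms unfolding eq by (rule *)
qed

lemma ext_act_conv_ext_image:
  assumes "J \<subseteq> {..<n}"
  shows "cst (lookup (ext_act n g (single J 1)) K) = ext_image n (mat_fun n g) J K"
proof -
  have "cst (lookup (wedge_list (map (\<lambda>j. \<Sum>k<n. scale (g $$ (k, j)) (ext_var k)) js)) K) =
      foldr (\<lambda>j. ext_mult n (\<lambda>k. cst (mat_fun n g k j))) js (\<lambda>K. if K = {} then 1 else 0) K"
    if "set js \<subseteq> {..<n}" "finite K" for js K
    using that
  proof (induction js arbitrary: K)
    case Nil
    then show ?case by (simp add: wedge_list_def ext_one_def lookup_single when_def)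
  next
    case (Cons j js)
    let ?v = "wedge_list (map (\<lambda>j. \<Sum>k<n. scale (g $$ (k, j)) (ext_var k)) js)"
    have "cst (lookup (wedge_list (map (\<lambda>j. \<Sum>k<n. scale (g $$ (k, j)) (ext_var k)) (j # js))) K) =
        (\<Sum>k\<in>{..<n} \<inter> K. cst (g $$ (k, j)) * ext_sign k K * cst (lookup ?v (K - {k})))"
      using lookup_wedge_linear[OF Cons.prems(2), of "\<lambda>k. g $$ (k, j)" n ?v]
      by (simp add: wedge_list_def cst_sum cst_mult cst_ext_sign)
    then show ?case
      using Cons by (simp add: ext_mult_def mat_fun_def)
  qed
  note * = this
  have finJ: "finite J" using assms finite_subset by blast
  show ?thesis
  proof (cases "K \<subseteq> {..<n}")
    case True
    then have "finite K" using finite_subset by blast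
    from *[of "sorted_list_of_set J", OF _ this] show ?thesis
      using assms finJ by (simp add: ext_act_def ext_image_def lookup_scale)
  next
    case False
    have "lookup (ext_act n g (single J 1)) K = 0" using ext_act_support False
      by (metis in_keys_iff)
    moreover have "ext_image n (mat_fun n g) J K = 0"
      using ext_image_support[OF finJ, of n "mat_fun n g" K UNIV] False by blast
    ultimately show ?thesis by simp
  qed
qed

lemma sym_act_conv_msubst:
  assumes "keys a \<subseteq> {..<n}"
  shows "sym_act n g (single a (1 :: 'k::field)) = msubst (lin_subst n (mat_fun n g)) a"
proof -
  have "msubst (lin_subst n (mat_fun n g)) a = (\<Prod>j<n. lin_subst n (mat_fun n g) j ^ lookup a j)"
    using assms by (intro msubst_superset) auto
  also have "\<dots> = (\<Prod>j<n. (\<Sum>k<n. scale (g $$ (k, j)) (sym_var k)) ^ lookup a j)"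
    by (rule prod.cong[OF refl]) (auto simp: lin_subst_def mat_fun_def scale_conv_mult)
  finally show ?thesis by (simp add: sym_act_def)
qed

lemma lookup_mult_cst: "lookup (f * cst c) a = c * lookup f a" for f :: "'k::field sym_alg"
  by (metis lookup_scale mult.commute scale_conv_mult)

lemma form_act_outside:
  assumes "\<not> K \<subseteq> {..<n}" shows "form_act n g w K = 0"
  unfolding form_act_def
proof (rule sum.neutral, rule ballI)
  fix J assume "J \<in> Pow {..<n}"
  then have "finite J" using finite_subset by auto
  then have "ext_image n g J K = 0" using ext_image_support[of J n g K UNIV] assms by blast
  then show "psubst (lin_subst n g) (w J) * ext_image n g J K = 0" by simp
qed

text \<open>The support condition reconciles the two encodings: \<open>sym_act\<close> ignores
  exponents of variables from \<open>n\<close> on, whereas \<open>lin_subst\<close> fixes these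
  variables.\<close>

lemma coef_diag_act:
  assumes "\<And>a J. (a, J) \<in> keys u \<Longrightarrow> keys a \<subseteq> {..<n} \<and> J \<subseteq> {..<n}"
  shows "coef (diag_act n g u) K = form_act n (mat_fun n g) (coef u) K"
proof (rule poly_mapping_eqI)
  fix a
  let ?E = "\<lambda>J. lookup (ext_act n g (single J 1)) K" and ?\<sigma> = "lin_subst n (mat_fun n g)"
  have keys: "keys u = (\<lambda>(J, b). (b, J)) ` Sigma (Pow {..<n}) (\<lambda>J. keys (coef u J))"
    using assms by (auto simp: keys_coef image_iff)
  have "lookup (diag_act n g u) (a, K) =
      (\<Sum>(b, J)\<in>keys u. lookup u (b, J) * (lookup (msubst ?\<sigma> b) a * ?E J))"
    unfolding diag_act_def lookup_sum
  proof (rule sum.cong[OF refl], clarify)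
    fix b J assume "(b, J) \<in> keys u"
    then have "sym_act n g (single b (1 :: 'a)) = msubst ?\<sigma> b" using assms sym_act_conv_msubst
      by blast
    then show "lookup (scale (lookup u (b, J)) (tensor (sym_act n g (single b 1)) (ext_act n g (single J 1)))) (a, K) =
        lookup u (b, J) * (lookup (msubst ?\<sigma> b) a * ?E J)"
      by (simp add: lookup_scale lookup_tensor)
  qed
  also have "\<dots> = (\<Sum>(J, b)\<in>Sigma (Pow {..<n}) (\<lambda>J. keys (coef u J)). lookup u (b, J) * (lookup (msubst ?\<sigma> b) a * ?E J))"
    unfolding keys by (subst sum.reindex) (auto simp: inj_on_def split_def)
  also have "\<dots> = (\<Sum>J\<in>Pow {..<n}. \<Sum>b\<in>keys (coef u J). lookup u (b, J) * (lookup (msubst ?\<sigma> b) a * ?E J))"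
    by (rule sum.Sigma[symmetric]) auto
  also have "\<dots> = (\<Sum>J\<in>Pow {..<n}. lookup (psubst ?\<sigma> (coef u J) * cst (?E J)) a)"
  proof (rule sum.cong[OF refl])
    fix J
    have "lookup (psubst ?\<sigma> (coef u J)) a =
        (\<Sum>b\<in>keys (coef u J). lookup u (b, J) * lookup (msubst ?\<sigma> b) a)"
      unfolding psubst_def lookup_sum
      by (rule sum.cong[OF refl]) (simp add: lookup_scale flip: scale_conv_mult)
    then show "(\<Sum>b\<in>keys (coef u J). lookup u (b, J) * (lookup (msubst ?\<sigma> b) a * ?E J)) =
        lookup (psubst ?\<sigma> (coef u J) * cst (?E J)) a"
      by (simp add: lookup_mult_cst sum_distrib_left mult_ac)
  qed
  also have "\<dots> = lookup (form_act n (mat_fun n g) (coef u) K) a"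
    unfolding form_act_def lookup_sum
    by (rule sum.cong[OF refl]) (simp add: ext_act_conv_ext_image)
  finally show "lookup (coef (diag_act n g u) K) a = lookup (form_act n (mat_fun n g) (coef u) K) a"
    by simp
qed

text \<open>The inverse clears column \<open>b\<close> with the pivot \<open>d b\<close>. The case
  \<open>N \<le> b\<close> is for diagonal blocks that do not meet column \<open>b\<close>, where
  the matrix is the identity.\<close>

lemma mat_elem_mat_mult:
  fixes d :: "nat \<Rightarrow> 'k::field"
  assumes "N \<le> b \<or> d b \<noteq> 0"
  shows "mat N N (\<lambda>(k, j). elem_mat b d k j) * mat N N (\<lambda>(k, j). elem_mat b (\<lambda>k. if k = b then 1 / d b else - d k / d b) k j) = 1\<^sub>m N"
    (is "?A * ?B = _")
proof (rule eq_matI)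
  fix k j assume "k < dim_row (1\<^sub>m N :: 'k mat)" "j < dim_col (1\<^sub>m N :: 'k mat)"
  then have kj: "k < N" "j < N" by simp_all
  let ?d = "\<lambda>k. if k = b then 1 / d b else - d k / d b"
  have "(?A * ?B) $$ (k, j) = (\<Sum>l = 0..<N. elem_mat b d k l * elem_mat b ?d l j)"
    using kj by (simp add: scalar_prod_def)
  also have "\<dots> = (if k = j then 1 else 0)"
  proof (cases "j = b")
    case False
    then have "(\<Sum>l = 0..<N. elem_mat b d k l * elem_mat b ?d l j) =
        (\<Sum>l = 0..<N. if l = j then elem_mat b d k j else 0)"
      by (intro sum.cong) (auto simp: elem_mat_def)
    then show ?thesis using False kj by (simp add: elem_mat_def)
  next
    case True
    then have db: "d b \<noteq> 0" using kj assms by auto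
    have "(\<Sum>l = 0..<N. elem_mat b d k l * elem_mat b ?d l j) =
        (\<Sum>l = 0..<N. (if l = b then d k / d b else 0) + (if l = k then (if k = b then 0 else - d k / d b) else 0))"
      by (rule sum.cong) (use True in \<open>auto simp: elem_mat_def\<close>)
    then show ?thesis using True kj db by (simp add: sum.distrib)
  qed
  finally show "(?A * ?B) $$ (k, j) = 1\<^sub>m N $$ (k, j)" using kj by simp
qed simp_all

lemma invertible_elem_mat:
  fixes d :: "nat \<Rightarrow> 'k::field"
  assumes "N \<le> b \<or> d b \<noteq> 0"
  shows "invertible_mat (mat N N (\<lambda>(k, j). elem_mat b d k j))"
proof -
  let ?A = "mat N N (\<lambda>(k, j). elem_mat b d k j)"
  define d' where "d' = (\<lambda>k. if k = b then 1 / d b else - d k / d b)"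
  let ?B = "mat N N (\<lambda>(k, j). elem_mat b d' k j)"
  have AB: "?A * ?B = 1\<^sub>m N" unfolding d'_def
    by (rule mat_elem_mat_mult[where b = b and d = d, OF assms])
  have "N \<le> b \<or> d' b \<noteq> 0" using assms by (auto simp: d'_def)
  from mat_elem_mat_mult[where b = b and d = d', OF this] have BA':
    "?B * mat N N (\<lambda>(k, j). elem_mat b (\<lambda>k. if k = b then 1 / d' b else - d' k / d' b) k j) =
    1\<^sub>m N" .
  \<comment> \<open>The formula for the inverse is an involution, so the right inverse of
    \<open>?B\<close> is \<open>?A\<close> and the inverse is two-sided.\<close>
  have "mat N N (\<lambda>(k, j). elem_mat b (\<lambda>k. if k = b then 1 / d' b else - d' k / d' b) k j) = ?A"
    by (rule eq_matI) (use assms in \<open>auto simp: elem_mat_def d'_def\<close>)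
  then have "?B * ?A = 1\<^sub>m N" using BA' by simp
  then show ?thesis using AB
    by (auto simp: invertible_mat_def inverts_mat_def square_mat.simps intro!: exI[of _ ?B])
qed

text \<open>Blocks are counted from 1 here, since \<open>partial_sum I 0 = 0\<close> is never above
  \<open>b\<close>; hence the subtraction of 1 in \<open>block_start\<close>.\<close>

definition block_index :: "nat list \<Rightarrow> nat \<Rightarrow> nat" where
  "block_index I b = (LEAST i. b < partial_sum I i)"

definition block_end :: "nat list \<Rightarrow> nat \<Rightarrow> nat" where
  "block_end I b = partial_sum I (block_index I b)"

definition block_start :: "nat list \<Rightarrow> nat \<Rightarrow> nat" where
  "block_start I b = partial_sum I (block_index I b - 1)"

section \<open>Blocks of a composition\<close>

lemma partial_sum_0 [simp]: "partial_sum I 0 = 0"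
  by (simp add: partial_sum_def)

lemma partial_sum_Suc: "i < length I \<Longrightarrow> partial_sum I (Suc i) = partial_sum I i + I ! i"
  by (simp add: partial_sum_def take_Suc_conv_app_nth)

lemma partial_sum_length [simp]: "partial_sum I (length I) = sum_list I"
  by (simp add: partial_sum_def)

lemma partial_sum_mono: "i \<le> j \<Longrightarrow> partial_sum I i \<le> partial_sum I j"
proof (induction rule: dec_induct)
  case (step j)
  have "partial_sum I j \<le> partial_sum I (Suc j)"
  proof (cases "j < length I")
    case True
    then show ?thesis by (simp add: partial_sum_Suc)
  next
    case False
    then show ?thesis by (simp add: partial_sum_def)
  qed
  then show ?case using step by simp
qed simp

lemma partial_sum_le: "partial_sum I i \<le> sum_list I"
  using partial_sum_mono[of i "max i (length I)" I]
    by (simp add: partial_sum_def max_def split: if_splits)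

lemma block_index:
  assumes "b < sum_list I"
  shows "0 < block_index I b" "block_index I b \<le> length I" "b < block_end I b" "block_start I b \<le> b"
    "\<And>i. b < partial_sum I i \<Longrightarrow> block_end I b \<le> partial_sum I i"
proof -
  have ex: "b < partial_sum I (length I)" using assms by simp
  show lt: "b < block_end I b" unfolding block_end_def block_index_def using ex by (rule LeastI)
  show pos: "0 < block_index I b"
  proof (rule ccontr)
    assume "\<not> 0 < block_index I b"
    then show False using lt by (simp add: block_end_def)
  qed
  show "block_index I b \<le> length I" unfolding block_index_def using ex by (rule Least_le)
  have "\<not> b < partial_sum I (block_index I b - 1)"
    using pos not_less_Least[of "block_index I b - 1" "\<lambda>i. b < partial_sum I i"]
      by (simp add: block_index_def)
  then show "block_start I b \<le> b" by (simp add: block_start_def)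
  fix i assume "b < partial_sum I i"
  then have "block_index I b \<le> i" unfolding block_index_def by (rule Least_le)
  then show "block_end I b \<le> partial_sum I i" unfolding block_end_def by (rule partial_sum_mono)
qed

lemma block_index_unique:
  assumes "partial_sum I i \<le> c" "c < partial_sum I (Suc i)" shows "block_index I c = Suc i"
  unfolding block_index_def
proof (rule Least_equality)
  fix j assume j: "c < partial_sum I j"
  show "Suc i \<le> j"
  proof (rule ccontr)
    assume "\<not> Suc i \<le> j"
    then have "partial_sum I j \<le> partial_sum I i" by (intro partial_sum_mono) simp
    then show False using j assms by simp
  qed
qed (rule assms)

lemma block_index_same:
  assumes "b < sum_list I" "block_start I b \<le> c" "c < block_end I b"
  shows "block_start I c = block_start I b \<and> block_end I c = block_end I b"
proof -
  obtain i where i: "block_index I b = Suc i" using block_index(1)[OF assms(1)] gr0_conv_Suc by auto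
  then have "block_index I c = Suc i"
    using assms(2,3) by (intro block_index_unique) (auto simp: block_start_def block_end_def)
  then show ?thesis using i by (simp add: block_start_def block_end_def)
qed

lemma lin_subst_compose:
  fixes A B :: "'k::field mat"
  assumes "A \<in> carrier_mat n n" "B \<in> carrier_mat n n" "B * A = 1\<^sub>m n" "j < n"
  shows "psubst (lin_subst n (mat_fun n B)) (lin_subst n (mat_fun n A) j) = var j"
proof -
  have entry: "(\<Sum>k<n. A $$ (k, j) * B $$ (l, k)) = (if l = j then 1 else 0)" if "l < n" for l
  proof -
    have "(B * A) $$ (l, j) = (\<Sum>k = 0..<n. B $$ (l, k) * A $$ (k, j))"
      using assms(1,2,4) that by (simp add: scalar_prod_def)
    then show ?thesis using assms(3,4) that by (simp add: mult.commute atLeast0LessThan)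
  qed
  have "psubst (lin_subst n (mat_fun n B)) (lin_subst n (mat_fun n A) j) =
      (\<Sum>k<n. \<Sum>l<n. cst (A $$ (k, j) * B $$ (l, k)) * var l)"
    using assms(4) by (simp add: lin_subst_def mat_fun_def sum_distrib_left mult_single flip: mult.assoc)
  also have "\<dots> = (\<Sum>l<n. cst (\<Sum>k<n. A $$ (k, j) * B $$ (l, k)) * var l)"
    by (subst sum.swap) (simp add: cst_sum sum_distrib_right)
  also have "\<dots> = (\<Sum>l<n. if l = j then var l else 0)"
    by (rule sum.cong) (auto simp: entry)
  finally show ?thesis using assms(4) by simp
qed

locale parabolic_field = coeff_field q ground
  for q and ground :: "'k::{field, finite} itself" +
  fixes I :: "nat list" and n :: nat
  assumes n_def: "n = sum_list I"

sublocale parabolic_field \<subseteq> flag_group q ground n "block_start I" "block_end I"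
  "mat_fun n ` (parabolic I :: 'k mat set)"
proof unfold_locales
  fix b assume b: "b < n"
  then have b': "b < sum_list I" by (simp add: n_def)
  show "block_start I b \<le> b" "b < block_end I b" using block_index[OF b'] by auto
  show "block_end I b \<le> n" unfolding block_end_def n_def by (rule partial_sum_le)
  show "block_start I c = block_start I b \<and> block_end I c = block_end I b"
    if "block_start I b \<le> c" "c < block_end I b" for c
    using block_index_same[OF b'] that by blast
  fix d :: "nat \<Rightarrow> 'k" assume d: "d b \<noteq> 0" "\<And>k. block_end I b \<le> k \<Longrightarrow> d k = 0"
  define A where "A = mat n n (\<lambda>(k, j). elem_mat b d k j)"
  have "block_end I b \<le> n" unfolding block_end_def n_def by (rule partial_sum_le)
  then have "mat_fun n A = elem_mat b d"
    using b d(2) by (auto simp: fun_eq_iff mat_fun_def A_def elem_mat_def)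
  moreover have "A \<in> parabolic I"
    unfolding parabolic_def
  proof (intro CollectI conjI allI impI)
    show "A \<in> general_linear (sum_list I)"
      unfolding general_linear_def A_def n_def[symmetric] using invertible_elem_mat[of n b d] d(1)
        by auto
  next
    fix i a c assume *: "i \<le> length I" "a < sum_list I" "c < partial_sum I i" "partial_sum I i \<le> a"
    have "c < n" using *(3) partial_sum_le[of I i] by (simp add: n_def)
    moreover have "d a = 0" if "c = b" using that * block_index(5)[OF b', of i] by (intro d(2)) auto
    ultimately show "A $$ (a, c) = 0" using * by (auto simp: A_def elem_mat_def n_def)
  next
    fix i assume i: "i < length I"
    let ?N = "I ! i" and ?s = "partial_sum I i"
    \<comment> \<open>The position of column \<open>b\<close> inside block \<open>i\<close>, or
      \<open>?N\<close>, just outside it, when the block is the identity.\<close>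
    define b1 where "b1 = (if ?s \<le> b \<and> b < ?s + ?N then b - ?s else ?N)"
    define d1 where "d1 = (\<lambda>k. d (?s + k))"
    have sn: "?s + ?N \<le> n" using partial_sum_le[of I "Suc i"] i by (simp add: partial_sum_Suc n_def)
    have "mat ?N ?N (\<lambda>(a, c). A $$ (?s + a, ?s + c)) = mat ?N ?N (\<lambda>(k, j). elem_mat b1 d1 k j)"
      by (rule eq_matI) (use sn in \<open>auto simp: A_def elem_mat_def b1_def d1_def\<close>)
    moreover have "?N \<le> b1 \<or> d1 b1 \<noteq> 0" using d(1) by (auto simp: b1_def d1_def)
    ultimately show "invertible_mat (mat ?N ?N (\<lambda>(a, c). A $$ (?s + a, ?s + c)))"
      using invertible_elem_mat[of ?N b1 d1] by simp
  qed
  ultimately show "elem_mat b d \<in> mat_fun n ` parabolic I" by (metis imageI)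
next
  fix h :: "nat \<Rightarrow> nat \<Rightarrow> 'k" and j k assume "h \<in> mat_fun n ` parabolic I" and j: "j < n"
    "block_end I j \<le> k" "k < n"
  then obtain g where g: "g \<in> parabolic I" "h = mat_fun n g" by blast
  have j': "j < sum_list I" using j by (simp add: n_def)
  have "g $$ (k, j) = 0"
    using g(1) block_index(2,3)[OF j'] j unfolding parabolic_def block_end_def n_def by blast
  then show "h k j = 0" using j g by (simp add: mat_fun_def)
next
  fix h :: "nat \<Rightarrow> nat \<Rightarrow> 'k" assume "h \<in> mat_fun n ` parabolic I"
  then obtain g where g: "g \<in> carrier_mat n n" "invertible_mat g" "h = mat_fun n g"
    by (auto simp: parabolic_def general_linear_def n_def)
  then obtain B where B: "g * B = 1\<^sub>m n" "B * g = 1\<^sub>m (dim_row B)"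
    by (auto simp: invertible_mat_def inverts_mat_def)
  have "dim_col B = n" using arg_cong[OF B(1), of dim_col] by simp
  moreover have "dim_row B = n" using arg_cong[OF B(2), of dim_col] g(1) by simp
  ultimately have Bc: "B \<in> carrier_mat n n" by auto
  show "inj_on (psubst (lin_subst n h)) (V 0 n)"
  proof (rule inj_on_inverseI)
    fix v assume v: "v \<in> V 0 n"
    have "psubst (lin_subst n (mat_fun n B)) (psubst (lin_subst n h) v) = psubst var v"
      unfolding psubst_psubst
      by (rule psubst_V[OF v]) (use lin_subst_compose[OF g(1) Bc] B(2) Bc g(3) in auto)
    then show "psubst (lin_subst n (mat_fun n B)) (psubst (lin_subst n h) v) = v" by simp
  qed
qed

lemma (in parabolic_field) parabolic_invariants_bij:
  "bij_betw coef (parabolic_invariants I i k :: 'k sym_ext set) (forms k i)"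
proof -
  have graded: "u \<in> bigraded n i k \<longleftrightarrow>
      is_form k (coef u) \<and> homog_form i (coef u)" for u :: "'k sym_ext"
  proof
    assume u: "u \<in> bigraded n i k"
    have "is_form k (coef u)"
      unfolding is_form_def
    proof (intro allI impI)
      fix K assume "coef u K \<noteq> 0"
      then obtain a where "a \<in> keys (coef u K)" using keys_eq_empty[of "coef u K"] by blast
      then show "K \<subseteq> {..<n} \<and> card K = k" using u by (auto simp: bigraded_def keys_coef)
    qed
    moreover have "keys a \<subseteq> {..<n} \<and> monom_deg a = i" if "(a, J) \<in> keys u" for a J
      using u that by (auto simp: bigraded_def)
    ultimately show "is_form k (coef u) \<and> homog_form i (coef u)"
      by (simp add: homog_form_def homogeneous_def vars_in_def keys_coef atLeast0LessThan)
  next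
    assume w: "is_form k (coef u) \<and> homog_form i (coef u)"
    show "u \<in> bigraded n i k"
      unfolding bigraded_def
    proof (intro CollectI ballI, clarify)
      fix a J assume "(a, J) \<in> keys u"
      then have a: "a \<in> keys (coef u J)" by (simp add: keys_coef)
      then have "coef u J \<noteq> 0" by auto
      then show "keys a \<subseteq> {..<n} \<and> monom_deg a = i \<and> J \<subseteq> {..<n} \<and> card J = k"
        using w a by (auto simp: is_form_def homog_form_def homogeneous_def vars_in_def atLeast0LessThan)
    qed
  qed
  have fixed: "diag_act n g u = u \<longleftrightarrow> form_fixed n (mat_fun n g) (coef u)"
    if u: "u \<in> bigraded n i k" for g and u :: "'k sym_ext"
  proof -
    have key: "keys a \<subseteq> {..<n} \<and> J \<subseteq> {..<n}" if "(a, J) \<in> keys u" for a J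
      using u that by (auto simp: bigraded_def)
    have act: "coef (diag_act n g u) K = form_act n (mat_fun n g) (coef u) K" for K
      by (rule coef_diag_act[OF key])
    show ?thesis
    proof
      assume "diag_act n g u = u"
      then show "form_fixed n (mat_fun n g) (coef u)" using act by (simp add: form_fixed_def)
    next
      assume "form_fixed n (mat_fun n g) (coef u)"
      then have eq: "coef (diag_act n g u) K = coef u K" if "K \<subseteq> {..<n}" for K
        using act that by (simp add: form_fixed_def)
      have "coef (diag_act n g u) K = coef u K" for K
      proof (cases "K \<subseteq> {..<n}")
        case False
        then have "coef u K = 0" using u graded unfolding is_form_def by blast
        then show ?thesis using act form_act_outside[OF False] by simp
      qed (rule eq)
      then show "diag_act n g u = u" by (intro coef_inject) (simp add: fun_eq_iff)
    qed
  qed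
  show ?thesis
  proof (rule bij_betw_imageI)
    show "inj_on coef (parabolic_invariants I i k :: 'k sym_ext set)"
      using coef_inject by (auto simp: inj_on_def)
    show "coef ` (parabolic_invariants I i k :: 'k sym_ext set) = forms k i"
    proof (intro equalityI subsetI)
      fix w assume "w \<in> coef ` (parabolic_invariants I i k :: 'k sym_ext set)"
      then show "w \<in> forms k i"
        using graded fixed by (auto simp: forms_def parabolic_invariants_def simp flip: n_def)
    next
      fix w assume w: "w \<in> forms k i"
      have "{J. w J \<noteq> 0} \<subseteq> Pow {..<n}" using w by (auto simp: forms_def is_form_def)
      then have "finite {J. w J \<noteq> 0}" by (rule finite_subset) simp
      then obtain u where u: "coef u = w" using coef_surj by blast
      then have "u \<in> bigraded n i k" using graded w by (simp add: forms_def)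
      then have "u \<in> parabolic_invariants I i k"
        using fixed w u by (auto simp: parabolic_invariants_def forms_def simp flip: n_def)
      then show "w \<in> coef ` (parabolic_invariants I i k :: 'k sym_ext set)" using u by blast
    qed
  qed
qed

lemma prod_one_plus: "finite A \<Longrightarrow> (\<Prod>j\<in>A. 1 + f j) = (\<Sum>S\<in>Pow A. \<Prod>j\<in>S. f j :: 'a::comm_ring_1)"
  using prod_add[of A f "\<lambda>_. 1"] by (simp add: add.commute)

text \<open>Abel summation; it brings the numerator into the shape in which the products are
  weighted by differences of powers of \<open>t\<close>.\<close>

lemma sum_telescope_weights:
  fixes T E :: "nat \<Rightarrow> 'a::comm_ring_1"
  assumes "E 0 = 1" "l \<ge> 1"
  shows "1 + (\<Sum>i = 1..l. T i * (E i - E (i - 1))) =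
    1 - T 1 + (\<Sum>i = 1..l - 1. (T i - T (i + 1)) * E i) + T l * E l"
  using assms(2)
proof (induction l rule: dec_induct)
  case base
  then show ?case using assms(1) by (simp add: algebra_simps)
next
  case (step l)
  have "(\<Sum>i = 1..l. (T i - T (i + 1)) * E i) =
      (\<Sum>i = 1..l - 1. (T i - T (i + 1)) * E i) + (T l - T (l + 1)) * E l"
    using step(1) by (cases l) simp_all
  then show ?case using step by (simp add: algebra_simps)
qed

text \<open>Translation by 1 permutes the field, so the sum of all elements does not change when 1
  is added to each.\<close>

lemma of_nat_card_UNIV: "of_nat (card (UNIV :: 'k set)) = (0 :: 'k::{field, finite})"
proof -
  have "(\<Sum>x\<in>UNIV. x + 1) = (\<Sum>x\<in>UNIV. x :: 'k)"
    by (rule sum.reindex_bij_witness[of _ "\<lambda>x. x - 1" "\<lambda>x. x + 1"]) auto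
  then show ?thesis by (simp add: sum.distrib)
qed

lemma double_series_sum:
  assumes "finite F" "\<And>i j. d i j = (\<Sum>S\<in>{S\<in>F. card S = j}. a i S)"
  shows "double_series d = fps_to_fls (Abs_fps (\<lambda>i. \<Sum>S\<in>F. of_nat (a i S) * fls_X ^ card S))"
proof -
  have "fps_to_fls (Abs_fps (\<lambda>j. of_nat (d i j))) =
      (\<Sum>S\<in>F. of_nat (a i S) * fls_X ^ card S :: rat fls)" for i
  proof -
    have "Abs_fps (\<lambda>j. of_nat (d i j)) = (\<Sum>S\<in>F. of_nat (a i S) * fps_X ^ card S :: rat fps)"
    proof (rule fps_ext)
      fix j
      have "of_nat (d i j) = (\<Sum>S\<in>F. if card S = j then of_nat (a i S) else 0 :: rat)"
        using assms(1) by (simp add: assms(2) sum.If_cases Int_def conj_commute)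
      also have "\<dots> = fps_nth (\<Sum>S\<in>F. of_nat (a i S) * fps_X ^ card S) j"
        by (auto simp: fps_sum_nth fps_of_nat[symmetric] fps_X_power_nth intro!: sum.cong)
      finally show "fps_nth (Abs_fps (\<lambda>j. of_nat (d i j))) j =
          fps_nth (\<Sum>S\<in>F. of_nat (a i S) * fps_X ^ card S :: rat fps) j"
        by simp
    qed
    moreover have "fps_to_fls (\<Sum>S\<in>F. of_nat (a i S) * fps_X ^ card S) =
        (\<Sum>S\<in>F. of_nat (a i S) * fls_X ^ card S :: rat fls)"
      using assms(1)
      by (induction F) (simp_all add: fps_to_fls_power fls_times_fps_to_fls)
    ultimately show ?thesis by simp
  qed
  then show ?thesis by (simp add: double_series_def)
qed

section \<open>Assembling the rational function\<close>

context parabolic_field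
begin

lemma parabolic_invariants_iff: "u \<in> parabolic_invariants I i k \<longleftrightarrow>
    coef u \<in> forms k i" for u :: "'k sym_ext"
proof
  show "coef u \<in> forms k i" if "u \<in> parabolic_invariants I i k"
    using parabolic_invariants_bij that by (auto simp: bij_betw_def)
  assume "coef u \<in> forms k i"
  then obtain v where "v \<in> parabolic_invariants I i k" "coef u = coef v"
    using parabolic_invariants_bij[of i k] by (auto simp: bij_betw_def)
  then show "u \<in> parabolic_invariants I i k" using coef_inject by metis
qed

lemma forms_add: "w \<in> forms k d \<Longrightarrow> w' \<in> forms k d \<Longrightarrow> (\<lambda>K. w K + w' K) \<in> forms k d"
  using forms_sum[of "UNIV :: bool set" "\<lambda>b. if b then w else w'" k d]
    by (simp add: UNIV_bool add.commute)

lemma forms_scale: "w \<in> forms k d \<Longrightarrow> (\<lambda>K. cst c * w K) \<in> forms k d"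
  using homogeneous_mult[OF homogeneous_cst]
  by (fastforce simp: forms_def is_form_def homog_form_def form_fixed_def form_act_scale intro: vars_in_mult)

lemma parabolic_invariants_subspace: "scale.subspace (parabolic_invariants I i k :: 'k sym_ext set)"
proof (rule scale.subspaceI)
  have "coef (0 :: 'k sym_ext) = (\<lambda>_. 0)" by (intro ext poly_mapping_eqI) simp
  then show "(0 :: 'k sym_ext) \<in> parabolic_invariants I i k"
    using forms_sum[of "{}"] by (simp add: parabolic_invariants_iff)
next
  fix u v :: "'k sym_ext" assume *: "u \<in> parabolic_invariants I i k"
    "v \<in> parabolic_invariants I i k"
  have "coef (u + v) = (\<lambda>J. coef u J + coef v J)"
    by (intro ext poly_mapping_eqI) (simp add: lookup_add)
  then show "u + v \<in> parabolic_invariants I i k" using * forms_add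
    by (simp add: parabolic_invariants_iff)
next
  fix c and u :: "'k sym_ext" assume *: "u \<in> parabolic_invariants I i k"
  have "coef (scale c u) = (\<lambda>J. cst c * coef u J)"
    by (intro ext poly_mapping_eqI) (simp add: lookup_scale flip: scale_conv_mult)
  then show "scale c u \<in> parabolic_invariants I i k" using * forms_scale
    by (simp add: parabolic_invariants_iff)
qed

lemma dim_parabolic_invariants:
  "scale.dim (parabolic_invariants I i k :: 'k sym_ext set) =
    (\<Sum>S\<in>ksets k. if omega_deg S \<le> i then inv_dim 0 (i - omega_deg S) else 0)"
proof -
  let ?U = "parabolic_invariants I i k :: 'k sym_ext set"
  have fin: "finite ?U" using bij_betw_finite[OF parabolic_invariants_bij] finite_forms by blast
  have "q ^ scale.dim ?U = card (forms k i)"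
    using card_finite_subspace[OF parabolic_invariants_subspace fin] bij_betw_same_card[OF parabolic_invariants_bij]
    by (simp add: q_card)
  then show ?thesis unfolding card_forms_power using power_inject_exp[OF q_gt_1] by blast
qed

definition form_numerator :: "nat \<Rightarrow> bi_series" where
  "form_numerator m = (\<Sum>S\<in>Pow {..<m}. var_s ^ card S * var_t ^ omega_deg S)"

text \<open>Freeness in terms of series: the generator for \<open>S\<close> contributes
  \<open>s\<close> to the power \<open>card S\<close> and \<open>t\<close> to the power
  \<open>omega_deg S\<close>.\<close>

lemma hilbert_series_conv:
  "hilbert_series ground I = form_numerator n * fps_to_fls (inv_series 0)"
proof -
  define a where "a i S = (if omega_deg S \<le> i then inv_dim 0 (i - omega_deg S) else 0)" for i S
  let ?F = "Pow {..<n}"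
  have "hilbert_series ground I = fps_to_fls (Abs_fps (\<lambda>i. \<Sum>S\<in>?F. of_nat (a i S) * fls_X ^ card S))"
    unfolding hilbert_series_def
  proof (rule double_series_sum)
    fix i k
    have "{S \<in> ?F. card S = k} = ksets k" by (auto simp: ksets_def)
    then show "scale.dim (parabolic_invariants I i k :: 'k sym_ext set) =
        (\<Sum>S\<in>{S \<in> ?F. card S = k}. a i S)"
      by (simp add: dim_parabolic_invariants a_def)
  qed simp
  also have "Abs_fps (\<lambda>i. \<Sum>S\<in>?F. of_nat (a i S) * fls_X ^ card S :: rat fls) =
      (\<Sum>S\<in>?F. fps_const (fls_X ^ card S) * fps_X ^ omega_deg S) * inv_series 0"
  proof (rule fps_ext)
    fix i
    have "fps_nth ((\<Sum>S\<in>?F. fps_const (fls_X ^ card S :: rat fls) * fps_X ^ omega_deg S) * inv_series 0) i =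
        (\<Sum>S\<in>?F. fls_X ^ card S * fps_nth (fps_X ^ omega_deg S * inv_series 0) i)"
      by (simp add: sum_distrib_right fps_sum_nth mult.assoc)
    also have "\<dots> = (\<Sum>S\<in>?F. of_nat (a i S) * fls_X ^ card S)"
      by (rule sum.cong[OF refl])
        (simp add: fps_X_power_mult_nth inv_series_def a_def not_less mult.commute)
    finally show "fps_nth (Abs_fps (\<lambda>i. \<Sum>S\<in>?F. of_nat (a i S) * fls_X ^ card S :: rat fls)) i =
        fps_nth ((\<Sum>S\<in>?F. fps_const (fls_X ^ card S) * fps_X ^ omega_deg S) * inv_series 0) i"
      by simp
  qed
  also have "fps_to_fls \<dots> = form_numerator n * fps_to_fls (inv_series 0)"
  proof -
    have const: "fls_const (fls_X ^ k) = (var_s ^ k :: bi_series)" for k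
      by (simp add: var_s_def fls_const_power)
    have "fps_to_fls (\<Sum>S\<in>F. fps_const (fls_X ^ card S :: rat fls) * fps_X ^ omega_deg S) =
        (\<Sum>S\<in>F. var_s ^ card S * var_t ^ omega_deg S)" if "finite F" for F
      using that
      by (induction F) (simp_all add: fps_to_fls_power fls_times_fps_to_fls const var_t_def)
    then show ?thesis by (simp add: fls_times_fps_to_fls form_numerator_def)
  qed
  finally show ?thesis .
qed

lemma inv_series_fls:
  "fps_to_fls (inv_series 0) * (\<Prod>b<n. 1 - var_t ^ (q ^ block_end I b - q ^ b)) = (1 :: bi_series)"
proof -
  have "fps_to_fls (\<Prod>b\<in>B. 1 - fps_X ^ f b) = (\<Prod>b\<in>B. 1 - var_t ^ f b :: bi_series)"
    if "finite B" for B :: "nat set" and f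
    using that by (induction B) (simp_all add: fls_times_fps_to_fls fps_to_fls_power var_t_def)
  then have "fps_to_fls (inv_series 0 * (\<Prod>b = 0..<n. 1 - fps_X ^ (q ^ (block_end I b - 0) - q ^ (b - 0)))) =
      fps_to_fls (inv_series 0) * (\<Prod>b<n. 1 - var_t ^ (q ^ block_end I b - q ^ b) :: bi_series)"
    by (simp add: fls_times_fps_to_fls atLeast0LessThan)
  then show ?thesis unfolding inv_series_product[OF le0] by simp
qed

lemma block_end_conv:
  assumes "i < length I" "partial_sum I i \<le> b" "b < partial_sum I (Suc i)"
  shows "block_end I b = partial_sum I (Suc i)"
  using block_index_unique[OF assms(2,3)] by (simp add: block_end_def)

text \<open>Inside a block ending at \<open>m\<close> the index \<open>b\<close> is counted from the
  end, \<open>b = m - j\<close>.\<close>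

lemma denominator_conv:
  "i \<le> length I \<Longrightarrow> (\<Prod>b<partial_sum I i. 1 - var_t ^ (q ^ block_end I b - q ^ b)) =
    (\<Prod>i = 1..i. \<Prod>j = 1..I ! (i - 1). 1 - var_t ^ (q ^ partial_sum I i - q ^ (partial_sum I i - j)))"
proof (induction i)
  case (Suc i)
  let ?f = "\<lambda>b. 1 - var_t ^ (q ^ block_end I b - q ^ b)" and ?m = "partial_sum I (Suc i)"
  have le: "partial_sum I i \<le> ?m" by (rule partial_sum_mono) simp
  have m: "?m = partial_sum I i + I ! i" using Suc.prems by (simp add: partial_sum_Suc)
  have "(\<Prod>b<?m. ?f b) = (\<Prod>b<partial_sum I i. ?f b) * (\<Prod>b = partial_sum I i..<?m. ?f b)"
    using prod.atLeastLessThan_concat[of 0 "partial_sum I i" ?m ?f] le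
      by (simp add: atLeast0LessThan)
  also have "(\<Prod>b = partial_sum I i..<?m. ?f b) =
      (\<Prod>j = 1..I ! i. 1 - var_t ^ (q ^ ?m - q ^ (?m - j)))"
    by (rule prod.reindex_bij_witness[of _ "\<lambda>j. ?m - j" "\<lambda>b. ?m - b"])
      (use m block_end_conv[of i] Suc.prems in auto)
  finally show ?case using Suc by simp
qed simp

definition form_product :: "nat \<Rightarrow> bi_series" where
  "form_product m = (\<Prod>j<m. 1 + var_s * var_t powi (- int (q ^ j)))"

lemma form_product_conv:
  "form_product m = (\<Sum>S\<in>Pow {..<m}. var_s ^ card S * var_t powi (- int (\<Sum>j\<in>S. q ^ j)))"
proof -
  have t: "var_t \<noteq> 0" by (simp add: var_t_def)
  have "(\<Prod>j\<in>S. var_s * var_t powi (- int (q ^ j))) =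
      var_s ^ card S * var_t powi (- int (\<Sum>j\<in>S. q ^ j))"
    if "finite S" for S
    using that by (induction S) (simp_all add: power_int_diff t power_int_minus power_int_add divide_simps)
  then show ?thesis
    unfolding form_product_def prod_one_plus[OF finite_lessThan]
      by (intro sum.cong) (auto intro: finite_subset)
qed

text \<open>Sets are grouped by the block of their maximum. Those new at block \<open>i\<close> all
  have the same \<open>end_of\<close>, so \<open>t\<close> to the power \<open>q^m - 1\<close>
  factors out, and the rest is a difference of two full products.\<close>

lemma form_numerator_conv:
  "i \<le> length I \<Longrightarrow> form_numerator (partial_sum I i) =
    1 + (\<Sum>i = 1..i. var_t ^ (q ^ partial_sum I i - 1) * (form_product (partial_sum I i) - form_product (partial_sum I (i - 1))))"
proof (induction i)
  case 0
  then show ?case by (simp add: form_numerator_def omega_deg_def end_of_def)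
next
  case (Suc i)
  have t: "var_t \<noteq> 0" by (simp add: var_t_def)
  let ?m = "partial_sum I (Suc i)" and ?P = "Pow {..<partial_sum I i}" and ?Q =
    "Pow {..<partial_sum I (Suc i)}"
  let ?g = "\<lambda>S. var_s ^ card S * var_t ^ omega_deg S"
    and ?h = "\<lambda>S. var_s ^ card S * var_t powi (- int (\<Sum>j\<in>S. q ^ j))"
  have le: "partial_sum I i \<le> ?m" by (rule partial_sum_mono) simp
  then have PQ: "?P \<subseteq> ?Q" by auto
  have g: "?g S = var_t ^ (q ^ ?m - 1) * ?h S" if S: "S \<in> ?Q - ?P" for S
  proof -
    have fin: "finite S" "S \<noteq> {}" using S finite_subset[of S] by auto
    have Sn: "S \<subseteq> {..<n}" using S partial_sum_le[of I "Suc i"] by (auto simp: n_def)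
    have "Max S < ?m" using Max_in[OF fin] S by auto
    moreover have "partial_sum I i \<le> Max S"
    proof (rule ccontr)
      assume "\<not> partial_sum I i \<le> Max S"
      then have "S \<subseteq> {..<partial_sum I i}" using Max_ge[OF fin(1)] by fastforce
      then show False using S by simp
    qed
    ultimately have e: "end_of S = ?m" using fin(2) block_end_conv[of i "Max S"] Suc.prems
      by (simp add: end_of_def)
    have le: "(\<Sum>j\<in>S. q ^ j) \<le> q ^ ?m - 1" using sum_le_end_of[OF Sn] by (simp add: e)
    have "int (omega_deg S) = int (q ^ ?m - 1) + - int (\<Sum>j\<in>S. q ^ j)"
      using le unfolding omega_deg_def e by linarith
    then have "var_t powi int (omega_deg S) = var_t powi (int (q ^ ?m - 1) + - int (\<Sum>j\<in>S. q ^ j))"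
      by (rule arg_cong)
    also have "\<dots> = var_t powi int (q ^ ?m - 1) * var_t powi (- int (\<Sum>j\<in>S. q ^ j))"
      by (rule power_int_add) (simp add: t)
    finally show ?thesis by (simp only: power_int_of_nat mult_ac)
  qed
  have "form_numerator ?m = (\<Sum>S\<in>?P. ?g S) + (\<Sum>S\<in>?Q - ?P. ?g S)"
    unfolding form_numerator_def using sum.subset_diff[OF PQ, of ?g] by (simp add: add.commute)
  also have "(\<Sum>S\<in>?Q - ?P. ?g S) = var_t ^ (q ^ ?m - 1) * (\<Sum>S\<in>?Q - ?P. ?h S)"
    unfolding sum_distrib_left by (rule sum.cong[OF refl g])
  also have "(\<Sum>S\<in>?Q - ?P. ?h S) = form_product ?m - form_product (partial_sum I i)"
    unfolding form_product_conv using PQ by (subst sum_diff) auto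
  finally show ?case using Suc by (simp add: form_numerator_def)
qed

end

theorem theorem3p3:
  fixes p r q n :: nat and I :: "nat list" and t s :: bi_series
  assumes "prime p" and "r \<ge> 1" and "q = p ^ r"
    and "card (UNIV :: 'k::{field, finite} set) = q"
    and "n \<ge> 1" and "composition I n"
  defines "t \<equiv> var_t" and "s \<equiv> var_s" and "m \<equiv> partial_sum I" and "l \<equiv> length I"
  shows "hilbert_series TYPE('k) I =
    (1 - t ^ (q ^ m 1 - 1)
     + (\<Sum>i = 1..l - 1. (t ^ (q ^ m i - 1) - t ^ (q ^ m (i + 1) - 1))
          * (\<Prod>j = 1..m i. 1 + s * t powi (- int (q ^ (j - 1)))))
     + t ^ (q ^ n - 1) * (\<Prod>j = 1..n. 1 + s * t powi (- int (q ^ (j - 1)))))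
    / (\<Prod>i = 1..l. \<Prod>j = 1..I ! (i - 1). 1 - t ^ (q ^ m i - q ^ (m i - j)))"
proof -
  \<comment> \<open>The cardinality of the field is zero in the field, which identifies
    \<open>p\<close> as its characteristic.\<close>
  have "CHAR('k) dvd p ^ r"
    using of_nat_card_UNIV[where 'k = 'k] assms(3,4) by (simp only: of_nat_eq_0_iff_char_dvd)
  then have "CHAR('k) dvd p" by (rule prime_dvd_power[OF prime_CHAR_finite_field])
  then have "CHAR('k) = p" using primes_dvd_imp_eq prime_CHAR_finite_field assms(1) by blast
  then have char: "\<exists>r. q = CHAR('k) ^ r" using assms(3) by blast
  interpret parabolic_field q "TYPE('k)" I n
    by unfold_locales (use assms(4,6) char in \<open>auto simp: composition_def\<close>)
  have E: "(\<Prod>j = 1..m. 1 + s * t powi (- int (q ^ (j - 1)))) = form_product m" for m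
    unfolding form_product_def s_def t_def
    by (rule prod.reindex_bij_witness[of _ Suc "\<lambda>j. j - 1"]) auto
  have l: "l \<ge> 1" using assms(5,6) by (cases I) (auto simp: l_def composition_def)
  have n: "n = m l" by (simp add: m_def l_def n_def)
  have "form_numerator n = 1 + (\<Sum>i = 1..l. t ^ (q ^ m i - 1) * (form_product (m i) - form_product (m (i - 1))))"
    unfolding n using form_numerator_conv[of l] by (simp add: l_def m_def t_def)
  also have "\<dots> = 1 - t ^ (q ^ m 1 - 1)
      + (\<Sum>i = 1..l - 1. (t ^ (q ^ m i - 1) - t ^ (q ^ m (i + 1) - 1)) * form_product (m i))
      + t ^ (q ^ m l - 1) * form_product (m l)"
    by (rule sum_telescope_weights[OF _ l]) (simp add: m_def form_product_def)
  finally have num: "form_numerator n = \<dots>" .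
  let ?D = "\<Prod>i = 1..l. \<Prod>j = 1..I ! (i - 1). 1 - t ^ (q ^ m i - q ^ (m i - j))"
  have eq: "fps_to_fls (inv_series 0) * ?D = 1"
    using inv_series_fls denominator_conv[of l] unfolding n by (simp add: l_def m_def t_def)
  then have "?D \<noteq> 0" by (rule contrapos_pn) (simp only: mult_zero_right zero_neq_one not_False_eq_True)
  then have "fps_to_fls (inv_series 0) = 1 / ?D" using eq by (simp only: nonzero_eq_divide_eq not_False_eq_True)
  then have "hilbert_series TYPE('k) I = form_numerator n / ?D" by (simp add: hilbert_series_conv)
  then show ?thesis unfolding E num n[symmetric] .
qed

end
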